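(* Suppose that: (1) for some $\bar p>0$ there exist a symmetric positive-definite matrix $Q\in\mathbb R^{n\times n}$ (the same for all states) and constants $\alpha_i\in\mathbb R$ such that for each $i\in\mathbb S$ $$\limsup_{|x|\to\infty}\frac{(1+x^TQx)\psi(x,i)-(2-\bar p)|x^TQg(x,i)|^2}{(x^TQx)^2}\le\alpha_i,$$ where $\psi(x,i):=2x^TQf(x,i)+\mathrm{trace}[g^T(x,i)Qg(x,i)]$; (2) there exist $\rho>0$ and constants $\beta_i\in\mathbb R$ such that for all $x,y\in\mathbb R^n$, $i\in\mathbb S$, $$|x-y|^2\psi(x,y,i)-(2-\rho)|(x-y)^TG(x,y,i)|^2\le\beta_i|x-y|^4,$$ where $F(x,y,i)=f(x,i)-f(y,i)$, $G(x,y,i)=g(x,i)-g(y,i)$ and $\psi(x,y,i)=2(x-y)^TF(x,y,i)+|G(x,y,i)|^2$; (3) $\sum_{i}\pi_i\alpha_i<0$ and $\sum_i\pi_i\beta_i<0$. Then there is a constant $\Delta^{**}\in(0,1]$ such that for any $\Delta\in(0,\Delta^{**}]$ the numerical solutions $(Z_k,r_k)$ of the truncated Euler–Maruyama scheme with stepsize $\Delta$ admit a unique invariant measure $\mu^\Delta\in\mathcal P(\mathbb R^n\times\mathbb S)$.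
   Context: Notation: $|\cdot|$ is the Euclidean norm on $\mathbb R^n$ and the trace norm $|A|=\sqrt{\mathrm{trace}(A^TA)}$ on matrices; $a\vee b=\max\{a,b\}$, $a\wedge b=\min\{a,b\}$; for a family $(c_i)_{i\in\mathbb S}$, $\check c=\max_i c_i$; $\mathbb R_+=[0,\infty)$; $\mathcal P(\mathbb R^n\times\mathbb S)$ is the set of probability measures on $\mathbb R^n\times\mathbb S$. System: $(\Omega,\mathcal F,\mathbb P)$ is a complete probability space with a filtration $\{\mathcal F_t\}_{t\ge0}$ satisfying the usual conditions; $B(t)$ is a $d$-dimensional Brownian motion and $r(t)$ is a right-continuous Markov chain with finite state space $\mathbb S=\{1,\dots,m\}$ and generator $\Gamma=(\gamma_{ij})_{m\times m}$ ($\gamma_{ij}\ge0$ for $i\ne j$, $\gamma_{ii}=-\sum_{j\ne i}\gamma_{ij}$), independent of $B$; both are adapted to (and are a Brownian motion, resp. a Markov chain, relative to) $\{\mathcal F_t\}$. The chain is irreducible, i.e. $\pi\Gamma=0$, $\sum_i\pi_i=1$ has a unique solution $\pi=(\pi_1,\dots,\pi_m)$, with all $\pi_i>0$. The switching diffusion system is $dX(t)=f(X(t),r(t))dt+g(X(t),r(t))dB(t)$, $(X(0),r(0))=(x_0,\ell)$, where $f:\mathbb R^n\times\mathbb S\to\mathbb R^n$, $g:\mathbb R^n\times\mathbb S\to\mathbb R^{n\times d}$ are locally Lipschitz in $x$ for each $i$. Truncated Euler–Maruyama scheme: for each $i\in\mathbb S$ choose a strictly increasing continuous $\bar\varphi_i:\mathbb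 R_+\to\mathbb R_+$ with $\bar\varphi_i(u)\to\infty$ as $u\to\infty$ and $\sup_{|x|\vee|y|\le u,\,x\ne y}\big(\frac{|f(x,i)-f(y,i)|}{|x-y|}\vee\frac{|g(x,i)-g(y,i)|^2}{|x-y|^2}\big)\le\bar\varphi_i(u)$ for all $u\ge1$; $\bar\varphi_i^{-1}:[\bar\varphi_i(1),\infty)\to\mathbb R_+$ is its inverse. (If for a state $i$, $|f(x,i)-f(y,i)|\le C|x-y|$ and $|g(x,i)-g(y,i)|^2\le C|x-y|^2$ for all $x,y$, one may instead take $\bar\varphi_i\equiv C$, $\bar\varphi_i^{-1}\equiv+\infty$ on $[C,\infty)$.) Choose a strictly decreasing $\bar h:(0,1]\to[\check{\bar\varphi}(|x_0|\vee1),\infty)$ with $\bar h(1)\ge\max_{i}\{|f(\mathbf 0,i)|\vee|g(\mathbf 0,i)|^2\}$, $\lim_{\Delta\to0}\bar h(\Delta)=\infty$ and $\Delta^{1/2-\bar\theta}\bar h(\Delta)\le K$ for all $\Delta\in(0,1]$, for some $0<\bar\theta<\frac12$ and a constant $K>0$; the same $\bar\varphi_i,\bar h$ are used when the scheme is started from other initial data. Set $\bar\pi^i_\Delta(x)=(|x|\wedge\bar\varphi_i^{-1}(\bar h(\Delta)))\frac{x}{|x|}$, with $\frac{x}{|x|}=\mathbf 0$ if $x=\mathbf 0$. With $t_k=k\Delta$, $r_k=r(t_k)$, $\Delta B_k=B(t_{k+1})-B(t_k)$, define $\tilde Z_0=x_0$, $r_0=\ell$, and for $k\ge0$: $Z_k=\bar\pi_\Delta^{r_k}(\tilde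 Z_k)$, $\tilde Z_{k+1}=Z_k+f(Z_k,r_k)\Delta+g(Z_k,r_k)\Delta B_k$. Numerical invariant measure: let $\mathbf P^\Delta_{k\Delta}(x,i;\cdot)$ be the transition probability kernel of the time-homogeneous Markov chain $(Z_k,r_k)$ started from $(x,i)$. $\mu^\Delta\in\mathcal P(\mathbb R^n\times\mathbb S)$ is invariant if $\mu^\Delta(\Upsilon\times\{\ell\})=\sum_{i=1}^m\int_{\mathbb R^n}\mathbf P^\Delta_{k\Delta}(x,i;\Upsilon\times\{\ell\})\mu^\Delta(dx\times\{i\})$ for all $k\ge0$, Borel $\Upsilon\subseteq\mathbb R^n$, $\ell\in\mathbb S$. *)

theory Defs
  imports "HOL-Probability.Probability"
begin

section \<open>Stochastic basis, Brownian motion and Markov chain\<close>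

text \<open>Only the time set \<open>{0..}\<close> matters: values of \<open>F\<close> at negative times are unconstrained.\<close>

definition usual_filtration :: "'w measure \<Rightarrow> (real \<Rightarrow> 'w measure) \<Rightarrow> bool" where
  "usual_filtration M F \<longleftrightarrow>
     (\<forall>t\<ge>0. subalgebra M (F t)) \<and>
     (\<forall>s t. 0 \<le> s \<and> s \<le> t \<longrightarrow> sets (F s) \<subseteq> sets (F t)) \<and>
     null_sets M \<subseteq> sets (F 0) \<and>
     (\<forall>t\<ge>0. sets (F t) = (\<Inter>s\<in>{t<..}. sets (F s)))"

definition brownian_motion ::
  "'w measure \<Rightarrow> (real \<Rightarrow> 'w measure) \<Rightarrow> (real \<Rightarrow> 'w \<Rightarrow> real ^ 'd) \<Rightarrow> bool" where
  "brownian_motion M F B \<longleftrightarrow>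
     (\<forall>t\<ge>0. B t \<in> measurable (F t) borel) \<and>
     (AE \<omega> in M. B 0 \<omega> = 0) \<and>
     (AE \<omega> in M. continuous_on {0..} (\<lambda>t. B t \<omega>)) \<and>
     (\<forall>s t. 0 \<le> s \<and> s < t \<longrightarrow>
        distributed M lborel (\<lambda>\<omega>. B t \<omega> - B s \<omega>)
          (\<lambda>x. ennreal (\<Prod>j\<in>UNIV. normal_density 0 (sqrt (t - s)) (x $ j))) \<and>
        prob_space.indep_set M (sets (F s))
          (sets (vimage_algebra (space M) (\<lambda>\<omega>. B t \<omega> - B s \<omega>) borel)))"

definition generator_matrix :: "real ^ 'm ^ 'm \<Rightarrow> bool" where
  "generator_matrix \<Gamma> \<longleftrightarrow>
     (\<forall>i j. i \<noteq> j \<longrightarrow> 0 \<le> \<Gamma> $ i $ j) \<and>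
     (\<forall>i. \<Gamma> $ i $ i = - (\<Sum>j\<in>UNIV - {i}. \<Gamma> $ i $ j))"

definition stationary_vector :: "real ^ 'm ^ 'm \<Rightarrow> real ^ 'm \<Rightarrow> bool" where
  "stationary_vector \<Gamma> \<pi> \<longleftrightarrow> \<pi> v* \<Gamma> = 0 \<and> (\<Sum>i\<in>UNIV. \<pi> $ i) = 1"

definition irreducible_generator :: "real ^ 'm ^ 'm \<Rightarrow> bool" where
  "irreducible_generator \<Gamma> \<longleftrightarrow>
     (\<exists>!\<pi>. stationary_vector \<Gamma> \<pi>) \<and>
     (\<forall>\<pi>. stationary_vector \<Gamma> \<pi> \<longrightarrow> (\<forall>i. 0 < \<pi> $ i))"

text \<open>The derivative at \<open>0\<close> (from the right) says
  \<open>P t $ i $ j = (if i = j then 1 else 0) + \<Gamma> $ i $ j * t + o(t)\<close>.\<close>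

definition transition_function :: "real ^ 'm ^ 'm \<Rightarrow> (real \<Rightarrow> real ^ 'm ^ 'm) \<Rightarrow> bool" where
  "transition_function \<Gamma> P \<longleftrightarrow>
     (\<forall>t\<ge>0. \<forall>i. (\<forall>j. 0 \<le> P t $ i $ j) \<and> (\<Sum>j\<in>UNIV. P t $ i $ j) = 1) \<and>
     P 0 = mat 1 \<and>
     (\<forall>s\<ge>0. \<forall>t\<ge>0. P (s + t) = P s ** P t) \<and>
     (P has_vector_derivative \<Gamma>) (at 0 within {0..})"

definition markov_chain ::
  "'w measure \<Rightarrow> (real \<Rightarrow> 'w measure) \<Rightarrow> real ^ 'm ^ 'm \<Rightarrow> (real \<Rightarrow> 'w \<Rightarrow> 'm) \<Rightarrow> bool" where
  "markov_chain M F \<Gamma> r \<longleftrightarrow>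
     (\<forall>t\<ge>0. r t \<in> measurable (F t) (count_space UNIV)) \<and>
     (AE \<omega> in M. \<forall>t\<ge>0. \<forall>\<^sub>F s in at_right t. r s \<omega> = r t \<omega>) \<and>
     (\<exists>P. transition_function \<Gamma> P \<and>
        (\<forall>s t j. 0 \<le> s \<and> s \<le> t \<longrightarrow>
           (AE \<omega> in M. real_cond_exp M (F s) (indicator {\<omega> \<in> space M. r t \<omega> = j}) \<omega>
              = P (t - s) $ r s \<omega> $ j)))"

text \<open>Independence of the processes on \<open>{0..}\<close>, i.e. of the \<open>\<sigma>\<close>-algebras they generate.\<close>

definition indep_processes ::
  "'w measure \<Rightarrow> (real \<Rightarrow> 'w \<Rightarrow> real ^ 'd) \<Rightarrow> (real \<Rightarrow> 'w \<Rightarrow> 'm) \<Rightarrow> bool" where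
  "indep_processes M B r \<longleftrightarrow>
     prob_space.indep_set M
       (sets (vimage_algebra (space M) (\<lambda>\<omega>. \<lambda>t\<in>{0..}. B t \<omega>) (\<Pi>\<^sub>M t\<in>{0..}. borel)))
       (sets (vimage_algebra (space M) (\<lambda>\<omega>. \<lambda>t\<in>{0..}. r t \<omega>) (\<Pi>\<^sub>M t\<in>{0..}. count_space UNIV)))"

section \<open>The functionals of the coefficients\<close>

definition psi ::
  "real ^ 'n ^ 'n \<Rightarrow> (real ^ 'n \<Rightarrow> 'm \<Rightarrow> real ^ 'n) \<Rightarrow> (real ^ 'n \<Rightarrow> 'm \<Rightarrow> real ^ 'd ^ 'n)
     \<Rightarrow> real ^ 'n \<Rightarrow> 'm \<Rightarrow> real" where
  "psi Q f g x i = 2 * (x \<bullet> (Q *v f x i)) + trace (transpose (g x i) ** Q ** g x i)"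

text \<open>Here and below, \<open>norm\<close> on \<open>real ^ 'd ^ 'n\<close> is the trace (Frobenius) norm.\<close>

definition psi_diff ::
  "(real ^ 'n \<Rightarrow> 'm \<Rightarrow> real ^ 'n) \<Rightarrow> (real ^ 'n \<Rightarrow> 'm \<Rightarrow> real ^ 'd ^ 'n)
     \<Rightarrow> real ^ 'n \<Rightarrow> real ^ 'n \<Rightarrow> 'm \<Rightarrow> real" where
  "psi_diff f g x y i = 2 * ((x - y) \<bullet> (f x i - f y i)) + (norm (g x i - g y i))\<^sup>2"

section \<open>The truncated Euler--Maruyama scheme\<close>

text \<open>The two admissible choices of \<open>\<phi>\<close> for a single state with drift \<open>a\<close> and diffusion \<open>b\<close>: a
  strictly increasing local bound, or a constant when the coefficients are globally Lipschitz.\<close>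

definition admissible_bound ::
  "(real ^ 'n \<Rightarrow> real ^ 'n) \<Rightarrow> (real ^ 'n \<Rightarrow> real ^ 'd ^ 'n) \<Rightarrow> (real \<Rightarrow> real) \<Rightarrow> bool" where
  "admissible_bound a b \<phi> \<longleftrightarrow>
     ((\<forall>u\<ge>0. 0 \<le> \<phi> u) \<and> strict_mono_on {0..} \<phi> \<and> continuous_on {0..} \<phi> \<and>
      filterlim \<phi> at_top at_top \<and>
      (\<forall>u\<ge>1. \<forall>x y. max (norm x) (norm y) \<le> u \<and> x \<noteq> y \<longrightarrow>
         max (norm (a x - a y) / norm (x - y)) ((norm (b x - b y))\<^sup>2 / (norm (x - y))\<^sup>2) \<le> \<phi> u))
     \<or> (\<exists>C. (\<forall>u\<ge>0. \<phi> u = C) \<and>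
          (\<forall>x y. norm (a x - a y) \<le> C * norm (x - y) \<and>
                 (norm (b x - b y))\<^sup>2 \<le> C * (norm (x - y))\<^sup>2))"

text \<open>The inverse of \<open>\<phi>\<close>, with value \<open>\<infinity>\<close> for constant \<open>\<phi>\<close>; only used at arguments \<open>v \<ge> \<phi> 1\<close>.\<close>

definition bound_inverse :: "(real \<Rightarrow> real) \<Rightarrow> real \<Rightarrow> ereal" where
  "bound_inverse \<phi> v =
     (if \<exists>C. \<forall>u\<ge>0. \<phi> u = C then \<infinity> else ereal (the_inv_into {0..} \<phi> v))"

text \<open>\<open>sgn x\<close> is \<open>x / |x|\<close>, and \<open>0\<close> for \<open>x = 0\<close>.\<close>

definition truncation :: "(real \<Rightarrow> real) \<Rightarrow> real \<Rightarrow> real ^ 'n \<Rightarrow> real ^ 'n" where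
  "truncation \<phi> v x = real_of_ereal (min (ereal (norm x)) (bound_inverse \<phi> v)) *\<^sub>R sgn x"

definition admissible_step_function ::
  "(real ^ 'n \<Rightarrow> 'm::finite \<Rightarrow> real ^ 'n) \<Rightarrow> (real ^ 'n \<Rightarrow> 'm \<Rightarrow> real ^ 'd ^ 'n)
     \<Rightarrow> ('m \<Rightarrow> real \<Rightarrow> real) \<Rightarrow> real ^ 'n \<Rightarrow> (real \<Rightarrow> real) \<Rightarrow> bool" where
  "admissible_step_function f g \<phi> x0 h \<longleftrightarrow>
     strict_antimono_on {0<..1} h \<and>
     (\<forall>\<Delta>\<in>{0<..1}. (MAX i. \<phi> i (max (norm x0) 1)) \<le> h \<Delta>) \<and>
     (MAX i. max (norm (f 0 i)) ((norm (g 0 i))\<^sup>2)) \<le> h 1 \<and>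
     filterlim h at_top (at_right 0) \<and>
     (\<exists>\<theta> K. 0 < \<theta> \<and> \<theta> < 1/2 \<and> 0 < K \<and> (\<forall>\<Delta>\<in>{0<..1}. \<Delta> powr (1/2 - \<theta>) * h \<Delta> \<le> K))"

text \<open>\<open>Z_pre\<close> is the scheme before truncation, \<open>Z_scheme\<close> the truncated one.\<close>

primrec Z_pre ::
  "(real ^ 'n \<Rightarrow> 'm \<Rightarrow> real ^ 'n) \<Rightarrow> (real ^ 'n \<Rightarrow> 'm \<Rightarrow> real ^ 'd ^ 'n)
     \<Rightarrow> ('m \<Rightarrow> real \<Rightarrow> real) \<Rightarrow> (real \<Rightarrow> real)
     \<Rightarrow> (real \<Rightarrow> 'w \<Rightarrow> real ^ 'd) \<Rightarrow> (real \<Rightarrow> 'w \<Rightarrow> 'm) \<Rightarrow> real \<Rightarrow> real ^ 'n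
     \<Rightarrow> nat \<Rightarrow> 'w \<Rightarrow> real ^ 'n" where
  "Z_pre f g \<phi> h B r \<Delta> x 0 \<omega> = x"
| "Z_pre f g \<phi> h B r \<Delta> x (Suc k) \<omega> =
     (let i = r (real k * \<Delta>) \<omega>;
          z = truncation (\<phi> i) (h \<Delta>) (Z_pre f g \<phi> h B r \<Delta> x k \<omega>)
      in z + \<Delta> *\<^sub>R f z i + g z i *v (B (real (Suc k) * \<Delta>) \<omega> - B (real k * \<Delta>) \<omega>))"

definition Z_scheme ::
  "(real ^ 'n \<Rightarrow> 'm \<Rightarrow> real ^ 'n) \<Rightarrow> (real ^ 'n \<Rightarrow> 'm \<Rightarrow> real ^ 'd ^ 'n)
     \<Rightarrow> ('m \<Rightarrow> real \<Rightarrow> real) \<Rightarrow> (real \<Rightarrow> real)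
     \<Rightarrow> (real \<Rightarrow> 'w \<Rightarrow> real ^ 'd) \<Rightarrow> (real \<Rightarrow> 'w \<Rightarrow> 'm) \<Rightarrow> real \<Rightarrow> real ^ 'n
     \<Rightarrow> nat \<Rightarrow> 'w \<Rightarrow> real ^ 'n" where
  "Z_scheme f g \<phi> h B r \<Delta> x k \<omega> =
     truncation (\<phi> (r (real k * \<Delta>) \<omega>)) (h \<Delta>) (Z_pre f g \<phi> h B r \<Delta> x k \<omega>)"

section \<open>Transition kernel and numerical invariant measure\<close>

abbreviation state_algebra :: "((real ^ 'n) \<times> 'm) measure" where
  "state_algebra \<equiv> borel \<Otimes>\<^sub>M count_space UNIV"

text \<open>The family \<open>r\<close> lists, for every initial state \<open>i\<close>, the switching chain \<open>r i\<close> started from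
  \<open>i\<close>; the kernel at \<open>(x, i)\<close> is the law at step \<open>k\<close> of the scheme started from \<open>(x, i)\<close>.\<close>

definition Z_kernel ::
  "'w measure \<Rightarrow> (real ^ 'n \<Rightarrow> 'm \<Rightarrow> real ^ 'n) \<Rightarrow> (real ^ 'n \<Rightarrow> 'm \<Rightarrow> real ^ 'd ^ 'n)
     \<Rightarrow> ('m \<Rightarrow> real \<Rightarrow> real) \<Rightarrow> (real \<Rightarrow> real)
     \<Rightarrow> (real \<Rightarrow> 'w \<Rightarrow> real ^ 'd) \<Rightarrow> ('m \<Rightarrow> real \<Rightarrow> 'w \<Rightarrow> 'm) \<Rightarrow> real
     \<Rightarrow> nat \<Rightarrow> real ^ 'n \<Rightarrow> 'm \<Rightarrow> ((real ^ 'n) \<times> 'm) measure" where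
  "Z_kernel M f g \<phi> h B r \<Delta> k x i =
     distr M state_algebra (\<lambda>\<omega>. (Z_scheme f g \<phi> h B (r i) \<Delta> x k \<omega>, r i (real k * \<Delta>) \<omega>))"

text \<open>The measure \<open>\<mu>(dx \<times> {i})\<close> on \<open>real ^ 'n\<close>.\<close>

definition slice :: "((real ^ 'n) \<times> 'm) measure \<Rightarrow> 'm \<Rightarrow> (real ^ 'n) measure" where
  "slice \<mu> i = distr (restrict_space \<mu> (UNIV \<times> {i})) borel fst"

definition invariant_measure ::
  "(nat \<Rightarrow> real ^ 'n \<Rightarrow> 'm::finite \<Rightarrow> ((real ^ 'n) \<times> 'm) measure)
     \<Rightarrow> ((real ^ 'n) \<times> 'm) measure \<Rightarrow> bool" where
  "invariant_measure P \<mu> \<longleftrightarrow>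
     prob_space \<mu> \<and> sets \<mu> = sets state_algebra \<and>
     (\<forall>k. \<forall>\<Upsilon>\<in>sets borel. \<forall>l.
        emeasure \<mu> (\<Upsilon> \<times> {l}) =
          (\<Sum>i\<in>UNIV. \<integral>\<^sup>+ x. emeasure (P k x i) (\<Upsilon> \<times> {l}) \<partial>slice \<mu> i))"

end

theory Submission
  imports Defs
begin

text \<open>
  The one-step map of the scheme, written as a random map of the hybrid state space of pairs
  \<open>(x, i)\<close>, contracts a suitable distance on average. Iterating it on independent copies of the
  noise in the backward order therefore converges almost surely, for every starting point and to one
  and the same limit; the law of the limit is the only invariant probability measure. Uniqueness thus
  rests on contraction, not on a smoothing effect of the noise, which may be degenerate.

  The contraction has three sources. First, two copies in the same switching state, driven by the
  same noise: truncation does not increase distances, and a cubic Taylor bound for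
  \<open>t \<mapsto> (1 + t) powr s\<close>, averaged over the symmetric Gaussian law, shows that one step of size
  \<open>\<Delta>\<close> multiplies the mean of \<open>norm (x - y) powr (2 * s)\<close> by at most
  \<open>1 + s * \<Delta> * (\<beta> i + o(1))\<close> as soon as \<open>2 * s \<le> \<rho>\<close> (\<open>em_step_powr_bound\<close>,
  \<open>em_contraction\<close>). The truncation makes the coefficients Lipschitz with constant \<open>h \<Delta>\<close>,
  and the growth condition on \<open>h\<close> makes the error \<open>\<Delta> * (h \<Delta>)\<^sup>2\<close> vanish.

  Secondly, single factors may exceed 1, since only the stationary mean of \<open>\<beta>\<close> is negative. A
  solution of the Poisson equation for the generator supplies weights \<open>\<xi> i \<ge> 1\<close> for which the
  generator plus the multiplication by \<open>s * \<beta> i\<close> is strictly negative on \<open>\<xi>\<close>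
  (\<open>weights_exist\<close>); this is first-order perturbation theory of the principal eigenvalue. The
  transition matrix over a short time \<open>\<Delta>\<close> inherits the strict inequality, so
  \<open>\<xi> i * norm (x - y) powr (2 * s)\<close> contracts.

  Thirdly, for two copies in different switching states: the chain is driven by a random self-map of
  the finite state space with independent values. With positive probability it is constant, which
  merges the two states at once. Charging a large penalty for different states, plus the moment
  functions of the two points, turns this into a contraction as well
  (\<open>weighted_dist_contraction\<close>); the moments are controlled by comparing a trajectory with the one
  started at the origin.

  It remains to identify the iterates of the random map with the given scheme. Independence of the
  two driving processes as a whole, the independent increments of the one and the Markov property of
  the other give the Markov property of the pair (\<open>scheme_markov_property\<close>). The chains for
  different initial states share their transition matrices because a transition function is
  determined by its generator (\<open>transition_function_unique\<close>).
\<close>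

section \<open>Generators and transition functions of finite chains\<close>

lemma generator_row_sum:
  assumes "generator_matrix \<Gamma>"
  shows "(\<Sum>j\<in>UNIV. \<Gamma> $ i $ j) = 0"
proof -
  have "(\<Sum>j\<in>UNIV. \<Gamma> $ i $ j) = \<Gamma> $ i $ i + (\<Sum>j\<in>UNIV - {i}. \<Gamma> $ i $ j)"
    by (rule sum.remove) auto
  then show ?thesis
    using assms unfolding generator_matrix_def by (metis add.left_inverse)
qed

lemma generator_offdiag_nonneg:
  assumes "generator_matrix \<Gamma>" "i \<noteq> j"
  shows "0 \<le> \<Gamma> $ i $ j"
  using assms unfolding generator_matrix_def by blast

lemma stationary_vector_column:
  assumes "stationary_vector \<Gamma> \<pi>"
  shows "(\<Sum>i\<in>UNIV. \<pi> $ i * \<Gamma> $ i $ j) = 0"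
proof -
  have "(\<pi> v* \<Gamma>) $ j = 0" using assms unfolding stationary_vector_def by simp
  then show ?thesis by (simp add: vector_matrix_mult_def mult.commute)
qed

text \<open>A left null vector of total mass zero can be added to \<open>\<pi>\<close> without losing stationarity, and one
  of nonzero mass can be normalised; uniqueness of the stationary vector settles both cases.\<close>

lemma left_kernel_multiple_stationary:
  assumes irr: "irreducible_generator \<Gamma>" and st: "stationary_vector \<Gamma> \<pi>" and z: "z v* \<Gamma> = 0"
  shows "z = (\<Sum>i\<in>UNIV. z $ i) *\<^sub>R \<pi>"
proof (cases "(\<Sum>i\<in>UNIV. z $ i) = 0")
  case True
  have "stationary_vector \<Gamma> (\<pi> + z)"
    using st z True unfolding stationary_vector_def
    by (simp add: vector_matrix_left_distrib sum.distrib)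
  then have "\<pi> + z = \<pi>"
    using irr st unfolding irreducible_generator_def by blast
  then show ?thesis using True by simp
next
  case False
  let ?t = "\<Sum>i\<in>UNIV. z $ i"
  have "stationary_vector \<Gamma> ((1 / ?t) *\<^sub>R z)"
    using st z False unfolding stationary_vector_def
    by (simp add: scaleR_vector_matrix_assoc sum_divide_distrib[symmetric])
  then have "(1 / ?t) *\<^sub>R z = \<pi>"
    using irr st unfolding irreducible_generator_def by blast
  then show ?thesis using False
    by auto
qed

text \<open>Fredholm alternative: the orthogonal complement of the range is the left kernel, which is spanned
  by \<open>\<pi>\<close>.\<close>

lemma poisson_equation_solvable:
  assumes irr: "irreducible_generator \<Gamma>" and st: "stationary_vector \<Gamma> \<pi>"
    and b: "\<pi> \<bullet> b = 0"
  obtains c where "\<Gamma> *v c = b"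
proof -
  let ?S = "range (\<lambda>c. \<Gamma> *v c)"
  have sub: "span ?S = ?S"
    by (simp add: span_eq_iff linear_subspace_image subspace_UNIV)
  obtain y z where y: "y \<in> span ?S" and z: "\<And>w. w \<in> span ?S \<Longrightarrow> orthogonal z w" and byz: "b = y + z"
    using orthogonal_subspace_decomp_exists[of ?S b] by blast
  have "z \<bullet> (\<Gamma> *v c) = 0" for c
    using z[of "\<Gamma> *v c"] sub by (auto simp: orthogonal_def)
  then have "(z v* \<Gamma>) \<bullet> c = 0" for c
    by (simp add: dot_lmul_matrix)
  then have "z v* \<Gamma> = 0" using inner_eq_zero_iff by blast
  from left_kernel_multiple_stationary[OF irr st this] obtain t where t: "z = t *\<^sub>R \<pi>" by blast
  have "z \<bullet> b = 0" using b t by simp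
  moreover have "z \<bullet> y = 0" using z[OF y] by (simp add: orthogonal_def)
  ultimately have "z = 0" using byz by (simp add: inner_add_right)
  then have "b \<in> ?S" using y byz sub by simp
  then show ?thesis using that by auto
qed

text \<open>The stationary flow into a closed class equals the flow out of it, which is zero. So the
  complement is closed too, and \<open>\<pi>\<close> conditioned on \<open>C\<close> would be a stationary vector that
  vanishes somewhere.\<close>

lemma closed_class_eq_UNIV:
  assumes gen: "generator_matrix \<Gamma>" and irr: "irreducible_generator \<Gamma>"
    and ne: "i \<in> C" and closed: "\<And>a b. a \<in> C \<Longrightarrow> 0 < \<Gamma> $ a $ b \<Longrightarrow> b \<in> C"
  shows "C = UNIV"
proof (rule ccontr)
  assume "C \<noteq> UNIV"
  then obtain k where k: "k \<notin> C" by blast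
  obtain \<pi> where st: "stationary_vector \<Gamma> \<pi>" and pos: "\<And>i. 0 < \<pi> $ i"
    using irr unfolding irreducible_generator_def by blast
  have out0: "\<Gamma> $ a $ b = 0" if "a \<in> C" "b \<notin> C" for a b
    using closed[OF that(1), of b] that generator_offdiag_nonneg[OF gen, of a b] by force
  have inC: "(\<Sum>b\<in>C. \<Gamma> $ a $ b) = 0" if "a \<in> C" for a
    using generator_row_sum[OF gen, of a] sum.mono_neutral_left[of UNIV C "\<lambda>b. \<Gamma> $ a $ b"] out0[OF that]
    by auto
  have nn: "0 \<le> (\<Sum>b\<in>C. \<Gamma> $ a $ b)" for a
    by (cases "a \<in> C")
      (auto simp: inC intro!: sum_nonneg generator_offdiag_nonneg[OF gen])
  have "(\<Sum>a\<in>UNIV. \<pi> $ a * (\<Sum>b\<in>C. \<Gamma> $ a $ b)) = (\<Sum>b\<in>C. \<Sum>a\<in>UNIV. \<pi> $ a * \<Gamma> $ a $ b)"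
    by (simp add: sum_distrib_left sum.swap[of _ UNIV])
  also have "\<dots> = 0" using stationary_vector_column[OF st] by simp
  finally have sum0: "(\<Sum>a\<in>UNIV. \<pi> $ a * (\<Sum>b\<in>C. \<Gamma> $ a $ b)) = 0" .
  have "\<pi> $ a * (\<Sum>b\<in>C. \<Gamma> $ a $ b) = 0" for a
    using sum_nonneg_eq_0_iff[THEN iffD1, OF _ _ sum0] nn pos by (simp add: less_imp_le)
  then have "(\<Sum>b\<in>C. \<Gamma> $ a $ b) = 0" for a
    by (metis mult_eq_0_iff less_irrefl pos)
  then have zero: "(\<Sum>b\<in>C. \<Gamma> $ a $ b) = 0" for a by blast
  have in0: "\<Gamma> $ a $ b = 0" if "a \<notin> C" "b \<in> C" for a b
  proof -
    have "\<forall>b\<in>C. \<Gamma> $ a $ b = 0"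
      using zero[of a] that(1)
      by (subst (asm) sum_nonneg_eq_0_iff) (auto intro!: generator_offdiag_nonneg[OF gen])
    then show ?thesis using that by blast
  qed
  define S where "S = (\<Sum>a\<in>C. \<pi> $ a)"
  have S: "0 < S" unfolding S_def using ne pos by (intro sum_pos) auto
  define \<zeta> :: "real ^ 'a" where "\<zeta> = (\<chi> a. if a \<in> C then \<pi> $ a / S else 0)"
  have "(\<Sum>a\<in>UNIV. \<Gamma> $ a $ b * \<zeta> $ a) = 0" for b
  proof (cases "b \<in> C")
    case True
    have "(\<Sum>a\<in>UNIV. \<Gamma> $ a $ b * \<zeta> $ a) = (\<Sum>a\<in>UNIV. \<pi> $ a * \<Gamma> $ a $ b) / S"
      unfolding sum_divide_distrib by (rule sum.cong) (auto simp: \<zeta>_def in0 True)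
    then show ?thesis using stationary_vector_column[OF st] by simp
  next
    case False
    show ?thesis by (rule sum.neutral) (auto simp: \<zeta>_def out0 False)
  qed
  moreover have "(\<Sum>a\<in>UNIV. \<zeta> $ a) = 1"
  proof -
    have "(\<Sum>a\<in>UNIV. \<zeta> $ a) = (\<Sum>a\<in>C. \<pi> $ a / S)"
      by (simp add: \<zeta>_def sum.If_cases)
    then show ?thesis using S by (simp add: S_def sum_divide_distrib[symmetric])
  qed
  ultimately have "stationary_vector \<Gamma> \<zeta>"
    unfolding stationary_vector_def by (simp add: vec_eq_iff vector_matrix_mult_def mult.commute)
  then have "0 < \<zeta> $ k" using irr unfolding irreducible_generator_def by blast
  then show False using k by (simp add: \<zeta>_def)
qed

context
  fixes \<Gamma> :: "real ^ 'm ^ 'm" and P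
  assumes P: "transition_function \<Gamma> P"
begin

lemma transition_nonneg: "0 \<le> t \<Longrightarrow> 0 \<le> P t $ i $ j"
  using P unfolding transition_function_def by blast

lemma transition_row_sum: "0 \<le> t \<Longrightarrow> (\<Sum>j\<in>UNIV. P t $ i $ j) = 1"
  using P unfolding transition_function_def by blast

lemma transition_zero: "P 0 $ i $ j = (if i = j then 1 else 0)"
  using P unfolding transition_function_def by (simp add: mat_def)

lemma transition_add:
  "0 \<le> s \<Longrightarrow> 0 \<le> t \<Longrightarrow> P (s + t) $ i $ j = (\<Sum>k\<in>UNIV. P s $ i $ k * P t $ k $ j)"
  using P unfolding transition_function_def by (simp add: matrix_matrix_mult_def)

lemma transition_product_le:
  assumes "0 \<le> s" "0 \<le> t"
  shows "P s $ i $ k * P t $ k $ j \<le> P (s + t) $ i $ j"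
  unfolding transition_add[OF assms]
  by (rule member_le_sum) (auto intro!: mult_nonneg_nonneg transition_nonneg assms)

lemma transition_derivative:
  "((\<lambda>t. (P t $ i $ j - (if i = j then 1 else 0)) / t) \<longlongrightarrow> \<Gamma> $ i $ j) (at_right 0)"
proof -
  have "((\<lambda>t. P t $ i $ j) has_vector_derivative \<Gamma> $ i $ j) (at 0 within {0..})"
    using P unfolding transition_function_def
    by (auto intro!: bounded_linear.has_vector_derivative[OF bounded_linear_vec_nth])
  then have "((\<lambda>t. P t $ i $ j) has_real_derivative \<Gamma> $ i $ j) (at 0 within {0..})"
    by (simp add: has_real_derivative_iff_has_vector_derivative)
  then have "((\<lambda>t. (P t $ i $ j - P 0 $ i $ j) / (t - 0)) \<longlongrightarrow> \<Gamma> $ i $ j) (at 0 within {0..})"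
    by (simp add: has_field_derivative_iff)
  moreover have "at (0::real) within {0..} = at_right 0"
    by (metis at_within_Ici_at_right)
  ultimately show ?thesis by (simp add: transition_zero)
qed

lemma transition_continuous:
  "((\<lambda>t. P t $ i $ j) \<longlongrightarrow> (if i = j then 1 else 0)) (at_right 0)"
proof -
  let ?c = "if i = j then 1 else 0 :: real"
  have "((\<lambda>t. (P t $ i $ j - ?c) / t * t + ?c) \<longlongrightarrow> \<Gamma> $ i $ j * 0 + ?c) (at_right 0)"
    by (intro tendsto_intros transition_derivative)
  moreover have "\<forall>\<^sub>F t in at_right 0. (P t $ i $ j - ?c) / t * t + ?c = P t $ i $ j"
    by (auto simp: eventually_at_right_less eventually_at_filter)
  ultimately show ?thesis by (simp add: tendsto_cong)
qed

text \<open>For small times the diagonal is close to 1, and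
  \<open>P t $ i $ i \<ge> (P (t / n) $ i $ i) ^ n\<close>.\<close>

lemma transition_diag_pos:
  assumes t: "0 < t"
  shows "0 < P t $ i $ i"
proof -
  have "\<forall>\<^sub>F t in at_right 0. 0 < P t $ i $ i"
    using order_tendstoD(1)[OF transition_continuous[of i i], of 0] by simp
  then obtain b where b: "0 < b" and small: "\<And>u. 0 < u \<Longrightarrow> u < b \<Longrightarrow> 0 < P u $ i $ i"
    unfolding eventually_at_right_field by auto
  obtain n :: nat where n: "t / b < real n" using reals_Archimedean2 by blast
  then have n0: "0 < real n" using t b by (meson divide_pos_pos less_trans)
  define u where "u = t / real n"
  have u: "0 < u" "u < b" using n n0 t b unfolding u_def by (auto simp: field_simps)
  have "0 < P (real k * u) $ i $ i" for k
  proof (induction k)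
    case 0
    then show ?case by (simp add: transition_zero)
  next
    case (Suc k)
    have "0 < P (real k * u) $ i $ i * P u $ i $ i" using Suc small[OF u] by simp
    also have "\<dots> \<le> P (real k * u + u) $ i $ i"
      by (rule transition_product_le) (use u in auto)
    finally show ?case by (simp add: algebra_simps)
  qed
  from this[of n] show ?thesis using n0 by (simp add: u_def)
qed

text \<open>The states that are reached from \<open>i\<close> at all positive times form a closed class: a jump of
  positive rate can be made within an arbitrarily short final piece of the time interval.\<close>

lemma transition_pos:
  assumes gen: "generator_matrix \<Gamma>" and irr: "irreducible_generator \<Gamma>" and t: "0 < t"
  shows "0 < P t $ i $ j"
proof -
  have "{j. \<forall>s>0. 0 < P s $ i $ j} = UNIV"
  proof (rule closed_class_eq_UNIV[OF gen irr])
    show "i \<in> {j. \<forall>s>0. 0 < P s $ i $ j}" using transition_diag_pos by simp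
    fix a b assume a: "a \<in> {j. \<forall>s>0. 0 < P s $ i $ j}" and ab: "0 < \<Gamma> $ a $ b"
    have "0 < P s $ i $ b" if s: "0 < s" for s
    proof (cases "a = b")
      case True
      then show ?thesis using a s by auto
    next
      case False
      have "\<forall>\<^sub>F u in at_right 0. 0 < (P u $ a $ b - (if a = b then 1 else 0)) / u"
        by (rule order_tendstoD(1)[OF transition_derivative ab])
      moreover have "\<forall>\<^sub>F u in at_right 0. 0 < u \<and> u < s"
        using s eventually_at_right_field by blast
      ultimately have "\<forall>\<^sub>F u in at_right 0. 0 < P u $ a $ b \<and> 0 < u \<and> u < s"
        by eventually_elim (use False in \<open>auto simp: zero_less_divide_iff\<close>)
      then obtain u where u: "0 < P u $ a $ b" "0 < u" "u < s"
        using eventually_happens' trivial_limit_at_right_real by blast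
      have "0 < P (s - u) $ i $ a * P u $ a $ b" using a u by simp
      also have "\<dots> \<le> P ((s - u) + u) $ i $ b"
        by (rule transition_product_le) (use u in auto)
      finally show ?thesis by simp
    qed
    then show "b \<in> {j. \<forall>s>0. 0 < P s $ i $ j}" by simp
  qed
  then show ?thesis using t by blast
qed

end

definition row_dist :: "real ^ 'm ^ 'm \<Rightarrow> real ^ 'm ^ 'm \<Rightarrow> 'm \<Rightarrow> real" where
  "row_dist A B i = (\<Sum>j\<in>UNIV. \<bar>A $ i $ j - B $ i $ j\<bar>)"

text \<open>Telescoping one factor at a time; multiplication by a stochastic matrix from the right does not
  increase the row distance, and from the left it averages rows.\<close>

lemma row_dist_add_le:
  assumes P: "transition_function \<Gamma> P" and P': "transition_function \<Gamma> P'" and u: "0 \<le> u" and v: "0 \<le> v"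
  shows "row_dist (P (u + v)) (P' (u + v)) i \<le> row_dist (P u) (P' u) i + (\<Sum>k\<in>UNIV. row_dist (P v) (P' v) k)"
proof -
  have entry: "\<bar>P (u + v) $ i $ j - P' (u + v) $ i $ j\<bar>
     \<le> (\<Sum>k\<in>UNIV. \<bar>P u $ i $ k - P' u $ i $ k\<bar> * P' v $ k $ j + \<bar>P v $ k $ j - P' v $ k $ j\<bar>)" for j
  proof -
    have eq: "P (u + v) $ i $ j - P' (u + v) $ i $ j
        = (\<Sum>k\<in>UNIV. (P u $ i $ k - P' u $ i $ k) * P' v $ k $ j + P u $ i $ k * (P v $ k $ j - P' v $ k $ j))"
      unfolding transition_add[OF P u v] transition_add[OF P' u v] sum_subtractf[symmetric]
      by (simp add: algebra_simps)
    show ?thesis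
      unfolding eq
    proof (rule order_trans[OF sum_abs sum_mono])
      fix k
      have "P u $ i $ k \<le> (\<Sum>k\<in>UNIV. P u $ i $ k)"
        by (rule member_le_sum) (auto intro: transition_nonneg[OF P u])
      then have "\<bar>P u $ i $ k * (P v $ k $ j - P' v $ k $ j)\<bar> \<le> \<bar>P v $ k $ j - P' v $ k $ j\<bar>"
        using transition_row_sum[OF P u] transition_nonneg[OF P u, of i k]
        by (simp add: abs_mult mult_left_le_one_le)
      moreover have "\<bar>(P u $ i $ k - P' u $ i $ k) * P' v $ k $ j\<bar> = \<bar>P u $ i $ k - P' u $ i $ k\<bar> * P' v $ k $ j"
        using transition_nonneg[OF P' v, of k j] by (simp add: abs_mult)
      ultimately show "\<bar>(P u $ i $ k - P' u $ i $ k) * P' v $ k $ j + P u $ i $ k * (P v $ k $ j - P' v $ k $ j)\<bar>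
          \<le> \<bar>P u $ i $ k - P' u $ i $ k\<bar> * P' v $ k $ j + \<bar>P v $ k $ j - P' v $ k $ j\<bar>"
        using abs_triangle_ineq[of "(P u $ i $ k - P' u $ i $ k) * P' v $ k $ j"] by linarith
    qed
  qed
  have "row_dist (P (u + v)) (P' (u + v)) i
      \<le> (\<Sum>k\<in>UNIV. \<Sum>j\<in>UNIV. \<bar>P u $ i $ k - P' u $ i $ k\<bar> * P' v $ k $ j + \<bar>P v $ k $ j - P' v $ k $ j\<bar>)"
    unfolding row_dist_def by (subst sum.swap) (rule sum_mono[OF entry])
  also have "\<dots> = row_dist (P u) (P' u) i + (\<Sum>k\<in>UNIV. row_dist (P v) (P' v) k)"
    by (simp add: sum.distrib sum_distrib_left[symmetric] transition_row_sum[OF P' v] row_dist_def)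
  finally show ?thesis .
qed

text \<open>Subadditivity bounds the distance at time \<open>t\<close> by \<open>n\<close> times the distance at time
  \<open>t / n\<close>, and the latter is \<open>o(1 / n)\<close> because both derivatives at 0 are \<open>\<Gamma>\<close>. The
  statement is needed because every initial state comes with a Markov chain, and hence with a
  transition function, of its own.\<close>

lemma transition_function_unique:
  fixes \<Gamma> :: "real ^ 'm ^ 'm"
  assumes P: "transition_function \<Gamma> P" and P': "transition_function \<Gamma> P'" and t: "0 \<le> t"
  shows "P t = P' t"
proof (cases "t = 0")
  case True
  then show ?thesis using P P' unfolding transition_function_def by simp
next
  case False
  with t have t: "0 < t" by simp
  define d where "d u = (\<Sum>i\<in>UNIV. row_dist (P u) (P' u) i)" for u
  let ?I = "\<lambda>i j. if i = j then 1 else 0 :: real"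
  have mult: "row_dist (P (real n * u)) (P' (real n * u)) i \<le> real n * d u" if u: "0 \<le> u" for u n i
  proof (induction n)
    case 0
    then show ?case by (simp add: row_dist_def transition_zero[OF P] transition_zero[OF P'])
  next
    case (Suc n)
    show ?case using row_dist_add_le[OF P P', of "real n * u" u i] Suc u by (simp add: d_def algebra_simps)
  qed
  have "((\<lambda>u. \<Sum>i\<in>UNIV. \<Sum>j\<in>UNIV. \<bar>(P u $ i $ j - ?I i j) / u - (P' u $ i $ j - ?I i j) / u\<bar>)
      \<longlongrightarrow> (\<Sum>i\<in>UNIV. \<Sum>j\<in>UNIV. \<bar>\<Gamma> $ i $ j - \<Gamma> $ i $ j\<bar>)) (at_right 0)"
    by (intro tendsto_intros transition_derivative P P')
  moreover have "\<forall>\<^sub>F u in at_right 0.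
      (\<Sum>i\<in>UNIV. \<Sum>j\<in>UNIV. \<bar>(P u $ i $ j - ?I i j) / u - (P' u $ i $ j - ?I i j) / u\<bar>) = d u / u"
    using eventually_at_right_less[of 0]
    by eventually_elim
      (simp add: d_def row_dist_def sum_divide_distrib diff_divide_distrib[symmetric] abs_divide)
  ultimately have lim: "((\<lambda>u. d u / u) \<longlongrightarrow> 0) (at_right 0)" by (simp add: tendsto_cong)
  have flt: "filterlim (\<lambda>n. t / real (Suc n)) (at_right 0) sequentially"
  proof (subst filterlim_at, intro conjI)
    show "((\<lambda>n. t / real (Suc n)) \<longlongrightarrow> 0) sequentially"
      using LIMSEQ_Suc[OF lim_const_over_n[of t]] by simp
    show "\<forall>\<^sub>F n in sequentially. t / real (Suc n) \<in> {0<..} \<and> t / real (Suc n) \<noteq> 0"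
      using t by simp
  qed
  have le: "row_dist (P t) (P' t) i \<le> t * (d (t / real (Suc n)) / (t / real (Suc n)))" for i n
    using mult[of "t / real (Suc n)" "Suc n" i] t by (simp del: of_nat_Suc add: mult.commute)
  have "(\<lambda>n. t * (d (t / real (Suc n)) / (t / real (Suc n)))) \<longlonglongrightarrow> t * 0"
    by (intro tendsto_intros filterlim_compose[OF lim flt])
  from LIMSEQ_le_const[OF this] le have "row_dist (P t) (P' t) i \<le> 0" for i by auto
  then have "\<bar>P t $ i $ j - P' t $ i $ j\<bar> \<le> 0" for i j
    unfolding row_dist_def using member_le_sum[of j UNIV "\<lambda>j. \<bar>P t $ i $ j - P' t $ i $ j\<bar>"]
    by (meson UNIV_I abs_ge_zero finite order_trans DiffD1)
  then show ?thesis by (simp add: vec_eq_iff)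
qed

section \<open>Moments of the Gaussian noise\<close>

text \<open>The centred normal law on \<open>real ^ 'd\<close> with covariance \<open>\<sigma>\<^sup>2\<close> times the identity.\<close>

definition gaussian_noise :: "real \<Rightarrow> (real ^ 'd) measure" where
  "gaussian_noise \<sigma> = density lborel (\<lambda>x. ennreal (\<Prod>j\<in>UNIV. normal_density 0 \<sigma> (x $ j)))"

lemma sets_gaussian_noise [measurable_cong]: "sets (gaussian_noise \<sigma>) = sets borel"
  by (simp add: gaussian_noise_def)

lemma prod_Basis_vec:
  "(\<Prod>b\<in>(Basis :: (real ^ 'd) set). F b) = (\<Prod>j\<in>UNIV. F (axis j 1))"
proof -
  have B: "(Basis :: (real ^ 'd) set) = range (\<lambda>j. axis j 1)" by (auto simp: Basis_vec_def)
  have "inj (\<lambda>j. axis j (1::real) :: real ^ 'd)" by (auto simp: inj_on_def axis_eq_axis)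
  from prod.reindex[OF this, of F] show ?thesis unfolding B by (simp add: o_def)
qed

text \<open>The covariances below have integrands of both signs, hence the Bochner form of Fubini's theorem for
  product integrands.\<close>

lemma lborel_product_integral:
  fixes f :: "'d::finite \<Rightarrow> real \<Rightarrow> real"
  assumes f: "\<And>j. integrable lborel (f j)"
  shows "integrable lborel (\<lambda>x :: real ^ 'd. \<Prod>j\<in>UNIV. f j (x $ j))"
    and "(\<integral>x. (\<Prod>j\<in>UNIV. f j (x $ j)) \<partial>(lborel :: (real ^ 'd) measure)) = (\<Prod>j\<in>UNIV. \<integral>y. f j y \<partial>lborel)"
proof -
  interpret product_sigma_finite "\<lambda>_ :: real ^ 'd. lborel :: real measure" ..
  define F :: "real ^ 'd \<Rightarrow> real \<Rightarrow> real" where "F b = f (THE j. b = axis j 1)" for b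
  have F: "F (axis j 1) = f j" for j by (simp add: F_def axis_eq_axis)
  have [measurable]: "f j \<in> borel_measurable borel" for j
    using borel_measurable_integrable[OF f[of j]] by simp
  have Fint: "integrable lborel (F b)" for b unfolding F_def by (rule f)
  have eq: "(\<Prod>j\<in>UNIV. f j (x $ j)) = (\<Prod>b\<in>Basis. F b (x \<bullet> b))" for x :: "real ^ 'd"
    unfolding prod_Basis_vec F by (simp add: inner_axis)
  have meas: "(\<lambda>x :: real ^ 'd. \<Prod>j\<in>UNIV. f j (x $ j)) \<in> borel_measurable borel"
    by (intro borel_measurable_prod measurable_compose[of "\<lambda>x. x $ j" _ borel "f j" for j]) auto
  have map: "(\<lambda>p. \<Sum>b\<in>Basis. p b *\<^sub>R b) \<in> measurable (\<Pi>\<^sub>M b\<in>(Basis :: (real ^ 'd) set). lborel) borel"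
    by measurable
  have comp: "(\<Prod>b\<in>Basis. F b ((\<Sum>c\<in>Basis. p c *\<^sub>R c) \<bullet> b)) = (\<Prod>b\<in>Basis. F b (p b))" for p :: "real ^ 'd \<Rightarrow> real"
    by (intro prod.cong refl) (simp add: inner_sum_left inner_Basis if_distrib cong: if_cong)
  show "integrable lborel (\<lambda>x :: real ^ 'd. \<Prod>j\<in>UNIV. f j (x $ j))"
    unfolding eq lborel_eq[where 'a="real ^ 'd"] integrable_distr_eq[OF map meas[unfolded eq]] comp
    by (rule product_integrable_prod) (auto intro: Fint)
  have "(\<integral>x. (\<Prod>j\<in>UNIV. f j (x $ j)) \<partial>(lborel :: (real ^ 'd) measure)) = (\<Prod>b\<in>(Basis :: (real ^ 'd) set). \<integral>y. F b y \<partial>lborel)"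
    unfolding eq lborel_eq[where 'a="real ^ 'd"] integral_distr[OF map meas[unfolded eq]] comp
    by (rule product_integral_prod) (auto intro: Fint)
  then show "(\<integral>x. (\<Prod>j\<in>UNIV. f j (x $ j)) \<partial>(lborel :: (real ^ 'd) measure)) = (\<Prod>j\<in>UNIV. \<integral>y. f j y \<partial>lborel)"
    by (simp add: prod_Basis_vec F)
qed

lemma power2_norm_matrix: "(norm (A :: real ^ 'd ^ 'n))\<^sup>2 = (\<Sum>i\<in>UNIV. (norm (A $ i))\<^sup>2)"
  by (simp add: norm_vec_def L2_set_def sum_nonneg)

lemma power2_norm_matrix_vector: "(norm ((A :: real ^ 'd ^ 'n) *v x))\<^sup>2 = (\<Sum>i\<in>UNIV. (A $ i \<bullet> x)\<^sup>2)"
  by (simp add: norm_vec_def[of "A *v x"] L2_set_def sum_nonneg matrix_vector_mul_component)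

lemma norm_matrix_vector_le: "norm ((A :: real ^ 'd ^ 'n) *v x) \<le> norm A * norm x"
proof -
  have "(norm (A *v x))\<^sup>2 \<le> (\<Sum>i\<in>UNIV. (norm (A $ i))\<^sup>2 * (norm x)\<^sup>2)"
    unfolding power2_norm_matrix_vector
  proof (rule sum_mono)
    fix i
    have "\<bar>A $ i \<bullet> x\<bar>\<^sup>2 \<le> (norm (A $ i) * norm x)\<^sup>2"
      by (intro power_mono Cauchy_Schwarz_ineq2) simp
    then show "(A $ i \<bullet> x)\<^sup>2 \<le> (norm (A $ i))\<^sup>2 * (norm x)\<^sup>2" by (simp add: power_mult_distrib)
  qed
  also have "\<dots> = (norm A * norm x)\<^sup>2"
    by (simp add: power_mult_distrib power2_norm_matrix sum_distrib_right)
  finally show ?thesis by (rule power2_le_imp_le) simp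
qed

lemma norm_vector_matrix_le: "norm (v v* (A :: real ^ 'd ^ 'n)) \<le> norm v * norm A"
proof (cases "v v* A = 0")
  case False
  have "(norm (v v* A))\<^sup>2 = v \<bullet> (A *v (v v* A))"
    by (simp add: power2_norm_eq_inner dot_lmul_matrix)
  also have "\<dots> \<le> norm v * norm (A *v (v v* A))" by (rule norm_cauchy_schwarz)
  also have "\<dots> \<le> norm v * (norm A * norm (v v* A))" by (intro mult_left_mono norm_matrix_vector_le) simp
  finally have "norm (v v* A) * norm (v v* A) \<le> (norm v * norm A) * norm (v v* A)"
    by (simp add: power2_eq_square mult.assoc)
  then show ?thesis using False by simp
qed simp

definition gaussian_moment_const :: "'d::finite itself \<Rightarrow> nat \<Rightarrow> real" where
  "gaussian_moment_const _ k = real CARD('d) ^ (k + 1) * (fact (2 * k) / (2 ^ k * fact k))"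

context
  fixes \<sigma> :: real
  assumes \<sigma>: "0 < \<sigma>"
begin

lemma gaussian_monomial:
  fixes m :: "'d::finite \<Rightarrow> nat"
  shows "integrable (gaussian_noise \<sigma>) (\<lambda>x :: real ^ 'd. \<Prod>j\<in>UNIV. (x $ j) ^ m j)"
    and "(\<integral>x. (\<Prod>j\<in>UNIV. (x $ j) ^ m j) \<partial>(gaussian_noise \<sigma> :: (real ^ 'd) measure))
      = (\<Prod>j\<in>UNIV. \<integral>y. normal_density 0 \<sigma> y * y ^ m j \<partial>lborel)"
proof -
  let ?w = "\<lambda>x :: real ^ 'd. \<Prod>j\<in>UNIV. normal_density 0 \<sigma> (x $ j)"
  have int: "integrable lborel (\<lambda>y. normal_density 0 \<sigma> y * y ^ k)" for k
    using integrable_normal_moment[OF \<sigma>, of 0 k] by simp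
  have meas: "(\<lambda>x :: real ^ 'd. \<Prod>j\<in>UNIV. (x $ j) ^ m j) \<in> borel_measurable lborel" by measurable
  have w: "?w \<in> borel_measurable lborel" by measurable
  have w0: "AE x in lborel. 0 \<le> ?w x" by (simp add: prod_nonneg)
  have eq: "?w x *\<^sub>R (\<Prod>j\<in>UNIV. (x $ j) ^ m j) = (\<Prod>j\<in>UNIV. normal_density 0 \<sigma> (x $ j) * (x $ j) ^ m j)" for x
    by (simp add: prod.distrib)
  show "integrable (gaussian_noise \<sigma>) (\<lambda>x :: real ^ 'd. \<Prod>j\<in>UNIV. (x $ j) ^ m j)"
    unfolding gaussian_noise_def integrable_density[OF meas w w0] eq
    by (rule lborel_product_integral(1)) (rule int)
  show "(\<integral>x. (\<Prod>j\<in>UNIV. (x $ j) ^ m j) \<partial>(gaussian_noise \<sigma> :: (real ^ 'd) measure))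
      = (\<Prod>j\<in>UNIV. \<integral>y. normal_density 0 \<sigma> y * y ^ m j \<partial>lborel)"
    unfolding gaussian_noise_def integral_density[OF meas w w0] eq
    by (rule lborel_product_integral(2)) (rule int)
qed

lemma prob_space_gaussian_noise: "prob_space (gaussian_noise \<sigma> :: (real ^ 'd::finite) measure)"
proof
  have "integrable (gaussian_noise \<sigma>) (\<lambda>x :: real ^ 'd. 1 :: real)"
    using gaussian_monomial(1)[of "\<lambda>_. 0"] by simp
  moreover have "(\<integral>x. (1 :: real) \<partial>(gaussian_noise \<sigma> :: (real ^ 'd) measure)) = 1"
    using gaussian_monomial(2)[of "\<lambda>_ :: 'd. 0"] integral_normal_density[OF \<sigma>, of 0] by simp
  ultimately have "(\<integral>\<^sup>+x. ennreal 1 \<partial>(gaussian_noise \<sigma> :: (real ^ 'd) measure)) = ennreal 1"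
    by (subst nn_integral_eq_integral) auto
  then show "emeasure (gaussian_noise \<sigma>) (space (gaussian_noise \<sigma> :: (real ^ 'd) measure)) = 1" by simp
qed

lemma gaussian_even_moment:
  fixes a :: "'d::finite"
  shows "integrable (gaussian_noise \<sigma>) (\<lambda>x :: real ^ 'd. (x $ a) ^ (2 * k))"
    and "(\<integral>x. (x $ a) ^ (2 * k) \<partial>(gaussian_noise \<sigma> :: (real ^ 'd) measure)) = fact (2 * k) / (2 ^ k * fact k) * \<sigma> ^ (2 * k)"
proof -
  define m where "m j = (if j = a then 2 * k else 0)" for j
  have eq: "(\<Prod>j\<in>UNIV. (x $ j) ^ m j) = (x $ a) ^ (2 * k)" for x :: "real ^ 'd"
    by (simp add: m_def if_distrib[of "\<lambda>k. _ ^ k"] prod.delta cong: if_cong)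
  show "integrable (gaussian_noise \<sigma>) (\<lambda>x :: real ^ 'd. (x $ a) ^ (2 * k))"
    using gaussian_monomial(1)[of m] by (simp add: eq)
  have "(\<Prod>j\<in>UNIV. \<integral>y. normal_density 0 \<sigma> y * y ^ m j \<partial>lborel)
      = (\<Prod>j\<in>UNIV. if j = a then fact (2 * k) / (2 ^ k * fact k) * \<sigma> ^ (2 * k) else 1)"
  proof (rule prod.cong[OF refl])
    fix j
    show "(\<integral>y. normal_density 0 \<sigma> y * y ^ m j \<partial>lborel) = (if j = a then fact (2 * k) / (2 ^ k * fact k) * \<sigma> ^ (2 * k) else 1)"
    proof (cases "j = a")
      case True
      have "(2 / \<sigma>\<^sup>2) ^ k = 2 ^ k / \<sigma> ^ (2 * k)" by (simp add: power_divide power_mult)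
      then show ?thesis
        using integral_normal_moment_even[OF \<sigma>, of 0 k] True by (simp add: m_def)
    next
      case False
      then show ?thesis using integral_normal_density[OF \<sigma>, of 0] by (simp add: m_def)
    qed
  qed
  then show "(\<integral>x. (x $ a) ^ (2 * k) \<partial>(gaussian_noise \<sigma> :: (real ^ 'd) measure)) = fact (2 * k) / (2 ^ k * fact k) * \<sigma> ^ (2 * k)"
    using gaussian_monomial(2)[of m] by (simp add: eq)
qed

lemma gaussian_covariance:
  fixes a b :: "'d::finite"
  shows "integrable (gaussian_noise \<sigma>) (\<lambda>x :: real ^ 'd. x $ a * x $ b)"
    and "(\<integral>x. x $ a * x $ b \<partial>(gaussian_noise \<sigma> :: (real ^ 'd) measure)) = (if a = b then \<sigma>\<^sup>2 else 0)"
proof -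
  define m where "m j = (if j = a then 1 else 0) + (if j = b then 1 else 0 :: nat)" for j
  have eq: "(\<Prod>j\<in>UNIV. (x $ j) ^ m j) = x $ a * x $ b" for x :: "real ^ 'd"
    by (simp add: m_def power_add if_distrib[of "\<lambda>k. _ ^ k"] prod.distrib prod.delta cong: if_cong)
  show "integrable (gaussian_noise \<sigma>) (\<lambda>x :: real ^ 'd. x $ a * x $ b)"
    using gaussian_monomial(1)[of m] by (simp add: eq)
  show "(\<integral>x. x $ a * x $ b \<partial>(gaussian_noise \<sigma> :: (real ^ 'd) measure)) = (if a = b then \<sigma>\<^sup>2 else 0)"
  proof (cases "a = b")
    case True
    then show ?thesis using gaussian_even_moment(2)[where k=1 and a=a] by (simp add: power2_eq_square)
  next
    case False
    have "(\<integral>y. normal_density 0 \<sigma> y * y ^ m a \<partial>lborel) = 0"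
      using integral_normal_moment_nz_1[OF \<sigma>, of 0] False by (simp add: m_def)
    then have "(\<Prod>j\<in>UNIV. \<integral>y. normal_density 0 \<sigma> y * y ^ m j \<partial>lborel) = 0"
      by (intro prod_zero) auto
    then show ?thesis using gaussian_monomial(2)[of m] False by (simp add: eq)
  qed
qed

lemma gaussian_linear_square:
  fixes v :: "real ^ 'd"
  shows "integrable (gaussian_noise \<sigma>) (\<lambda>x. (v \<bullet> x)\<^sup>2)"
    and "(\<integral>x. (v \<bullet> x)\<^sup>2 \<partial>gaussian_noise \<sigma>) = \<sigma>\<^sup>2 * (norm v)\<^sup>2"
proof -
  have eq: "(v \<bullet> x)\<^sup>2 = (\<Sum>a\<in>UNIV. \<Sum>b\<in>UNIV. (v $ a * v $ b) * (x $ a * x $ b))" for x :: "real ^ 'd"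
    unfolding inner_vec_def power2_eq_square sum_product by (simp add: algebra_simps)
  show "integrable (gaussian_noise \<sigma>) (\<lambda>x. (v \<bullet> x)\<^sup>2)"
    unfolding eq by (intro Bochner_Integration.integrable_sum integrable_mult_right gaussian_covariance)
  have "(\<integral>x. (v \<bullet> x)\<^sup>2 \<partial>gaussian_noise \<sigma>) = (\<Sum>a\<in>UNIV. \<Sum>b\<in>UNIV. (v $ a * v $ b) * (if a = b then \<sigma>\<^sup>2 else 0))"
    unfolding eq
    by (simp add: Bochner_Integration.integral_sum Bochner_Integration.integrable_sum integrable_mult_right gaussian_covariance)
  also have "\<dots> = \<sigma>\<^sup>2 * (norm v)\<^sup>2"
    by (simp add: if_distrib[of "\<lambda>z. _ * z"] sum.delta power2_norm_eq_inner inner_vec_def sum_distrib_left mult.commute cong: if_cong)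
  finally show "(\<integral>x. (v \<bullet> x)\<^sup>2 \<partial>gaussian_noise \<sigma>) = \<sigma>\<^sup>2 * (norm v)\<^sup>2" .
qed

lemma gaussian_matrix_square:
  fixes A :: "real ^ 'd ^ 'n"
  shows "integrable (gaussian_noise \<sigma>) (\<lambda>x. (norm (A *v x))\<^sup>2)"
    and "(\<integral>x. (norm (A *v x))\<^sup>2 \<partial>gaussian_noise \<sigma>) = \<sigma>\<^sup>2 * (norm A)\<^sup>2"
  unfolding power2_norm_matrix_vector power2_norm_matrix
  by (auto simp: gaussian_linear_square sum_distrib_left intro!: Bochner_Integration.integrable_sum)

text \<open>The square of the norm is at most \<open>CARD('d)\<close> times the largest squared coordinate, so the
  moments of the norm reduce to those of the coordinates.\<close>

lemma gaussian_norm_moment: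
  shows "integrable (gaussian_noise \<sigma>) (\<lambda>x :: real ^ 'd. norm x ^ (2 * k))"
    and "(\<integral>x. norm x ^ (2 * k) \<partial>(gaussian_noise \<sigma> :: (real ^ 'd) measure)) \<le> gaussian_moment_const TYPE('d) k * \<sigma> ^ (2 * k)"
proof -
  let ?d = "real CARD('d)"
  have le: "norm x ^ (2 * k) \<le> ?d ^ k * (\<Sum>a\<in>UNIV. (x $ a) ^ (2 * k))" for x :: "real ^ 'd"
  proof -
    define M where "M = Max (range (\<lambda>a. (x $ a)\<^sup>2))"
    have "M \<in> range (\<lambda>a. (x $ a)\<^sup>2)" unfolding M_def by (rule Max_in) auto
    then obtain a where a: "M = (x $ a)\<^sup>2" by blast
    have "(norm x)\<^sup>2 = (\<Sum>b\<in>UNIV. (x $ b)\<^sup>2)" by (simp add: norm_vec_def L2_set_def sum_nonneg)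
    also have "\<dots> \<le> (\<Sum>b\<in>(UNIV :: 'd set). M)" unfolding M_def by (intro sum_mono Max_ge) auto
    finally have "(norm x)\<^sup>2 \<le> ?d * (x $ a)\<^sup>2" by (simp add: a)
    then have "((norm x)\<^sup>2) ^ k \<le> (?d * (x $ a)\<^sup>2) ^ k" by (rule power_mono) simp
    then have "norm x ^ (2 * k) \<le> ?d ^ k * (x $ a) ^ (2 * k)" by (simp add: power_mult power_mult_distrib)
    also have "(x $ a) ^ (2 * k) \<le> (\<Sum>a\<in>UNIV. (x $ a) ^ (2 * k))"
      by (rule member_le_sum) auto
    finally show ?thesis by (simp add: mult_left_mono)
  qed
  have int: "integrable (gaussian_noise \<sigma>) (\<lambda>x :: real ^ 'd. ?d ^ k * (\<Sum>a\<in>UNIV. (x $ a) ^ (2 * k)))"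
    by (intro integrable_mult_right Bochner_Integration.integrable_sum gaussian_even_moment)
  have [measurable]: "(\<lambda>x :: real ^ 'd. norm x ^ (2 * k)) \<in> borel_measurable (gaussian_noise \<sigma>)"
    by (simp add: gaussian_noise_def)
  show *: "integrable (gaussian_noise \<sigma>) (\<lambda>x :: real ^ 'd. norm x ^ (2 * k))"
    by (rule Bochner_Integration.integrable_bound[OF int]) (auto intro!: AE_I2 order_trans[OF le])
  have "(\<integral>x. norm x ^ (2 * k) \<partial>(gaussian_noise \<sigma> :: (real ^ 'd) measure)) \<le> (\<integral>x. ?d ^ k * (\<Sum>a\<in>UNIV. (x $ a) ^ (2 * k)) \<partial>(gaussian_noise \<sigma> :: (real ^ 'd) measure))"
    by (rule integral_mono[OF * int le])
  also have "\<dots> = gaussian_moment_const TYPE('d) k * \<sigma> ^ (2 * k)"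
    by (simp add: Bochner_Integration.integral_sum gaussian_even_moment gaussian_moment_const_def)
  finally show "(\<integral>x. norm x ^ (2 * k) \<partial>(gaussian_noise \<sigma> :: (real ^ 'd) measure)) \<le> gaussian_moment_const TYPE('d) k * \<sigma> ^ (2 * k)" .
qed

lemma gaussian_symmetric:
  assumes [measurable]: "u \<in> borel_measurable (borel :: (real ^ 'd) measure)"
  shows "(\<integral>\<^sup>+x. u (- x) \<partial>gaussian_noise \<sigma>) = (\<integral>\<^sup>+x. u x \<partial>gaussian_noise \<sigma>)"
proof -
  let ?w = "\<lambda>x :: real ^ 'd. ennreal (\<Prod>j\<in>UNIV. normal_density 0 \<sigma> (x $ j))"
  have [measurable]: "?w \<in> borel_measurable borel" by measurable
  have w: "normal_density 0 \<sigma> (- y) = normal_density 0 \<sigma> y" for y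
    by (simp add: normal_density_def)
  have "(\<integral>\<^sup>+x. u x \<partial>gaussian_noise \<sigma>) = (\<integral>\<^sup>+x. ?w x * u x \<partial>lborel)"
    by (simp add: gaussian_noise_def nn_integral_density)
  also have "\<dots> = (\<integral>\<^sup>+x. ?w x * u x \<partial>(density (distr lborel borel (\<lambda>x. 0 + (- 1) *\<^sub>R x)) (\<lambda>_. \<bar>- 1 :: real\<bar> ^ DIM(real ^ 'd))))"
    by (subst lborel_affine[of "- 1" 0]) simp_all
  also have "\<dots> = (\<integral>\<^sup>+x. ?w x * u (- x) \<partial>lborel)"
    by (simp add: nn_integral_density nn_integral_distr w)
  also have "\<dots> = (\<integral>\<^sup>+x. u (- x) \<partial>gaussian_noise \<sigma>)"
    by (simp add: gaussian_noise_def nn_integral_density)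
  finally show ?thesis ..
qed

end

section \<open>Fractional moments of one Euler--Maruyama step\<close>

text \<open>Concavity in the form \<open>u \<le> u powr q\<close> for \<open>0 \<le> u \<le> 1\<close>.\<close>

lemma powr_add_le_add_powr:
  fixes a b q :: real
  assumes "0 \<le> a" "0 \<le> b" "0 < q" "q \<le> 1"
  shows "(a + b) powr q \<le> a powr q + b powr q"
proof (cases "a + b = 0")
  case False
  then have ab: "0 < a + b" using assms by linarith
  have frac: "c / (a + b) \<le> (c / (a + b)) powr q" if "0 \<le> c" "c \<le> a + b" for c
    using that ab assms powr_mono'[of q 1 "c / (a + b)"] by (cases "c = 0") auto
  have "1 = a / (a + b) + b / (a + b)" using ab by (simp add: add_divide_distrib[symmetric])
  also have "\<dots> \<le> (a / (a + b)) powr q + (b / (a + b)) powr q"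
    using assms by (intro add_mono frac) auto
  also have "\<dots> = (a powr q + b powr q) / (a + b) powr q"
    using assms ab by (simp add: powr_divide add_divide_distrib)
  finally show ?thesis using ab by (simp add: pos_le_divide_eq)
qed (use assms in auto)

text \<open>The fourth Taylor coefficient is a positive multiple of \<open>s * (s - 1) * (s - 2) * (s - 3)\<close>, which
  is negative for \<open>0 < s < 1\<close>, so the cubic Taylor polynomial is an upper bound. At
  \<open>t = -1\<close> the derivatives do not exist and both sides are computed.\<close>

lemma powr_cubic_upper:
  fixes s t :: real
  assumes s: "0 < s" "s < 1" and t: "-1 \<le> t"
  shows "(1 + t) powr s \<le> 1 + s * t + s * (s - 1) / 2 * t\<^sup>2 + s * (s - 1) * (s - 2) / 6 * t ^ 3"
proof -
  consider "t = -1" | "t = 0" | "-1 < t" "t \<noteq> 0" using t by linarith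
  then show ?thesis
  proof cases
    case 1
    have "0 \<le> (1 - s) * (2 - s) * (3 - s) / 6" using s by simp
    also have "\<dots> = 1 + s * t + s * (s - 1) / 2 * t\<^sup>2 + s * (s - 1) * (s - 2) / 6 * t ^ 3"
      unfolding 1 by (simp add: field_simps power2_eq_square power3_eq_cube)
    finally show ?thesis using 1 by simp
  next
    case 2
    then show ?thesis by simp
  next
    case 3
    define c where "c m = (\<Prod>i<m. s - real i)" for m
    define diff where "diff m x = c m * x powr (s - real m)" for m x
    have "\<exists>u. (if 1 + t < 1 then 1 + t < u \<and> u < 1 else 1 < u \<and> u < 1 + t) \<and>
       (1 + t) powr s = (\<Sum>m<4. diff m 1 / fact m * (1 + t - 1) ^ m) + diff 4 u / fact 4 * (1 + t - 1) ^ 4"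
    proof (rule Taylor[where a="min 1 (1 + t)" and b="max 1 (1 + t)"])
      show "diff 0 = (\<lambda>x. x powr s)" by (simp add: diff_def c_def fun_eq_iff)
      show "\<forall>m x. m < 4 \<and> min 1 (1 + t) \<le> x \<and> x \<le> max 1 (1 + t) \<longrightarrow> (diff m has_real_derivative diff (Suc m) x) (at x)"
      proof (intro allI impI)
        fix m :: nat and x assume "m < 4 \<and> min 1 (1 + t) \<le> x \<and> x \<le> max 1 (1 + t)"
        then have x: "0 < x" using 3 by auto
        have "((\<lambda>x. c m * x powr (s - real m)) has_real_derivative c m * ((s - real m) * x powr (s - real m - 1))) (at x)"
          by (intro DERIV_cmult has_real_derivative_powr x)
        then show "(diff m has_real_derivative diff (Suc m) x) (at x)"
          by (simp add: diff_def[abs_def] c_def algebra_simps)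
      qed
    qed (use 3 in auto)
    then obtain u where u: "(1 + t) powr s = (\<Sum>m<4. diff m 1 / fact m * t ^ m) + diff 4 u / fact 4 * t ^ 4" by auto
    have c4: "c 4 \<le> 0"
    proof -
      have "c 4 = - (s * (1 - s) * (2 - s) * (3 - s))"
        by (simp add: c_def eval_nat_numeral algebra_simps)
      then show ?thesis using s by simp
    qed
    then have "diff 4 u / fact 4 * t ^ 4 \<le> 0"
      unfolding diff_def by (intro mult_nonpos_nonneg divide_nonpos_pos) (auto intro: mult_nonpos_nonneg)
    moreover have "(\<Sum>m<4. diff m 1 / fact m * t ^ m) = 1 + s * t + s * (s - 1) / 2 * t\<^sup>2 + s * (s - 1) * (s - 2) / 6 * t ^ 3"
      by (simp add: diff_def c_def eval_nat_numeral fact_reduce algebra_simps)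
    ultimately show ?thesis using u by simp
  qed
qed

lemma cube_add_le: "(x + y) ^ 3 \<le> 4 * (x ^ 3 + y ^ 3)" if "0 \<le> x" "0 \<le> (y :: real)"
proof -
  have "4 * (x ^ 3 + y ^ 3) - (x + y) ^ 3 = 3 * (x + y) * (x - y)\<^sup>2"
    by (simp add: power2_eq_square power3_eq_cube algebra_simps)
  also have "\<dots> \<ge> 0" using that by simp
  finally show ?thesis by simp
qed

text \<open>The constant collects the remainder terms in the proof of \<open>em_step_powr_bound\<close>.\<close>

definition step_error_const :: "'d::finite itself \<Rightarrow> real" where
  "step_error_const d = 41 + 48 * gaussian_moment_const d 1 + 16 * gaussian_moment_const d 2
     + 2 * gaussian_moment_const d 3"

lemma gaussian_moment_const_nonneg: "0 \<le> gaussian_moment_const d k"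
  by (simp add: gaussian_moment_const_def)

text \<open>Adding the values at \<open>a + l\<close> and \<open>a - l\<close> cancels the odd powers of \<open>l\<close>. This is essential:
  below, \<open>l\<close> is the linear noise term of size \<open>(\<Delta> * H) powr (1/2)\<close>, and the growth condition
  on the truncation level does not make its absolute third moment small compared with \<open>\<Delta>\<close>.\<close>

lemma symmetrized_powr_le:
  fixes a l s \<eta> :: real
  assumes s: "0 < s" "s < 1" and pm: "0 \<le> 1 + a + l" "0 \<le> 1 + a - l"
    and a: "a \<le> \<eta>" and \<eta>: "0 \<le> \<eta>"
  shows "(1 + a + l) powr s + (1 + a - l) powr s
    \<le> 2 * (1 + s * a - s * (1 - s) / 2 * l\<^sup>2 + s / 3 * (\<eta> ^ 3 + 3 * (\<eta> * l\<^sup>2)))"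
proof -
  define k where "k = s * (s - 1) / 2"
  define c where "c = s * (s - 1) * (s - 2) / 6"
  have 1: "(1 + (a + l)) powr s \<le> 1 + s * (a + l) + k * (a + l)\<^sup>2 + c * (a + l) ^ 3"
    unfolding k_def c_def by (rule powr_cubic_upper[OF s]) (use pm in linarith)
  have 2: "(1 + (a - l)) powr s \<le> 1 + s * (a - l) + k * (a - l)\<^sup>2 + c * (a - l) ^ 3"
    unfolding k_def c_def by (rule powr_cubic_upper[OF s]) (use pm in linarith)
  have c0: "0 \<le> c" unfolding c_def using s by (simp add: mult_nonneg_nonpos2 mult_nonneg_nonpos mult_nonpos_nonpos)
  have "(s - 1) * (s - 2) = 2 - s * (3 - s)" by (simp add: algebra_simps)
  also have "\<dots> \<le> 2" using s by simp
  finally have "s * ((s - 1) * (s - 2)) \<le> s * 2" using s by (intro mult_left_mono) auto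
  moreover have "6 * c = s * ((s - 1) * (s - 2))" by (simp add: c_def)
  ultimately have c1: "c \<le> s / 3" by linarith
  have cub: "a ^ 3 + 3 * (a * l\<^sup>2) \<le> \<eta> ^ 3 + 3 * (\<eta> * l\<^sup>2)"
    using a by (intro add_mono power_mono_odd mult_left_mono mult_right_mono) auto
  have pos: "0 \<le> \<eta> ^ 3 + 3 * (\<eta> * l\<^sup>2)" using \<eta> by simp
  have third: "c * (a ^ 3 + 3 * (a * l\<^sup>2)) \<le> s / 3 * (\<eta> ^ 3 + 3 * (\<eta> * l\<^sup>2))"
    by (rule order_trans[OF mult_left_mono[OF cub c0] mult_right_mono[OF c1 pos]])
  have "k * a\<^sup>2 \<le> 0" unfolding k_def using s by (intro mult_nonpos_nonneg) (auto simp: mult_nonneg_nonpos)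
  moreover have "k = - (s * (1 - s) / 2)" by (simp add: k_def field_simps)
  then have "k * l\<^sup>2 = - (s * (1 - s) / 2 * l\<^sup>2)" by simp
  ultimately have second: "k * (a\<^sup>2 + l\<^sup>2) \<le> - (s * (1 - s) / 2 * l\<^sup>2)"
    by (simp add: distrib_left)
  have eq: "(1 + s * (a + l) + k * (a + l)\<^sup>2 + c * (a + l) ^ 3) + (1 + s * (a - l) + k * (a - l)\<^sup>2 + c * (a - l) ^ 3)
      = 2 * (1 + s * a + k * (a\<^sup>2 + l\<^sup>2) + c * (a ^ 3 + 3 * (a * l\<^sup>2)))"
    by (simp add: power2_eq_square power3_eq_cube algebra_simps)
  have "(1 + a + l) powr s + (1 + a - l) powr s = (1 + (a + l)) powr s + (1 + (a - l)) powr s"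
    by (simp add: algebra_simps)
  also have "\<dots> \<le> 2 * (1 + s * a + k * (a\<^sup>2 + l\<^sup>2) + c * (a ^ 3 + 3 * (a * l\<^sup>2)))"
    using add_mono[OF 1 2] unfolding eq .
  also have "\<dots> \<le> 2 * (1 + s * a + - (s * (1 - s) / 2 * l\<^sup>2) + s / 3 * (\<eta> ^ 3 + 3 * (\<eta> * l\<^sup>2)))"
    by (intro mult_left_mono add_mono order_refl second third) simp
  finally show ?thesis by simp
qed

text \<open>The central estimate. Write the squared length after the step as
  \<open>1 + a n + l n\<close> with \<open>a\<close> even and \<open>l\<close> odd in the noise. The mean of
  \<open>a\<close> gives the drift part \<open>2 * (e \<bullet> F) + (norm G)\<^sup>2\<close>, the mean of \<open>l\<^sup>2\<close>, which enters with
  the negative factor \<open>s * (s - 1) / 2\<close>, gives the term with \<open>(norm (e v* G))\<^sup>2\<close>, and the rest is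
  \<open>\<Delta>\<close> times \<open>O(\<Delta> * H\<^sup>2)\<close>.\<close>

lemma em_step_powr_bound_unit:
  fixes e F :: "real ^ 'n" and G :: "real ^ 'd ^ 'n"
  assumes s: "0 < s" "s < 1" and e: "norm e = 1" and F: "norm F \<le> H" and G: "(norm G)\<^sup>2 \<le> H"
    and \<Delta>: "0 < \<Delta>" "\<Delta> * H \<le> 1"
    and \<kappa>: "2 * (e \<bullet> F) + (norm G)\<^sup>2 - (2 - 2 * s) * (norm (e v* G))\<^sup>2 \<le> \<kappa>"
  shows "(\<integral>\<^sup>+n. ennreal (norm (e + \<Delta> *\<^sub>R F + G *v n) powr (2 * s)) \<partial>gaussian_noise (sqrt \<Delta>))
    \<le> ennreal (1 + s * \<Delta> * (\<kappa> + step_error_const TYPE('d) * (\<Delta> * H\<^sup>2)))"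
proof -
  let ?\<nu> = "gaussian_noise (sqrt \<Delta>) :: (real ^ 'd) measure" and ?C = "gaussian_moment_const TYPE('d)"
  have H: "0 \<le> H" using F norm_ge_zero[of F] by linarith
  have sd: "0 < sqrt \<Delta>" using \<Delta> by simp
  interpret \<nu>: prob_space ?\<nu> by (rule prob_space_gaussian_noise[OF sd])
  have norm_add: "(norm (u + w))\<^sup>2 = (norm u)\<^sup>2 + 2 * (u \<bullet> w) + (norm w)\<^sup>2" for u w :: "real ^ 'k"
    by (simp add: power2_norm_eq_inner inner_add_left inner_add_right inner_commute)
  define y where "y = e + \<Delta> *\<^sub>R F"
  \<comment> \<open>The even and the odd part, in the noise, of the increment of the squared length.\<close>
  define a where "a n = 2 * \<Delta> * (e \<bullet> F) + \<Delta>\<^sup>2 * (norm F)\<^sup>2 + (norm (G *v n))\<^sup>2" for n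
  define l where "l n = 2 * (y \<bullet> (G *v n))" for n
  \<comment> \<open>A nonnegative upper bound for the even part that is polynomial in the norm of the noise.\<close>
  define \<eta> where "\<eta> n = 3 * H * \<Delta> + H * (norm n)\<^sup>2" for n :: "real ^ 'd"
  define T where "T = \<Delta>\<^sup>2 * H\<^sup>2"
  have T0: "0 \<le> T" by (simp add: T_def)
  have T_le: "T \<le> H * \<Delta>"
    using mult_right_mono[OF \<Delta>(2), of "\<Delta> * H"] \<Delta> H by (simp add: T_def power2_eq_square mult_ac)
  have "\<Delta> * norm F \<le> \<Delta> * H" using F \<Delta> by (intro mult_left_mono) auto
  then have "\<Delta> * norm F \<le> 1" using \<Delta>(2) by linarith
  then have "norm (\<Delta> *\<^sub>R F) \<le> 1" using \<Delta>(1) by simp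
  then have normy: "norm y \<le> 2" unfolding y_def using norm_triangle_ineq[of e "\<Delta> *\<^sub>R F"] e by linarith
  have Gn: "(norm (G *v n))\<^sup>2 \<le> H * (norm n)\<^sup>2" for n
    using power_mono[OF norm_matrix_vector_le[of G n], of 2] mult_right_mono[OF G, of "(norm n)\<^sup>2"]
    by (simp add: power_mult_distrib)
  have F2: "\<Delta>\<^sup>2 * (norm F)\<^sup>2 \<le> T"
    unfolding T_def using F by (intro mult_left_mono power_mono) auto
  have "e \<bullet> F \<le> H" using norm_cauchy_schwarz[of e F] e F by simp
  then have eF: "\<Delta> * (e \<bullet> F) \<le> H * \<Delta>" using \<Delta> by (simp add: mult.commute)
  have a_le: "a n \<le> \<eta> n" for n
    unfolding a_def \<eta>_def using F2 T_le Gn[of n] eF by linarith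
  have \<eta>0: "0 \<le> \<eta> n" for n using H \<Delta> by (simp add: \<eta>_def)
  have l2: "(l n)\<^sup>2 \<le> 16 * (H * (norm n)\<^sup>2)" for n
  proof -
    have "\<bar>y \<bullet> (G *v n)\<bar> \<le> norm y * norm (G *v n)" by (rule Cauchy_Schwarz_ineq2)
    also have "\<dots> \<le> 2 * norm (G *v n)" using normy by (simp add: mult_right_mono)
    finally have "\<bar>y \<bullet> (G *v n)\<bar>\<^sup>2 \<le> (2 * norm (G *v n))\<^sup>2" by (rule power_mono) simp
    then show ?thesis using Gn[of n] by (simp add: l_def power_mult_distrib)
  qed
  have y2: "(norm y)\<^sup>2 = 1 + 2 * \<Delta> * (e \<bullet> F) + \<Delta>\<^sup>2 * (norm F)\<^sup>2"
    using norm_add[of e "\<Delta> *\<^sub>R F"] e by (simp add: y_def power_mult_distrib)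
  have sq: "(norm (y + G *v n))\<^sup>2 = 1 + a n + l n" "(norm (y + G *v (- n)))\<^sup>2 = 1 + a n - l n" for n
  proof -
    have "G *v (- n) = - (G *v n)" by (simp add: vec_eq_iff matrix_vector_mult_def sum_negf)
    then show "(norm (y + G *v n))\<^sup>2 = 1 + a n + l n" "(norm (y + G *v (- n)))\<^sup>2 = 1 + a n - l n"
      using norm_add[of y "G *v n"] norm_add[of y "- (G *v n)"] y2 by (simp_all add: a_def l_def)
  qed
  have pm: "0 \<le> 1 + a n + l n" "0 \<le> 1 + a n - l n" for n
    unfolding sq[symmetric] by simp_all
  have pw: "norm x powr (2 * s) = ((norm x)\<^sup>2) powr s" for x :: "real ^ 'n"
    by (cases "x = 0") (simp_all add: powr_powr[symmetric])
  \<comment> \<open>The polynomial bound for the symmetrised power; all its means are explicit or estimated.\<close>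
  define R where "R n = 1 + s * a n - s * (1 - s) / 2 * (l n)\<^sup>2
      + s / 3 * (108 * (H * \<Delta>) ^ 3 + 4 * H ^ 3 * norm n ^ (2 * 3)
          + 144 * (H\<^sup>2 * \<Delta>) * norm n ^ (2 * 1) + 48 * H\<^sup>2 * norm n ^ (2 * 2))" for n
  have Rle: "(1 + a n + l n) powr s + (1 + a n - l n) powr s \<le> 2 * R n" for n
  proof -
    have "\<eta> n ^ 3 \<le> 4 * ((3 * H * \<Delta>) ^ 3 + (H * (norm n)\<^sup>2) ^ 3)"
      unfolding \<eta>_def using H \<Delta> by (intro cube_add_le) auto
    moreover have "3 * (\<eta> n * (l n)\<^sup>2) \<le> 3 * (\<eta> n * (16 * (H * (norm n)\<^sup>2)))"
      by (intro mult_left_mono l2 \<eta>0) auto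
    ultimately have "\<eta> n ^ 3 + 3 * (\<eta> n * (l n)\<^sup>2) \<le> 4 * ((3 * H * \<Delta>) ^ 3 + (H * (norm n)\<^sup>2) ^ 3)
        + 3 * (\<eta> n * (16 * (H * (norm n)\<^sup>2)))" by (rule add_mono)
    also have "\<dots> = 108 * (H * \<Delta>) ^ 3 + 4 * H ^ 3 * norm n ^ (2 * 3)
          + 144 * (H\<^sup>2 * \<Delta>) * norm n ^ (2 * 1) + 48 * H\<^sup>2 * norm n ^ (2 * 2)"
      by (simp add: \<eta>_def algebra_simps power2_eq_square power4_eq_xxxx power_mult_distrib eval_nat_numeral)
    finally have "2 * (1 + s * a n - s * (1 - s) / 2 * (l n)\<^sup>2 + s / 3 * (\<eta> n ^ 3 + 3 * (\<eta> n * (l n)\<^sup>2))) \<le> 2 * R n"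
      unfolding R_def using s by (intro mult_left_mono add_left_mono) auto
    then show ?thesis
      using symmetrized_powr_le[OF s pm[of n] a_le[of n] \<eta>0[of n]] by (rule order_trans[rotated])
  qed
  have R0: "0 \<le> R n" for n
    using Rle[of n] powr_ge_zero[of "1 + a n + l n" s] powr_ge_zero[of "1 + a n - l n" s] by linarith
  have lG: "(l n)\<^sup>2 = 4 * ((y v* G) \<bullet> n)\<^sup>2" for n
    by (simp add: l_def dot_lmul_matrix power_mult_distrib)
  have a_int: "integrable ?\<nu> a" "(\<integral>n. a n \<partial>?\<nu>) = 2 * \<Delta> * (e \<bullet> F) + \<Delta>\<^sup>2 * (norm F)\<^sup>2 + \<Delta> * (norm G)\<^sup>2"
    unfolding a_def[abs_def] using gaussian_matrix_square[OF sd, of G] \<Delta> \<nu>.prob_space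
    by (simp_all add: Bochner_Integration.integral_add)
  have l_int: "integrable ?\<nu> (\<lambda>n. (l n)\<^sup>2)" "(\<integral>n. (l n)\<^sup>2 \<partial>?\<nu>) = 4 * \<Delta> * (norm (y v* G))\<^sup>2"
    unfolding lG using gaussian_linear_square[OF sd, of "y v* G"] \<Delta> by simp_all
  note m_int = gaussian_norm_moment(1)[OF sd, where 'd='d]
  define m where "m k = (\<integral>n. norm n ^ (2 * k) \<partial>?\<nu>)" for k
  have m_le: "m k \<le> ?C k * \<Delta> ^ k" for k
    using gaussian_norm_moment(2)[OF sd, of k, where 'd='d] \<Delta> by (simp add: m_def power_mult)
  have R_int: "integrable ?\<nu> R"
    unfolding R_def[abs_def]
    by (intro Bochner_Integration.integrable_add Bochner_Integration.integrable_diff integrable_mult_right a_int l_int m_int \<nu>.integrable_const)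
  have R_eq: "(\<integral>n. R n \<partial>?\<nu>) = 1 + s * (\<integral>n. a n \<partial>?\<nu>) - s * (1 - s) / 2 * (\<integral>n. (l n)\<^sup>2 \<partial>?\<nu>)
      + s / 3 * (108 * (H * \<Delta>) ^ 3 + 4 * H ^ 3 * m 3 + 144 * (H\<^sup>2 * \<Delta>) * m 1 + 48 * H\<^sup>2 * m 2)"
    unfolding R_def[abs_def] m_def using a_int(1) l_int(1) m_int[of 1] m_int[of 2] m_int[of 3] \<nu>.prob_space
    by (simp add: Bochner_Integration.integral_add Bochner_Integration.integral_diff del: mult_2 One_nat_def)
  have H3: "(H * \<Delta>) ^ 3 \<le> T"
    using mult_right_mono[OF \<Delta>(2) T0] by (simp add: T_def power2_eq_square power3_eq_cube mult_ac)
  have "H ^ 3 * m 3 \<le> ?C 3 * (H * \<Delta>) ^ 3"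
    using mult_left_mono[OF m_le[of 3], of "H ^ 3"] H by (simp add: power_mult_distrib mult_ac)
  then have m3: "H ^ 3 * m 3 \<le> ?C 3 * T"
    using mult_left_mono[OF H3 gaussian_moment_const_nonneg[of "TYPE('d)" 3]] by linarith
  have m1: "(H\<^sup>2 * \<Delta>) * m 1 \<le> ?C 1 * T"
  proof -
    have "(H\<^sup>2 * \<Delta>) * m 1 \<le> (H\<^sup>2 * \<Delta>) * (?C 1 * \<Delta> ^ 1)"
      using \<Delta> by (intro mult_left_mono m_le) auto
    then show ?thesis by (simp add: T_def power2_eq_square mult_ac)
  qed
  have m2: "H\<^sup>2 * m 2 \<le> ?C 2 * T"
    using mult_left_mono[OF m_le[of 2], of "H\<^sup>2"] by (simp add: T_def mult_ac)
  have rem: "108 * (H * \<Delta>) ^ 3 + 4 * H ^ 3 * m 3 + 144 * (H\<^sup>2 * \<Delta>) * m 1 + 48 * H\<^sup>2 * m 2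
      \<le> (108 + 4 * ?C 3 + 144 * ?C 1 + 48 * ?C 2) * T"
    using H3 m1 m2 m3 by (simp add: distrib_right mult.assoc)
  \<comment> \<open>Replacing \<open>y\<close> by \<open>e\<close> in the quadratic term costs only \<open>O(\<Delta> * H\<^sup>2)\<close>.\<close>
  have yG: "(norm (e v* G))\<^sup>2 - 2 * \<Delta> * H\<^sup>2 \<le> (norm (y v* G))\<^sup>2"
  proof -
    let ?u = "e v* G" and ?w = "(\<Delta> *\<^sub>R F) v* G"
    have "norm ?u * norm ?w \<le> norm G * ((\<Delta> * norm F) * norm G)"
      using norm_vector_matrix_le[of e G] norm_vector_matrix_le[of "\<Delta> *\<^sub>R F" G] \<Delta> e
      by (intro mult_mono) auto
    also have "\<dots> = \<Delta> * (norm F * (norm G)\<^sup>2)" by (simp add: power2_eq_square)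
    also have "\<dots> \<le> \<Delta> * (H * H)"
      using F G \<Delta> H by (intro mult_left_mono mult_mono) auto
    finally have uw: "norm ?u * norm ?w \<le> \<Delta> * H\<^sup>2" by (simp add: power2_eq_square)
    have "y v* G = ?u + ?w" unfolding y_def by (rule vector_matrix_left_distrib)
    then have "(norm (y v* G))\<^sup>2 = (norm ?u)\<^sup>2 + 2 * (?u \<bullet> ?w) + (norm ?w)\<^sup>2"
      using norm_add[of ?u ?w] by simp
    moreover have "- (norm ?u * norm ?w) \<le> ?u \<bullet> ?w"
      using Cauchy_Schwarz_ineq2[of ?u ?w] by linarith
    ultimately show ?thesis using uw zero_le_power2[of "norm ?w"] by linarith
  qed
  have drift: "s * (\<integral>n. a n \<partial>?\<nu>) - s * (1 - s) / 2 * (\<integral>n. (l n)\<^sup>2 \<partial>?\<nu>) \<le> s * \<Delta> * \<kappa> + 5 * s * T"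
  proof -
    let ?x = "(norm (e v* G))\<^sup>2"
    have "s * (1 - s) / 2 * (4 * \<Delta> * (?x - 2 * \<Delta> * H\<^sup>2)) \<le> s * (1 - s) / 2 * (\<integral>n. (l n)\<^sup>2 \<partial>?\<nu>)"
      unfolding l_int(2) using yG s \<Delta> by (intro mult_left_mono) auto
    moreover have "s * (\<integral>n. a n \<partial>?\<nu>) \<le> s * (\<Delta> * (2 * (e \<bullet> F) + (norm G)\<^sup>2) + T)"
      unfolding a_int(2) using F2 s by (intro mult_left_mono) (auto simp: algebra_simps)
    ultimately have "s * (\<integral>n. a n \<partial>?\<nu>) - s * (1 - s) / 2 * (\<integral>n. (l n)\<^sup>2 \<partial>?\<nu>)
        \<le> s * (\<Delta> * (2 * (e \<bullet> F) + (norm G)\<^sup>2) + T) - s * (1 - s) / 2 * (4 * \<Delta> * (?x - 2 * \<Delta> * H\<^sup>2))"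
      by linarith
    also have "\<dots> = s * \<Delta> * (2 * (e \<bullet> F) + (norm G)\<^sup>2 - (2 - 2 * s) * ?x) + s * T + 4 * (s * (1 - s)) * T"
      by (simp add: T_def field_simps power2_eq_square)
    also have "\<dots> \<le> s * \<Delta> * \<kappa> + s * T + 4 * (s * 1) * T"
      using s \<Delta> T0 by (intro add_mono mult_left_mono mult_right_mono \<kappa>) auto
    finally show ?thesis by (simp add: algebra_simps)
  qed
  have total: "(\<integral>n. R n \<partial>?\<nu>) \<le> 1 + s * \<Delta> * (\<kappa> + step_error_const TYPE('d) * (\<Delta> * H\<^sup>2))"
  proof -
    have "(\<integral>n. R n \<partial>?\<nu>) \<le> 1 + (s * \<Delta> * \<kappa> + 5 * s * T) + s / 3 * ((108 + 4 * ?C 3 + 144 * ?C 1 + 48 * ?C 2) * T)"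
      unfolding R_eq using drift mult_left_mono[OF rem, of "s / 3"] s by linarith
    also have "\<dots> = 1 + s * \<Delta> * \<kappa> + s * ((41 + 4 / 3 * ?C 3 + 48 * ?C 1 + 16 * ?C 2) * T)"
      by (simp add: algebra_simps)
    also have "\<dots> \<le> 1 + s * \<Delta> * \<kappa> + s * (step_error_const TYPE('d) * T)"
      using s gaussian_moment_const_nonneg[of "TYPE('d)" 3] T0
      by (intro add_left_mono mult_left_mono mult_right_mono) (auto simp: step_error_const_def)
    also have "\<dots> = 1 + s * \<Delta> * (\<kappa> + step_error_const TYPE('d) * (\<Delta> * H\<^sup>2))"
      by (simp add: T_def power2_eq_square algebra_simps)
    finally show ?thesis .
  qed
  let ?u = "\<lambda>n. ennreal (norm (y + G *v n) powr (2 * s))"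
  have mn: "(\<lambda>n. norm (y + G *v n)) \<in> borel_measurable borel"
    by (intro borel_measurable_continuous_onI continuous_intros)
  have "(\<lambda>t :: real. ennreal (t powr (2 * s))) \<in> borel_measurable borel" by measurable
  from measurable_compose[OF mn this] have [measurable]: "?u \<in> borel_measurable borel" .
  have sym: "(\<integral>\<^sup>+n. ?u (- n) \<partial>?\<nu>) = (\<integral>\<^sup>+n. ?u n \<partial>?\<nu>)"
    by (rule gaussian_symmetric[OF sd]) measurable
  have "2 * (\<integral>\<^sup>+n. ?u n \<partial>?\<nu>) = (\<integral>\<^sup>+n. ?u n \<partial>?\<nu>) + (\<integral>\<^sup>+n. ?u (- n) \<partial>?\<nu>)"
    unfolding sym by (rule mult_2)
  also have "\<dots> = (\<integral>\<^sup>+n. ?u n + ?u (- n) \<partial>?\<nu>)"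
    by (rule nn_integral_add[symmetric]) measurable
  also have "\<dots> \<le> (\<integral>\<^sup>+n. ennreal (2 * R n) \<partial>?\<nu>)"
  proof (rule nn_integral_mono)
    show "?u n + ?u (- n) \<le> ennreal (2 * R n)" for n
      using Rle[of n] unfolding pw sq(1)[of n] sq(2)[of n]
      by (simp add: ennreal_plus[symmetric] ennreal_leI del: ennreal_plus)
  qed
  also have "\<dots> = 2 * ennreal (\<integral>n. R n \<partial>?\<nu>)"
    using R_int R0 by (subst nn_integral_eq_integral) (auto simp: ennreal_mult)
  finally have "(\<integral>\<^sup>+n. ?u n \<partial>?\<nu>) \<le> ennreal (\<integral>n. R n \<partial>?\<nu>)"
    by (simp add: ennreal_mult_le_mult_iff)
  also have "\<dots> \<le> ennreal (1 + s * \<Delta> * (\<kappa> + step_error_const TYPE('d) * (\<Delta> * H\<^sup>2)))"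
    by (rule ennreal_leI[OF total])
  finally show ?thesis by (simp add: y_def)
qed

text \<open>Both sides are homogeneous in \<open>(e, F, G)\<close>, so the unit case suffices.\<close>

lemma em_step_powr_bound:
  fixes e F :: "real ^ 'n" and G :: "real ^ 'd ^ 'n"
  assumes s: "0 < s" "s < 1" and e: "e \<noteq> 0"
    and F: "norm F \<le> H * norm e" and G: "(norm G)\<^sup>2 \<le> H * (norm e)\<^sup>2"
    and \<Delta>: "0 < \<Delta>" "\<Delta> * H \<le> 1"
    and \<kappa>: "(norm e)\<^sup>2 * (2 * (e \<bullet> F) + (norm G)\<^sup>2) - (2 - 2 * s) * (norm (e v* G))\<^sup>2 \<le> \<kappa> * norm e ^ 4"
  shows "(\<integral>\<^sup>+n. ennreal (norm (e + \<Delta> *\<^sub>R F + G *v n) powr (2 * s)) \<partial>gaussian_noise (sqrt \<Delta>))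
    \<le> ennreal (norm e powr (2 * s) * (1 + s * \<Delta> * (\<kappa> + step_error_const TYPE('d) * (\<Delta> * H\<^sup>2))))"
proof -
  define L where "L = norm e"
  have L: "0 < L" using e by (simp add: L_def)
  let ?e = "(1 / L) *\<^sub>R e" and ?F = "(1 / L) *\<^sub>R F" and ?G = "(1 / L) *\<^sub>R G"
  let ?\<nu> = "gaussian_noise (sqrt \<Delta>) :: (real ^ 'd) measure"
  have vG: "?e v* ?G = (1 / L\<^sup>2) *\<^sub>R (e v* G)"
    by (simp add: vec_eq_iff vector_matrix_mult_def sum_distrib_left power2_eq_square mult_ac)
  have unit: "(\<integral>\<^sup>+n. ennreal (norm (?e + \<Delta> *\<^sub>R ?F + ?G *v n) powr (2 * s)) \<partial>?\<nu>)
      \<le> ennreal (1 + s * \<Delta> * (\<kappa> + step_error_const TYPE('d) * (\<Delta> * H\<^sup>2)))"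
  proof (rule em_step_powr_bound_unit[OF s _ _ _ \<Delta>])
    show "norm ?e = 1" using L by (simp add: L_def)
    show "norm ?F \<le> H" using F L by (simp add: L_def divide_le_eq)
    show "(norm ?G)\<^sup>2 \<le> H" using G L by (simp add: L_def power_divide divide_le_eq)
    have "2 * (?e \<bullet> ?F) + (norm ?G)\<^sup>2 - (2 - 2 * s) * (norm (?e v* ?G))\<^sup>2
        = (L\<^sup>2 * (2 * (e \<bullet> F) + (norm G)\<^sup>2) - (2 - 2 * s) * (norm (e v* G))\<^sup>2) / L ^ 4"
      unfolding vG using L by (simp add: power_divide field_simps power2_eq_square power4_eq_xxxx)
    also have "\<dots> \<le> \<kappa>" using \<kappa> L by (simp add: divide_le_eq L_def)
    finally show "2 * (?e \<bullet> ?F) + (norm ?G)\<^sup>2 - (2 - 2 * s) * (norm (?e v* ?G))\<^sup>2 \<le> \<kappa>" .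
  qed
  have scale: "ennreal (norm (e + \<Delta> *\<^sub>R F + G *v n) powr (2 * s))
      = ennreal (L powr (2 * s)) * ennreal (norm (?e + \<Delta> *\<^sub>R ?F + ?G *v n) powr (2 * s))" for n
  proof -
    have "e + \<Delta> *\<^sub>R F + G *v n = L *\<^sub>R (?e + \<Delta> *\<^sub>R ?F + ?G *v n)"
      using L by (simp add: scaleR_add_right scaleR_matrix_vector_assoc[symmetric])
    then have "norm (e + \<Delta> *\<^sub>R F + G *v n) = L * norm (?e + \<Delta> *\<^sub>R ?F + ?G *v n)" 
      using L by (simp only: norm_scaleR abs_of_pos)
    then show ?thesis using L by (simp add: powr_mult ennreal_mult)
  qed
  have m: "(\<lambda>n. norm (?e + \<Delta> *\<^sub>R ?F + ?G *v n)) \<in> borel_measurable borel"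
    by (intro borel_measurable_continuous_onI continuous_intros)
  have "(\<lambda>t :: real. ennreal (t powr (2 * s))) \<in> borel_measurable borel" by measurable
  note meas = measurable_compose[OF m this]
  have "(\<integral>\<^sup>+n. ennreal (L powr (2 * s)) * ennreal (norm (?e + \<Delta> *\<^sub>R ?F + ?G *v n) powr (2 * s)) \<partial>?\<nu>)
      = ennreal (L powr (2 * s)) * (\<integral>\<^sup>+n. ennreal (norm (?e + \<Delta> *\<^sub>R ?F + ?G *v n) powr (2 * s)) \<partial>?\<nu>)"
    by (rule nn_integral_cmult) (unfold measurable_cong_sets[OF sets_gaussian_noise refl], rule meas)
  also have "\<dots> \<le> ennreal (L powr (2 * s)) * ennreal (1 + s * \<Delta> * (\<kappa> + step_error_const TYPE('d) * (\<Delta> * H\<^sup>2)))"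
    by (intro mult_left_mono unit) simp
  finally have "(\<integral>\<^sup>+n. ennreal (norm (e + \<Delta> *\<^sub>R F + G *v n) powr (2 * s)) \<partial>?\<nu>)
      \<le> ennreal (L powr (2 * s)) * ennreal (1 + s * \<Delta> * (\<kappa> + step_error_const TYPE('d) * (\<Delta> * H\<^sup>2)))"
    by (simp only: scale)
  then show ?thesis by (simp add: L_def ennreal_mult')
qed

section \<open>The truncation map\<close>

text \<open>Truncation is the metric projection onto a ball, hence nonexpansive and idempotent.\<close>

lemma truncation_eq_closest_point:
  assumes R: "bound_inverse \<phi> v = ereal R" "0 \<le> R"
  shows "truncation \<phi> v x = closest_point (cball 0 R) x"
proof -
  have T: "truncation \<phi> v x = min (norm x) R *\<^sub>R sgn x"
    by (simp add: truncation_def R ereal_min[symmetric] del: ereal_min)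
  have nrm: "norm (truncation \<phi> v x) \<le> R"
    using R(2) unfolding T by (auto simp: norm_sgn)
  have "dist x (truncation \<phi> v x) \<le> dist x z" if "z \<in> cball 0 R" for z
  proof (cases "norm x \<le> R")
    case True
    then have "truncation \<phi> v x = x" unfolding T by (cases "x = 0") (simp_all add: sgn_div_norm)
    then show ?thesis by simp
  next
    case False
    then have x: "x \<noteq> 0" "norm x > R" using R(2) by auto
    have "x - truncation \<phi> v x = (1 - R / norm x) *\<^sub>R x"
      unfolding T using x by (simp add: sgn_div_norm scaleR_diff_left divide_inverse)
    then have "dist x (truncation \<phi> v x) = \<bar>1 - R / norm x\<bar> * norm x"
      by (simp add: dist_norm)
    also have "\<dots> = norm x - R" using x R(2) by (simp add: abs_if field_simps)
    also have "\<dots> \<le> dist x z"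
      using that norm_triangle_ineq2[of x z] by (simp add: dist_norm)
    finally show ?thesis .
  qed
  then show ?thesis
    using nrm by (intro closest_point_unique) auto
qed

lemma truncation_eq_self: "bound_inverse \<phi> v = \<infinity> \<Longrightarrow> truncation \<phi> v x = x"
  by (cases "x = 0") (simp_all add: truncation_def sgn_div_norm)

lemma admissible_bound_cases:
  assumes adm: "admissible_bound a b \<phi>" and v: "\<phi> 1 \<le> v"
  obtains (radius) R where "1 \<le> R" "bound_inverse \<phi> v = ereal R"
      "\<And>x y. norm x \<le> R \<Longrightarrow> norm y \<le> R \<Longrightarrow> norm (a x - a y) \<le> v * norm (x - y)"
      "\<And>x y. norm x \<le> R \<Longrightarrow> norm y \<le> R \<Longrightarrow> (norm (b x - b y))\<^sup>2 \<le> v * (norm (x - y))\<^sup>2"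
  | (global) "bound_inverse \<phi> v = \<infinity>"
      "\<And>x y. norm (a x - a y) \<le> v * norm (x - y)"
      "\<And>x y. (norm (b x - b y))\<^sup>2 \<le> v * (norm (x - y))\<^sup>2"
  using adm unfolding admissible_bound_def
proof (elim disjE conjE exE)
  assume pos: "\<forall>u\<ge>0. 0 \<le> \<phi> u" and mono: "strict_mono_on {0..} \<phi>" and cont: "continuous_on {0..} \<phi>"
    and lim: "filterlim \<phi> at_top at_top"
    and lip: "\<forall>u\<ge>1. \<forall>x y. max (norm x) (norm y) \<le> u \<and> x \<noteq> y \<longrightarrow>
         max (norm (a x - a y) / norm (x - y)) ((norm (b x - b y))\<^sup>2 / (norm (x - y))\<^sup>2) \<le> \<phi> u"
  have "\<forall>\<^sub>F u in at_top. v \<le> \<phi> u \<and> 1 \<le> u"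
    using lim by (intro eventually_conj eventually_ge_at_top) (simp add: filterlim_at_top)
  then obtain u where u: "v \<le> \<phi> u" "1 \<le> u"
    using eventually_happens'[OF trivial_limit_at_top_linorder] by blast
  have "continuous_on {1..u} \<phi>" using cont by (rule continuous_on_subset) auto
  then obtain R where R: "1 \<le> R" "R \<le> u" "\<phi> R = v"
    using IVT'[of \<phi> 1 v u] v u by auto
  have "\<not> (\<exists>C. \<forall>u\<ge>0. \<phi> u = C)"
  proof
    assume "\<exists>C. \<forall>u\<ge>0. \<phi> u = C"
    then have "\<phi> 0 = \<phi> 1" by (metis zero_le_one order_refl)
    moreover have "\<phi> 0 < \<phi> 1" using mono by (auto simp: strict_mono_on_def)
    ultimately show False by simp
  qed
  moreover have "the_inv_into {0..} \<phi> v = R"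
    using R by (intro the_inv_into_f_eq strict_mono_on_imp_inj_on[OF mono]) auto
  ultimately have inv: "bound_inverse \<phi> v = ereal R" by (simp add: bound_inverse_def)
  have "norm (a x - a y) \<le> v * norm (x - y) \<and> (norm (b x - b y))\<^sup>2 \<le> v * (norm (x - y))\<^sup>2"
    if "norm x \<le> R" "norm y \<le> R" for x y
  proof (cases "x = y")
    case False
    then have "norm (a x - a y) / norm (x - y) \<le> v" "(norm (b x - b y))\<^sup>2 / (norm (x - y))\<^sup>2 \<le> v"
      using lip[rule_format, of R x y] that R by auto
    then show ?thesis using False by (simp add: divide_le_eq)
  qed simp
  then show ?thesis using radius[OF R(1) inv] by blast
next
  fix C assume C: "\<forall>u\<ge>0. \<phi> u = C"
    and lip: "\<forall>x y. norm (a x - a y) \<le> C * norm (x - y) \<and> (norm (b x - b y))\<^sup>2 \<le> C * (norm (x - y))\<^sup>2"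
  have "C \<le> v" using C v by force
  have "norm (a x - a y) \<le> v * norm (x - y)" for x y
    by (rule order_trans[OF lip[rule_format, THEN conjunct1]]) (intro mult_right_mono \<open>C \<le> v\<close> norm_ge_zero)
  moreover have "(norm (b x - b y))\<^sup>2 \<le> v * (norm (x - y))\<^sup>2" for x y
    by (rule order_trans[OF lip[rule_format, THEN conjunct2]]) (intro mult_right_mono \<open>C \<le> v\<close> zero_le_power2)
  moreover have "bound_inverse \<phi> v = \<infinity>" using C by (auto simp: bound_inverse_def)
  ultimately show ?thesis using global by blast
qed

context
  fixes a :: "real ^ 'n \<Rightarrow> real ^ 'n" and b :: "real ^ 'n \<Rightarrow> real ^ 'd ^ 'n" and \<phi> v
  assumes adm: "admissible_bound a b \<phi>" and v: "\<phi> 1 \<le> v"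
begin

lemma truncation_nonexpansive:
  "dist (truncation \<phi> v (x :: real ^ 'n)) (truncation \<phi> v y) \<le> dist x y"
  using adm v
proof (cases rule: admissible_bound_cases)
  case (radius R)
  then show ?thesis
    by (simp add: truncation_eq_closest_point[OF radius(2)] closest_point_lipschitz)
qed (simp add: truncation_eq_self)

lemma truncation_idempotent: "truncation \<phi> v (truncation \<phi> v (x :: real ^ 'n)) = truncation \<phi> v x"
  using adm v
proof (cases rule: admissible_bound_cases)
  case (radius R)
  then show ?thesis
    using closest_point_in_set[of "cball 0 R" x]
    by (simp add: truncation_eq_closest_point[OF radius(2)] closest_point_self)
qed (simp add: truncation_eq_self)

lemma truncation_continuous: "continuous_on S (truncation \<phi> v :: real ^ 'n \<Rightarrow> _)"
  by (rule continuous_on_subset[of UNIV])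
    (auto simp: continuous_on_iff intro: le_less_trans[OF truncation_nonexpansive])

lemma truncation_lipschitz_drift:
  "norm (a (truncation \<phi> v x) - a (truncation \<phi> v y)) \<le> v * norm (truncation \<phi> v x - truncation \<phi> v y)"
  using adm v
proof (cases rule: admissible_bound_cases)
  case (radius R)
  have "norm (truncation \<phi> v z) \<le> R" for z :: "real ^ 'n"
    using closest_point_in_set[of "cball 0 R" z] radius(1)
    by (simp add: truncation_eq_closest_point[OF radius(2)])
  then show ?thesis using radius(3) by blast
qed

lemma truncation_lipschitz_diffusion:
  "(norm (b (truncation \<phi> v x) - b (truncation \<phi> v y)))\<^sup>2 \<le> v * (norm (truncation \<phi> v x - truncation \<phi> v y))\<^sup>2"
  using adm v
proof (cases rule: admissible_bound_cases)
  case (radius R)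
  have "norm (truncation \<phi> v z) \<le> R" for z :: "real ^ 'n"
    using closest_point_in_set[of "cball 0 R" z] radius(1)
    by (simp add: truncation_eq_closest_point[OF radius(2)])
  then show ?thesis using radius(4) by blast
qed

end

lemma truncation_zero [simp]: "truncation \<phi> v 0 = 0"
  by (simp add: truncation_def)

lemma continuous_on_of_locally_lipschitz:
  fixes u :: "'a::real_normed_vector \<Rightarrow> 'b::metric_space"
  assumes "\<And>R. \<exists>L. L-lipschitz_on (cball 0 R) u"
  shows "continuous_on UNIV u"
proof -
  have "continuous_on (ball 0 R) u" for R
    using assms[of R] lipschitz_on_continuous_on continuous_on_subset ball_subset_cball by metis
  then have "continuous_on (\<Union>R. ball 0 R) u"
    by (intro continuous_on_open_UN) auto
  moreover have "(\<Union>R. ball (0 :: 'a) R) = UNIV"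
    by (auto intro: gt_ex)
  ultimately show ?thesis by simp
qed

section \<open>Random maps that contract on average\<close>

text \<open>The first noise variable is applied last. For fixed \<open>n\<close> this has the same law as the forward
  iterate, but only in this order do the iterates converge pathwise.\<close>

primrec backward_iterate :: "('s \<Rightarrow> 'w \<Rightarrow> 's) \<Rightarrow> nat \<Rightarrow> 's \<Rightarrow> 'w stream \<Rightarrow> 's" where
  "backward_iterate \<Psi> 0 a \<omega> = a"
| "backward_iterate \<Psi> (Suc n) a \<omega> = \<Psi> (backward_iterate \<Psi> n a (stl \<omega>)) (shd \<omega>)"

text \<open>The finite index type carries no metric; this distance, cut off at 1, treats it as discrete.\<close>

definition hybrid_dist :: "'a::metric_space \<times> 'm \<Rightarrow> 'a \<times> 'm \<Rightarrow> real" where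
  "hybrid_dist a b = (if snd a = snd b then min 1 (dist (fst a) (fst b)) else 1)"

definition hybrid_tendsto :: "(nat \<Rightarrow> 'a::topological_space \<times> 'm) \<Rightarrow> 'a \<times> 'm \<Rightarrow> bool" where
  "hybrid_tendsto Y y \<longleftrightarrow>
     (\<lambda>n. fst (Y n)) \<longlonglongrightarrow> fst y \<and> (\<forall>\<^sub>F n in sequentially. snd (Y n) = snd y)"

text \<open>The discrete component of the limit is read off from a limit of real numbers, so that measurability
  of limits of real functions applies to both components.\<close>

definition hybrid_lim :: "(nat \<Rightarrow> 'a::t2_space \<times> 'm::countable) \<Rightarrow> 'a \<times> 'm" where
  "hybrid_lim Y = (lim (\<lambda>n. fst (Y n)),
     from_nat (nat \<lfloor>lim (\<lambda>n. real (to_nat (snd (Y n))))\<rfloor>))"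

lemma hybrid_lim_eq:
  fixes Y :: "nat \<Rightarrow> 'a::t2_space \<times> 'm::countable"
  assumes "hybrid_tendsto Y y"
  shows "hybrid_lim Y = y"
proof -
  have "\<forall>\<^sub>F n in sequentially. real (to_nat (snd (Y n))) = real (to_nat (snd y))"
    using assms unfolding hybrid_tendsto_def by (auto elim!: eventually_mono)
  then have "(\<lambda>n. real (to_nat (snd (Y n)))) \<longlonglongrightarrow> real (to_nat (snd y))"
    by (rule tendsto_eventually)
  then show ?thesis
    using assms by (auto simp: hybrid_lim_def hybrid_tendsto_def limI prod_eq_iff)
qed

lemma hybrid_tendsto_shift:
  "hybrid_tendsto (\<lambda>n. Y (Suc n)) y \<longleftrightarrow> hybrid_tendsto Y y"
  unfolding hybrid_tendsto_def
  using eventually_sequentially_Suc[of "\<lambda>n. snd (Y n) = snd y"]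
    filterlim_sequentially_Suc[of "\<lambda>n. fst (Y n)"]
  by auto

lemma measurable_hybrid_lim:
  fixes Y :: "nat \<Rightarrow> 'w \<Rightarrow> 'a::{banach, second_countable_topology} \<times> 'm::countable"
  assumes [measurable]: "\<And>n. Y n \<in> measurable M (borel \<Otimes>\<^sub>M count_space UNIV)"
  shows "(\<lambda>\<omega>. hybrid_lim (\<lambda>n. Y n \<omega>)) \<in> measurable M (borel \<Otimes>\<^sub>M count_space UNIV)"
  unfolding hybrid_lim_def by measurable

lemma hybrid_tendsto_close:
  fixes Y Z :: "nat \<Rightarrow> 'a::metric_space \<times> 'm"
  assumes Y: "hybrid_tendsto Y y" and YZ: "(\<lambda>n. hybrid_dist (Z n) (Y n)) \<longlonglongrightarrow> 0"
  shows "hybrid_tendsto Z y"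
proof -
  have ev: "\<forall>\<^sub>F n in sequentially. hybrid_dist (Z n) (Y n) < 1"
    by (rule order_tendstoD[OF YZ]) simp
  then have sn: "\<forall>\<^sub>F n in sequentially. snd (Z n) = snd (Y n) \<and> dist (fst (Z n)) (fst (Y n)) = hybrid_dist (Z n) (Y n)"
    by eventually_elim (auto simp: hybrid_dist_def split: if_splits)
  have "(\<lambda>n. dist (fst (Z n)) (fst (Y n))) \<longlonglongrightarrow> 0"
    using YZ sn by (subst tendsto_cong[where g="\<lambda>n. hybrid_dist (Z n) (Y n)"]) (auto elim: eventually_mono)
  moreover have "(\<lambda>n. dist (fst (Y n)) (fst y)) \<longlonglongrightarrow> 0"
    using Y unfolding hybrid_tendsto_def
    by (intro tendsto_dist_iff[THEN iffD1]) (rule conjunct1)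
  ultimately have "(\<lambda>n. dist (fst (Z n)) (fst (Y n)) + dist (fst (Y n)) (fst y)) \<longlonglongrightarrow> 0"
    using tendsto_add by fastforce
  then have "(\<lambda>n. dist (fst (Z n)) (fst y)) \<longlonglongrightarrow> 0"
    by (rule tendsto_sandwich[where f="\<lambda>_. 0", rotated -1])
      (auto intro!: always_eventually dist_triangle)
  then have "(\<lambda>n. fst (Z n)) \<longlonglongrightarrow> fst y" by (rule tendsto_dist_iff[THEN iffD2])
  moreover have "\<forall>\<^sub>F n in sequentially. snd (Z n) = snd y"
    using sn Y[unfolded hybrid_tendsto_def, THEN conjunct2] by eventually_elim simp
  ultimately show ?thesis by (simp add: hybrid_tendsto_def)
qed

lemma hybrid_summable_convergent:
  fixes Y :: "nat \<Rightarrow> 'a::complete_space \<times> 'm"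
  assumes "summable (\<lambda>n. hybrid_dist (Y (Suc n)) (Y n))"
  shows "\<exists>y. hybrid_tendsto Y y"
proof -
  have "\<forall>\<^sub>F n in sequentially. hybrid_dist (Y (Suc n)) (Y n) < 1"
    by (rule order_tendstoD[OF summable_LIMSEQ_zero[OF assms]]) simp
  then obtain N where N: "\<And>n. N \<le> n \<Longrightarrow> hybrid_dist (Y (Suc n)) (Y n) < 1"
    unfolding eventually_sequentially by blast
  have same: "snd (Y (Suc n)) = snd (Y n)"
    and d: "dist (fst (Y (Suc n))) (fst (Y n)) = hybrid_dist (Y (Suc n)) (Y n)" if "N \<le> n" for n
    using N[OF that] by (auto simp: hybrid_dist_def split: if_splits)
  have "snd (Y n) = snd (Y N)" if "N \<le> n" for n
    using that by (induction n rule: dec_induct) (auto simp: same)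
  then have ev: "\<forall>\<^sub>F n in sequentially. snd (Y n) = snd (Y N)"
    unfolding eventually_sequentially by blast
  have sm: "summable (\<lambda>n. dist (fst (Y (Suc n))) (fst (Y n)))"
    by (rule summable_comparison_test_ev[OF _ assms])
      (use d in \<open>auto simp: eventually_sequentially intro!: exI[of _ N]\<close>)
  have "Cauchy (\<lambda>n. fst (Y n))"
  proof (rule metric_CauchyI)
    fix e :: real assume "0 < e"
    with sm obtain K where K: "\<And>m n. K \<le> m \<Longrightarrow> norm (sum (\<lambda>n. dist (fst (Y (Suc n))) (fst (Y n))) {m..<n}) < e"
      unfolding summable_Cauchy by blast
    have tri: "dist (fst (Y m)) (fst (Y n)) \<le> sum (\<lambda>n. dist (fst (Y (Suc n))) (fst (Y n))) {m..<n}" if "m \<le> n" for m n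
      using that
    proof (induction n rule: dec_induct)
      case (step n)
      have "dist (fst (Y m)) (fst (Y (Suc n))) \<le> dist (fst (Y m)) (fst (Y n)) + dist (fst (Y (Suc n))) (fst (Y n))"
        by (rule dist_triangle2)
      with step show ?case by simp
    qed simp
    have lt: "dist (fst (Y m)) (fst (Y n)) < e" if "K \<le> m" "m \<le> n" for m n
      using tri[OF that(2)] K[OF that(1), of n] by (simp add: abs_if split: if_splits)
    show "\<exists>M. \<forall>m\<ge>M. \<forall>n\<ge>M. dist (fst (Y m)) (fst (Y n)) < e"
      by (rule exI[of _ K]) (metis lt dist_commute nle_le)
  qed
  then obtain x where "(\<lambda>n. fst (Y n)) \<longlonglongrightarrow> x" using Cauchy_convergent convergent_def by blast
  with ev show ?thesis by (intro exI[of _ "(x, snd (Y N))"]) (simp add: hybrid_tendsto_def)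
qed

text \<open>Continuous approximations of the indicator of \<open>C \<times> {l}\<close> for closed \<open>C\<close>. They determine a
  finite measure on pairs, which replaces weak convergence on the hybrid space.\<close>

definition sheet_cutoff :: "'a::metric_space set \<Rightarrow> 'm \<Rightarrow> nat \<Rightarrow> 'a \<times> 'm \<Rightarrow> real" where
  "sheet_cutoff C l k a = (if snd a = l then max 0 (1 - real k * infdist (fst a) C) else 0)"

lemma sheet_cutoff_bounds: "0 \<le> sheet_cutoff C l k a" "sheet_cutoff C l k a \<le> 1"
  by (auto simp: sheet_cutoff_def infdist_nonneg)

lemma measurable_sheet_cutoff [measurable]:
  "sheet_cutoff C l k \<in> borel_measurable ((borel :: 'a::{second_countable_topology, metric_space} measure) \<Otimes>\<^sub>M count_space (UNIV :: 'm::countable set))"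
proof -
  have [measurable]: "(\<lambda>x. infdist x C) \<in> borel_measurable (borel :: 'a measure)"
    by (intro borel_measurable_continuous_onI continuous_intros)
  show ?thesis unfolding sheet_cutoff_def[abs_def] by measurable
qed

lemma sheet_cutoff_tendsto:
  assumes "hybrid_tendsto Y y"
  shows "(\<lambda>n. sheet_cutoff C l k (Y n)) \<longlonglongrightarrow> sheet_cutoff C l k y"
proof -
  have "(\<lambda>n. max 0 (1 - real k * infdist (fst (Y n)) C)) \<longlonglongrightarrow> max 0 (1 - real k * infdist (fst y) C)"
    using assms by (auto simp: hybrid_tendsto_def intro!: tendsto_intros)
  then have "(\<lambda>n. if snd y = l then max 0 (1 - real k * infdist (fst (Y n)) C) else 0) \<longlonglongrightarrow> sheet_cutoff C l k y"
    by (auto simp: sheet_cutoff_def)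
  moreover have "\<forall>\<^sub>F n in sequentially. (if snd y = l then max 0 (1 - real k * infdist (fst (Y n)) C) else 0) = sheet_cutoff C l k (Y n)"
    using assms[unfolded hybrid_tendsto_def, THEN conjunct2] by eventually_elim (simp add: sheet_cutoff_def)
  ultimately show ?thesis by (rule Lim_transform_eventually)
qed

lemma sheet_cutoff_indicator:
  assumes "closed C" "C \<noteq> {}"
  shows "(\<lambda>k. sheet_cutoff C l k a) \<longlonglongrightarrow> indicator (C \<times> {l}) a"
proof (cases "snd a = l \<and> fst a \<in> C")
  case True
  then have "sheet_cutoff C l k a = 1" for k
    by (simp add: sheet_cutoff_def)
  moreover have "indicator (C \<times> {l}) a = (1::real)" using True by (cases a) auto
  ultimately show ?thesis by simp
next
  case False
  have "\<forall>\<^sub>F k in sequentially. sheet_cutoff C l k a = 0"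
  proof (cases "snd a = l")
    case True
    then have "0 < infdist (fst a) C"
      using False in_closed_iff_infdist_zero[OF assms, of "fst a"] infdist_nonneg[of "fst a" C] by linarith
    then have "\<forall>\<^sub>F k in sequentially. 1 / infdist (fst a) C < real k"
      using filterlim_real_sequentially by (simp add: filterlim_at_top_dense)
    then show ?thesis
      by eventually_elim (use \<open>0 < infdist (fst a) C\<close> in \<open>auto simp: sheet_cutoff_def field_simps\<close>)
  qed (simp add: sheet_cutoff_def)
  moreover have "indicator (C \<times> {l}) a = (0::real)" using False by (cases a) auto
  ultimately show ?thesis by (simp add: tendsto_eventually)
qed

lemma measure_eqI_sheets:
  fixes \<mu> \<nu> :: "('a::topological_space \<times> 'm::finite) measure"
  assumes sets: "sets \<mu> = sets (borel \<Otimes>\<^sub>M count_space UNIV)" "sets \<nu> = sets (borel \<Otimes>\<^sub>M count_space UNIV)"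
    and sheet: "\<And>A l. A \<in> sets borel \<Longrightarrow> emeasure \<mu> (A \<times> {l}) = emeasure \<nu> (A \<times> {l})"
  shows "\<mu> = \<nu>"
proof (rule measure_eqI)
  fix A assume "A \<in> sets \<mu>"
  then have A: "A \<in> sets (borel \<Otimes>\<^sub>M count_space UNIV)" using sets by simp
  define As where "As l = (\<lambda>x. (x, l)) -` A" for l
  have As: "As l \<in> sets borel" for l
  proof -
    have "(\<lambda>x::'a. (x, l)) \<in> measurable borel (borel \<Otimes>\<^sub>M count_space UNIV)" by measurable
    from measurable_sets[OF this A] show ?thesis by (simp add: As_def)
  qed
  have AU: "A = (\<Union>l. As l \<times> {l})" by (auto simp: As_def)
  have sum: "emeasure M A = (\<Sum>l\<in>UNIV. emeasure M (As l \<times> {l}))"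
    if "sets M = sets (borel \<Otimes>\<^sub>M count_space UNIV)" for M
    by (subst AU, rule sum_emeasure[symmetric])
      (use As that in \<open>auto simp: disjoint_family_on_def intro!: pair_measureI\<close>)
  show "emeasure \<mu> A = emeasure \<nu> A"
    unfolding sum[OF sets(1)] sum[OF sets(2)] by (simp add: sheet As)
qed (simp add: sets)

lemma measure_eqI_sheet_cutoff:
  fixes \<mu> \<nu> :: "('a::{second_countable_topology, metric_space} \<times> 'm::finite) measure"
  assumes sets: "sets \<mu> = sets (borel \<Otimes>\<^sub>M count_space UNIV)" "sets \<nu> = sets (borel \<Otimes>\<^sub>M count_space UNIV)"
    and fin: "finite_measure \<mu>" "finite_measure \<nu>"
    and eq: "\<And>C l k. closed C \<Longrightarrow> (\<integral>\<^sup>+a. ennreal (sheet_cutoff C l k a) \<partial>\<mu>) = (\<integral>\<^sup>+a. ennreal (sheet_cutoff C l k a) \<partial>\<nu>)"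
  shows "\<mu> = \<nu>"
proof -
  let ?S = "borel \<Otimes>\<^sub>M count_space UNIV :: ('a \<times> 'm) measure"
  interpret \<mu>: finite_measure \<mu> by fact
  interpret \<nu>: finite_measure \<nu> by fact
  note sets[measurable_cong]
  have closedS: "C \<times> {l} \<in> sets ?S" if "closed C" for C and l :: 'm
    using that by (intro pair_measureI) auto
  have lim: "(\<lambda>k. \<integral>\<^sup>+a. ennreal (sheet_cutoff C l k a) \<partial>M) \<longlonglongrightarrow> emeasure M (C \<times> {l})"
    if M: "finite_measure M" "sets M = sets ?S" and C: "closed C" "C \<noteq> {}" for M C and l :: 'm
  proof -
    interpret M: finite_measure M by fact
    note M(2)[measurable_cong]
    have [measurable]: "C \<times> {l} \<in> sets M" using closedS[OF C(1)] M(2) by simp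
    have "(\<lambda>k. \<integral>\<^sup>+a. ennreal (sheet_cutoff C l k a) \<partial>M) \<longlonglongrightarrow> (\<integral>\<^sup>+a. indicator (C \<times> {l}) a \<partial>M)"
    proof (rule nn_integral_dominated_convergence[where w="\<lambda>_. 1"])
      show "AE a in M. (\<lambda>k. ennreal (sheet_cutoff C l k a)) \<longlonglongrightarrow> indicator (C \<times> {l}) a"
        using sheet_cutoff_indicator[OF C, of l] by (auto intro!: AE_I2 simp flip: ennreal_indicator)
    qed (auto simp: sheet_cutoff_bounds M.emeasure_finite less_top[symmetric])
    then show ?thesis by simp
  qed
  have closed_eq: "emeasure \<mu> (C \<times> {l}) = emeasure \<nu> (C \<times> {l})" if C: "closed C" for C and l :: 'm
  proof (cases "C = {}")
    case False
    show ?thesis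
      using LIMSEQ_unique[OF lim[OF fin(1) sets(1) C False, of l]] lim[OF fin(2) sets(2) C False, of l] eq[OF C] by simp
  qed simp
  have sheet: "emeasure \<mu> (A \<times> {l}) = emeasure \<nu> (A \<times> {l})" if A: "A \<in> sets borel" for A and l :: 'm
  proof -
    define tr where "tr M = distr (restrict_space M (UNIV \<times> {l})) borel fst" for M :: "('a \<times> 'm) measure"
    have em: "emeasure (tr M) B = emeasure M (B \<times> {l})" if M: "sets M = sets ?S" and B: "B \<in> sets borel" for M B
    proof -
      have space: "space M = UNIV" using sets_eq_imp_space_eq[OF M] by (simp add: space_pair_measure)
      have [measurable]: "fst \<in> measurable (restrict_space M (UNIV \<times> {l})) borel"
        by (intro measurable_restrict_space1) (simp add: measurable_cong_sets[OF M refl])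
      have U: "UNIV \<times> {l} \<in> sets M" unfolding M by (intro pair_measureI) auto
      have "emeasure (tr M) B = emeasure (restrict_space M (UNIV \<times> {l})) (fst -` B \<inter> space (restrict_space M (UNIV \<times> {l})))"
        unfolding tr_def using B by (subst emeasure_distr) auto
      also have "fst -` B \<inter> space (restrict_space M (UNIV \<times> {l})) = B \<times> {l}"
        by (auto simp: space_restrict_space space)
      also have "emeasure (restrict_space M (UNIV \<times> {l})) (B \<times> {l}) = emeasure M (B \<times> {l})"
        using U by (subst emeasure_restrict_space) (auto simp: space)
      finally show ?thesis .
    qed
    have "tr \<mu> = tr \<nu>"
    proof (rule measure_eqI_generator_eq[where E="Collect closed" and \<Omega>=UNIV and A="\<lambda>_. UNIV"])
      show "Int_stable (Collect closed :: 'a set set)" by (auto simp: Int_stable_def)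
      show "emeasure (tr \<mu>) X = emeasure (tr \<nu>) X" if "X \<in> Collect closed" for X
        using that closed_eq by (simp add: em sets)
      show "sets (tr \<mu>) = sigma_sets UNIV (Collect closed)" "sets (tr \<nu>) = sigma_sets UNIV (Collect closed)"
        by (simp_all add: tr_def borel_eq_closed)
      show "emeasure (tr \<mu>) UNIV \<noteq> \<infinity>" for i :: nat
        by (simp add: em[OF sets(1)] \<mu>.emeasure_finite)
    qed auto
    then show ?thesis using em[OF sets(1) A] em[OF sets(2) A] by simp
  qed
  show ?thesis by (rule measure_eqI_sheets[OF sets sheet])
qed

lemma AE_summable_of_geometric:
  fixes d :: "nat \<Rightarrow> 'w \<Rightarrow> ennreal" and \<gamma> :: real
  assumes [measurable]: "\<And>n. d n \<in> borel_measurable M"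
    and \<gamma>: "0 \<le> \<gamma>" "\<gamma> < 1" and C: "C < top"
    and bound: "\<And>n. (\<integral>\<^sup>+\<omega>. d n \<omega> \<partial>M) \<le> ennreal (\<gamma> ^ n) * C"
    and e: "\<And>n \<omega>. 0 \<le> e n \<omega>" "\<And>n \<omega>. ennreal (e n \<omega>) \<le> d n \<omega>"
  shows "AE \<omega> in M. summable (\<lambda>n. e n \<omega>)"
proof -
  have "(\<integral>\<^sup>+\<omega>. (\<Sum>n. d n \<omega>) \<partial>M) = (\<Sum>n. \<integral>\<^sup>+\<omega>. d n \<omega> \<partial>M)"
    by (rule nn_integral_suminf) simp
  also have "\<dots> \<le> (\<Sum>n. ennreal (\<gamma> ^ n) * C)"
    by (intro suminf_le bound summableI)
  also have "\<dots> = ennreal (\<Sum>n. \<gamma> ^ n) * C"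
    using \<gamma> by (simp add: ennreal_suminf_multc suminf_ennreal2 summable_geometric)
  also have "\<dots> < \<infinity>" using C by (simp add: ennreal_mult_less_top)
  finally have "AE \<omega> in M. (\<Sum>n. d n \<omega>) \<noteq> \<infinity>"
    by (intro nn_integral_PInf_AE) auto
  then show ?thesis
  proof eventually_elim
    case (elim \<omega>)
    have "(\<Sum>n. ennreal (e n \<omega>)) \<le> (\<Sum>n. d n \<omega>)"
      by (intro suminf_le e summableI)
    with elim have "(\<Sum>n. ennreal (e n \<omega>)) \<noteq> \<top>"
      by (metis infinity_ennreal_def neq_top_trans)
    then show ?case by (intro summable_suminf_not_top e)
  qed
qed

text \<open>The contraction is measured by \<open>D\<close>; the lower bound \<open>hybrid_dist\<close> turns summability of
  \<open>D\<close> along a sequence into convergence.\<close>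

locale contracting_random_map = prob_space W for W :: "'w measure" +
  fixes \<Psi> :: "'a::{banach, second_countable_topology} \<times> 'm::finite \<Rightarrow> 'w \<Rightarrow> 'a \<times> 'm"
    and D :: "'a \<times> 'm \<Rightarrow> 'a \<times> 'm \<Rightarrow> ennreal" and \<gamma> :: real and a0 :: "'a \<times> 'm"
  assumes map_measurable: "(\<lambda>(a, w). \<Psi> a w) \<in> measurable
      ((borel \<Otimes>\<^sub>M count_space UNIV) \<Otimes>\<^sub>M W) (borel \<Otimes>\<^sub>M count_space UNIV)"
    and dist_measurable: "(\<lambda>(a, b). D a b) \<in> borel_measurable
      ((borel \<Otimes>\<^sub>M count_space UNIV) \<Otimes>\<^sub>M (borel \<Otimes>\<^sub>M count_space UNIV))"
    and dist_ge: "\<And>a b. ennreal (hybrid_dist a b) \<le> D a b"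
    and dist_finite: "\<And>a b. D a b < top"
    and rate: "0 \<le> \<gamma>" "\<gamma> < 1"
    and contraction: "\<And>a b. (\<integral>\<^sup>+w. D (\<Psi> a w) (\<Psi> b w) \<partial>W) \<le> ennreal \<gamma> * D a b"
    and start_finite: "(\<integral>\<^sup>+w. D (\<Psi> a0 w) a0 \<partial>W) < top"
    and map_continuous: "\<And>w Y y. hybrid_tendsto Y y \<Longrightarrow> hybrid_tendsto (\<lambda>n. \<Psi> (Y n) w) (\<Psi> y w)"
begin

abbreviation "E \<equiv> (borel :: 'a measure) \<Otimes>\<^sub>M count_space (UNIV :: 'm set)"
abbreviation "\<S> \<equiv> stream_space W"

sublocale S: prob_space \<S> by (rule prob_space_stream_space)

lemma measurable_const_E [measurable]: "(\<lambda>_. a) \<in> measurable M E"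
  by (rule measurable_const) (simp add: space_pair_measure)

lemma measurable_map [measurable (raw)]:
  assumes "X \<in> measurable M E" "Y \<in> measurable M W"
  shows "(\<lambda>\<omega>. \<Psi> (X \<omega>) (Y \<omega>)) \<in> measurable M E"
  using measurable_compose[OF measurable_Pair[OF assms] map_measurable] by simp

lemma measurable_D [measurable (raw)]:
  assumes "X \<in> measurable M E" "Y \<in> measurable M E"
  shows "(\<lambda>\<omega>. D (X \<omega>) (Y \<omega>)) \<in> borel_measurable M"
  using measurable_compose[OF measurable_Pair[OF assms] dist_measurable] by simp

lemma measurable_backward [measurable (raw)]:
  assumes "X \<in> measurable M E" "Y \<in> measurable M \<S>"
  shows "(\<lambda>\<omega>. backward_iterate \<Psi> n (X \<omega>) (Y \<omega>)) \<in> measurable M E"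
  using assms
proof (induction n arbitrary: Y)
  case (Suc n)
  note Suc.prems[measurable]
  have [measurable]: "(\<lambda>\<omega>. backward_iterate \<Psi> n (X \<omega>) (stl (Y \<omega>))) \<in> measurable M E"
    by (rule Suc.IH) measurable
  show ?case by simp
qed simp

text \<open>The head and the tail of a noise stream are independent, and the tail is again a noise stream.\<close>

lemma nn_integral_shift:
  assumes [measurable]: "(\<lambda>z. k (fst z) (snd z)) \<in> borel_measurable (\<S> \<Otimes>\<^sub>M W)"
  shows "(\<integral>\<^sup>+\<omega>. k (stl \<omega>) (shd \<omega>) \<partial>\<S>) = (\<integral>\<^sup>+\<omega>. \<integral>\<^sup>+w. k \<omega> w \<partial>W \<partial>\<S>)"
proof -
  interpret WS: pair_sigma_finite W \<S> ..
  have k: "(\<lambda>\<omega>. k (X \<omega>) (Y \<omega>)) \<in> borel_measurable N"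
    if "X \<in> measurable N \<S>" "Y \<in> measurable N W" for X Y and N :: "'q measure"
    using measurable_compose[OF measurable_Pair[OF that] assms] by simp
  have "(\<integral>\<^sup>+\<omega>. k (stl \<omega>) (shd \<omega>) \<partial>\<S>) = (\<integral>\<^sup>+w. \<integral>\<^sup>+\<omega>. k \<omega> w \<partial>\<S> \<partial>W)"
    by (subst nn_integral_stream_space) (auto intro: k)
  also have "\<dots> = (\<integral>\<^sup>+\<omega>. \<integral>\<^sup>+w. k \<omega> w \<partial>W \<partial>\<S>)"
    by (rule WS.Fubini'[symmetric]) (simp add: case_prod_beta' k)
  finally show ?thesis .
qed

lemma one_step_contraction:
  assumes [measurable]: "X \<in> measurable \<S> E" "Y \<in> measurable \<S> E"
  shows "(\<integral>\<^sup>+\<omega>. D (\<Psi> (X (stl \<omega>)) (shd \<omega>)) (\<Psi> (Y (stl \<omega>)) (shd \<omega>)) \<partial>\<S>)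
    \<le> ennreal \<gamma> * (\<integral>\<^sup>+\<omega>. D (X \<omega>) (Y \<omega>) \<partial>\<S>)"
proof -
  have "(\<integral>\<^sup>+\<omega>. D (\<Psi> (X (stl \<omega>)) (shd \<omega>)) (\<Psi> (Y (stl \<omega>)) (shd \<omega>)) \<partial>\<S>)
      = (\<integral>\<^sup>+\<omega>. \<integral>\<^sup>+w. D (\<Psi> (X \<omega>) w) (\<Psi> (Y \<omega>) w) \<partial>W \<partial>\<S>)"
    by (rule nn_integral_shift) measurable
  also have "\<dots> \<le> (\<integral>\<^sup>+\<omega>. ennreal \<gamma> * D (X \<omega>) (Y \<omega>) \<partial>\<S>)"
    by (intro nn_integral_mono contraction)
  also have "\<dots> = ennreal \<gamma> * (\<integral>\<^sup>+\<omega>. D (X \<omega>) (Y \<omega>) \<partial>\<S>)"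
    by (rule nn_integral_cmult) measurable
  finally show ?thesis .
qed

lemma geometric_step: "a \<le> ennreal (\<gamma> ^ n) * C \<Longrightarrow> ennreal \<gamma> * a \<le> ennreal (\<gamma> ^ Suc n) * C"
  using mult_left_mono[of a "ennreal (\<gamma> ^ n) * C" "ennreal \<gamma>"] rate
  by (simp add: ennreal_mult mult.assoc)

lemma backward_contraction:
  "(\<integral>\<^sup>+\<omega>. D (backward_iterate \<Psi> n a \<omega>) (backward_iterate \<Psi> n b \<omega>) \<partial>\<S>) \<le> ennreal (\<gamma> ^ n) * D a b"
proof (induction n)
  case 0
  then show ?case by (simp add: S.emeasure_space_1)
next
  case (Suc n)
  show ?case
    unfolding backward_iterate.simps
    by (rule order_trans[OF one_step_contraction geometric_step[OF Suc]]) measurable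
qed

text \<open>Consecutive backward iterates differ only in the innermost map, so their distance is that of two
  iterates of the same length started at \<open>\<Psi> a0 w\<close> and \<open>a0\<close>.\<close>

lemma backward_increment:
  "(\<integral>\<^sup>+\<omega>. D (backward_iterate \<Psi> (Suc n) a0 \<omega>) (backward_iterate \<Psi> n a0 \<omega>) \<partial>\<S>)
     \<le> ennreal (\<gamma> ^ n) * (\<integral>\<^sup>+w. D (\<Psi> a0 w) a0 \<partial>W)"
proof (induction n)
  case 0
  then show ?case by (subst nn_integral_stream_space) (simp_all add: S.emeasure_space_1)
next
  case (Suc n)
  show ?case
    unfolding backward_iterate.simps(2)[of _ "Suc n"] backward_iterate.simps(2)[of _ n _ "\<omega>" for \<omega>]
    by (rule order_trans[OF one_step_contraction geometric_step[OF Suc[unfolded backward_iterate.simps(2)]]]) measurable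
qed

definition pullback_limit :: "'w stream \<Rightarrow> 'a \<times> 'm" where
  "pullback_limit \<omega> = hybrid_lim (\<lambda>n. backward_iterate \<Psi> n a0 \<omega>)"

lemma measurable_pullback_limit [measurable]: "pullback_limit \<in> measurable \<S> E"
  unfolding pullback_limit_def[abs_def] by (intro measurable_hybrid_lim) measurable

lemma hybrid_dist_nonneg: "0 \<le> hybrid_dist a b"
  by (simp add: hybrid_dist_def)

lemma AE_pullback_start: "AE \<omega> in \<S>. hybrid_tendsto (\<lambda>n. backward_iterate \<Psi> n a0 \<omega>) (pullback_limit \<omega>)"
proof -
  have "AE \<omega> in \<S>. summable (\<lambda>n. hybrid_dist (backward_iterate \<Psi> (Suc n) a0 \<omega>) (backward_iterate \<Psi> n a0 \<omega>))"
    by (rule AE_summable_of_geometric[where C="\<integral>\<^sup>+w. D (\<Psi> a0 w) a0 \<partial>W" and \<gamma>=\<gamma>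
          and d="\<lambda>n \<omega>. D (backward_iterate \<Psi> (Suc n) a0 \<omega>) (backward_iterate \<Psi> n a0 \<omega>)"])
      (measurable, auto simp del: backward_iterate.simps simp: rate start_finite backward_increment hybrid_dist_nonneg dist_ge)
  then show ?thesis
  proof eventually_elim
    case (elim \<omega>)
    from hybrid_summable_convergent[OF this] show ?case
      unfolding pullback_limit_def using hybrid_lim_eq by metis
  qed
qed

text \<open>The limit does not depend on the starting point, because two backward iterates driven by the same
  noise approach each other.\<close>

lemma AE_pullback: "AE \<omega> in \<S>. hybrid_tendsto (\<lambda>n. backward_iterate \<Psi> n a \<omega>) (pullback_limit \<omega>)"
proof -
  have "AE \<omega> in \<S>. summable (\<lambda>n. hybrid_dist (backward_iterate \<Psi> n a \<omega>) (backward_iterate \<Psi> n a0 \<omega>))"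
    by (rule AE_summable_of_geometric[where C="D a a0" and \<gamma>=\<gamma>
          and d="\<lambda>n \<omega>. D (backward_iterate \<Psi> n a \<omega>) (backward_iterate \<Psi> n a0 \<omega>)"])
      (measurable, auto simp: rate dist_finite backward_contraction hybrid_dist_nonneg dist_ge)
  with AE_pullback_start show ?thesis
  proof eventually_elim
    case (elim \<omega>)
    show ?case by (rule hybrid_tendsto_close[OF elim(1) summable_LIMSEQ_zero[OF elim(2)]])
  qed
qed

definition stationary :: "('a \<times> 'm) measure \<Rightarrow> bool" where
  "stationary \<mu> \<longleftrightarrow> prob_space \<mu> \<and> sets \<mu> = sets E \<and> distr (\<mu> \<Otimes>\<^sub>M W) E (\<lambda>(a, w). \<Psi> a w) = \<mu>"

lemma nn_integral_image:
  assumes sets[measurable_cong]: "sets \<mu> = sets E" and [measurable]: "u \<in> borel_measurable E"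
  shows "(\<integral>\<^sup>+a. u a \<partial>distr (\<mu> \<Otimes>\<^sub>M W) E (\<lambda>(a, w). \<Psi> a w)) = (\<integral>\<^sup>+a. \<integral>\<^sup>+w. u (\<Psi> a w) \<partial>W \<partial>\<mu>)"
proof -
  have "(\<integral>\<^sup>+a. u a \<partial>distr (\<mu> \<Otimes>\<^sub>M W) E (\<lambda>(a, w). \<Psi> a w))
      = (\<integral>\<^sup>+x. u (case x of (a, w) \<Rightarrow> \<Psi> a w) \<partial>(\<mu> \<Otimes>\<^sub>M W))"
    by (subst nn_integral_distr) measurable
  also have "\<dots> = (\<integral>\<^sup>+a. \<integral>\<^sup>+w. u (\<Psi> a w) \<partial>W \<partial>\<mu>)"
    by (subst nn_integral_fst[symmetric]) auto
  finally show ?thesis .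
qed

lemma stationary_nn_integral:
  assumes "stationary \<mu>" "u \<in> borel_measurable E"
  shows "(\<integral>\<^sup>+a. \<integral>\<^sup>+w. u (\<Psi> a w) \<partial>W \<partial>\<mu>) = (\<integral>\<^sup>+a. u a \<partial>\<mu>)"
  using nn_integral_image[of \<mu> u] assms by (simp add: stationary_def)

lemma stationary_backward:
  assumes \<mu>: "stationary \<mu>" and u: "u \<in> borel_measurable E"
  shows "(\<integral>\<^sup>+a. \<integral>\<^sup>+\<omega>. u (backward_iterate \<Psi> n a \<omega>) \<partial>\<S> \<partial>\<mu>) = (\<integral>\<^sup>+a. u a \<partial>\<mu>)"
  using u
proof (induction n arbitrary: u)
  case 0
  then show ?case by (simp add: S.emeasure_space_1)
next
  case (Suc n)
  note Suc.prems[measurable]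
  have "(\<integral>\<^sup>+a. \<integral>\<^sup>+\<omega>. u (backward_iterate \<Psi> (Suc n) a \<omega>) \<partial>\<S> \<partial>\<mu>)
      = (\<integral>\<^sup>+a. \<integral>\<^sup>+\<omega>. (\<integral>\<^sup>+w. u (\<Psi> (backward_iterate \<Psi> n a \<omega>) w) \<partial>W) \<partial>\<S> \<partial>\<mu>)"
    unfolding backward_iterate.simps by (subst nn_integral_shift) simp_all
  also have "\<dots> = (\<integral>\<^sup>+a. \<integral>\<^sup>+w. u (\<Psi> a w) \<partial>W \<partial>\<mu>)"
    by (rule Suc.IH) measurable
  also have "\<dots> = (\<integral>\<^sup>+a. u a \<partial>\<mu>)" by (rule stationary_nn_integral[OF \<mu> Suc.prems])
  finally show ?case .
qed

text \<open>By continuity the limit \<open>Y\<close> solves \<open>Y (w ## \<omega>) = \<Psi> (Y \<omega>) w\<close>, and \<open>Y \<omega>\<close> is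
  independent of \<open>w\<close>.\<close>

theorem stationary_pullback_law: "stationary (distr \<S> E pullback_limit)"
proof -
  let ?\<mu> = "distr \<S> E pullback_limit"
  have limit: "AE \<omega> in \<S>. pullback_limit (w ## \<omega>) = \<Psi> (pullback_limit \<omega>) w" for w
    using AE_pullback_start
  proof eventually_elim
    case (elim \<omega>)
    from map_continuous[OF this, of w]
    have "hybrid_tendsto (\<lambda>n. backward_iterate \<Psi> (Suc n) a0 (w ## \<omega>)) (\<Psi> (pullback_limit \<omega>) w)" by simp
    then have "hybrid_tendsto (\<lambda>n. backward_iterate \<Psi> n a0 (w ## \<omega>)) (\<Psi> (pullback_limit \<omega>) w)"
      by (subst (asm) hybrid_tendsto_shift)
    then show ?case unfolding pullback_limit_def[of "w ## \<omega>"] by (simp add: hybrid_lim_eq)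
  qed
  have "distr (?\<mu> \<Otimes>\<^sub>M W) E (\<lambda>(a, w). \<Psi> a w) = ?\<mu>"
  proof (rule measure_eqI)
    fix A assume "A \<in> sets (distr (?\<mu> \<Otimes>\<^sub>M W) E (\<lambda>(a, w). \<Psi> a w))"
    then have [measurable]: "A \<in> sets E" by simp
    have "emeasure (distr (?\<mu> \<Otimes>\<^sub>M W) E (\<lambda>(a, w). \<Psi> a w)) A = (\<integral>\<^sup>+a. \<integral>\<^sup>+w. indicator A (\<Psi> a w) \<partial>W \<partial>?\<mu>)"
      by (subst nn_integral_image[symmetric]) simp_all
    also have "\<dots> = (\<integral>\<^sup>+\<omega>. \<integral>\<^sup>+w. indicator A (\<Psi> (pullback_limit \<omega>) w) \<partial>W \<partial>\<S>)"
      by (subst nn_integral_distr) simp_all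
    also have "\<dots> = (\<integral>\<^sup>+\<omega>. indicator A (\<Psi> (pullback_limit (stl \<omega>)) (shd \<omega>)) \<partial>\<S>)"
      by (rule nn_integral_shift[symmetric]) measurable
    also have "\<dots> = (\<integral>\<^sup>+w. \<integral>\<^sup>+\<omega>. indicator A (\<Psi> (pullback_limit \<omega>) w) \<partial>\<S> \<partial>W)"
      by (subst nn_integral_stream_space) simp_all
    also have "\<dots> = (\<integral>\<^sup>+w. \<integral>\<^sup>+\<omega>. indicator A (pullback_limit (w ## \<omega>)) \<partial>\<S> \<partial>W)"
    proof (rule nn_integral_cong, rule nn_integral_cong_AE)
      show "AE \<omega> in \<S>. indicator A (\<Psi> (pullback_limit \<omega>) w) = (indicator A (pullback_limit (w ## \<omega>)) :: ennreal)" for w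
        using limit[of w] by eventually_elim simp
    qed
    also have "\<dots> = (\<integral>\<^sup>+\<omega>. indicator A (pullback_limit \<omega>) \<partial>\<S>)"
      by (subst (2) nn_integral_stream_space) simp_all
    also have "\<dots> = (\<integral>\<^sup>+a. indicator A a \<partial>?\<mu>)"
      by (subst nn_integral_distr) simp_all
    also have "\<dots> = emeasure ?\<mu> A" by simp
    finally show "emeasure (distr (?\<mu> \<Otimes>\<^sub>M W) E (\<lambda>(a, w). \<Psi> a w)) A = emeasure ?\<mu> A" .
  qed simp
  moreover have "prob_space ?\<mu>" by (rule S.prob_space_distr) simp
  ultimately show ?thesis unfolding stationary_def by simp
qed

text \<open>Started from a stationary law independent of the noise, all backward iterates have this law, while
  they converge almost surely to the limit for every starting point.\<close>

theorem stationary_unique: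
  assumes \<mu>: "stationary \<mu>"
  shows "\<mu> = distr \<S> E pullback_limit"
proof (rule measure_eqI_sheet_cutoff)
  interpret \<mu>: prob_space \<mu> using \<mu> by (simp add: stationary_def)
  show sets[measurable_cong]: "sets \<mu> = sets E" using \<mu> by (simp add: stationary_def)
  show "finite_measure \<mu>" by (rule \<mu>.finite_measure_axioms)
  show "finite_measure (distr \<S> E pullback_limit)"
    by (rule S.finite_measure_distr) simp
  fix C :: "'a set" and l :: 'm and k
  let ?u = "sheet_cutoff C l k"
  have le1: "ennreal (?u a) \<le> 1" for a using sheet_cutoff_bounds(2)[of C l k a] by (simp add: ennreal_le_1)
  have lim: "(\<lambda>n. \<integral>\<^sup>+\<omega>. ennreal (?u (backward_iterate \<Psi> n a \<omega>)) \<partial>\<S>) \<longlonglongrightarrow> (\<integral>\<^sup>+\<omega>. ennreal (?u (pullback_limit \<omega>)) \<partial>\<S>)" for a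
  proof (rule nn_integral_dominated_convergence[where w="\<lambda>_. 1"])
    show "AE \<omega> in \<S>. (\<lambda>n. ennreal (?u (backward_iterate \<Psi> n a \<omega>))) \<longlonglongrightarrow> ennreal (?u (pullback_limit \<omega>))"
      using AE_pullback[of a] by eventually_elim (intro tendsto_ennrealI sheet_cutoff_tendsto)
  qed (simp_all add: sheet_cutoff_bounds S.emeasure_space_1)
  have "(\<lambda>n. \<integral>\<^sup>+a. \<integral>\<^sup>+\<omega>. ennreal (?u (backward_iterate \<Psi> n a \<omega>)) \<partial>\<S> \<partial>\<mu>)
      \<longlonglongrightarrow> (\<integral>\<^sup>+a. (\<integral>\<^sup>+\<omega>. ennreal (?u (pullback_limit \<omega>)) \<partial>\<S>) \<partial>\<mu>)"
  proof (rule nn_integral_dominated_convergence[where w="\<lambda>_. 1"])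
    fix n
    have "(\<integral>\<^sup>+\<omega>. ennreal (?u (backward_iterate \<Psi> n a \<omega>)) \<partial>\<S>) \<le> (\<integral>\<^sup>+\<omega>. 1 \<partial>\<S>)" for a
      by (intro nn_integral_mono le1)
    then show "AE a in \<mu>. (\<integral>\<^sup>+\<omega>. ennreal (?u (backward_iterate \<Psi> n a \<omega>)) \<partial>\<S>) \<le> 1"
      by (simp add: S.emeasure_space_1)
  qed (simp_all add: lim \<mu>.emeasure_space_1)
  moreover have "(\<integral>\<^sup>+a. \<integral>\<^sup>+\<omega>. ennreal (?u (backward_iterate \<Psi> n a \<omega>)) \<partial>\<S> \<partial>\<mu>) = (\<integral>\<^sup>+a. ennreal (?u a) \<partial>\<mu>)" for n
    by (rule stationary_backward[OF \<mu>]) simp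
  ultimately have "(\<integral>\<^sup>+a. ennreal (?u a) \<partial>\<mu>) = (\<integral>\<^sup>+\<omega>. ennreal (?u (pullback_limit \<omega>)) \<partial>\<S>)"
    by (simp add: LIMSEQ_const_iff \<mu>.emeasure_space_1)
  then show "(\<integral>\<^sup>+a. ennreal (?u a) \<partial>\<mu>) = (\<integral>\<^sup>+a. ennreal (?u a) \<partial>distr \<S> E pullback_limit)"
    by (subst nn_integral_distr) simp_all
qed simp

end

section \<open>The Markov property of the truncated scheme\<close>

lemma Z_scheme_0: "Z_scheme f g \<phi> h B r \<Delta> x 0 \<omega> = truncation (\<phi> (r 0 \<omega>)) (h \<Delta>) x"
  by (simp add: Z_scheme_def)

text \<open>The recursion for the truncated values alone. The next value before truncation depends on the past
  only through the present truncated one and the switching state, so these two form a Markov chain.\<close>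

definition truncated_step where
  "truncated_step f g \<phi> v \<Delta> x i n j = truncation (\<phi> j) v (x + \<Delta> *\<^sub>R f x i + g x i *v n)"

lemma Z_scheme_Suc:
  "Z_scheme f g \<phi> h B r \<Delta> x (Suc k) \<omega> =
     truncated_step f g \<phi> (h \<Delta>) \<Delta> (Z_scheme f g \<phi> h B r \<Delta> x k \<omega>) (r (real k * \<Delta>) \<omega>)
       (B (real (Suc k) * \<Delta>) \<omega> - B (real k * \<Delta>) \<omega>) (r (real (Suc k) * \<Delta>) \<omega>)"
  by (simp add: Z_scheme_def truncated_step_def Let_def)

lemma (in prob_space) distr_pair_of_indep_set:
  assumes ind: "indep_set \<A> \<B>"
    and [measurable]: "X \<in> measurable M S" "Y \<in> measurable M T"
    and X: "\<And>A. A \<in> sets S \<Longrightarrow> X -` A \<inter> space M \<in> \<A>"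
    and Y: "\<And>A. A \<in> sets T \<Longrightarrow> Y -` A \<inter> space M \<in> \<B>"
  shows "distr M (S \<Otimes>\<^sub>M T) (\<lambda>\<omega>. (X \<omega>, Y \<omega>)) = distr M S X \<Otimes>\<^sub>M distr M T Y"
proof (rule pair_measure_eqI[symmetric])
  interpret X: prob_space "distr M S X" by (rule prob_space_distr) simp
  interpret Y: prob_space "distr M T Y" by (rule prob_space_distr) simp
  show "sigma_finite_measure (distr M S X)" "sigma_finite_measure (distr M T Y)"
    by (rule X.sigma_finite_measure_axioms Y.sigma_finite_measure_axioms)+
  fix A C assume "A \<in> sets (distr M S X)" "C \<in> sets (distr M T Y)"
  then have [measurable]: "A \<in> sets S" "C \<in> sets T" by auto
  have "(\<lambda>\<omega>. (X \<omega>, Y \<omega>)) -` (A \<times> C) \<inter> space M = (X -` A \<inter> space M) \<inter> (Y -` C \<inter> space M)"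
    by auto
  then show "emeasure (distr M S X) A * emeasure (distr M T Y) C
      = emeasure (distr M (S \<Otimes>\<^sub>M T) (\<lambda>\<omega>. (X \<omega>, Y \<omega>))) (A \<times> C)"
    using indep_setD[OF ind X Y, of A C]
    by (simp add: emeasure_distr emeasure_eq_measure ennreal_mult)
qed simp_all

lemma (in prob_space) nn_integral_pair_of_indep_set:
  assumes ind: "indep_set \<A> \<B>"
    and [measurable]: "X \<in> measurable M S" "Y \<in> measurable M T"
    and X: "\<And>A. A \<in> sets S \<Longrightarrow> X -` A \<inter> space M \<in> \<A>"
    and Y: "\<And>A. A \<in> sets T \<Longrightarrow> Y -` A \<inter> space M \<in> \<B>"
    and [measurable]: "u \<in> borel_measurable (S \<Otimes>\<^sub>M T)"
  shows "(\<integral>\<^sup>+\<omega>. u (X \<omega>, Y \<omega>) \<partial>M) = (\<integral>\<^sup>+\<omega>. \<integral>\<^sup>+y. u (X \<omega>, y) \<partial>distr M T Y \<partial>M)"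
proof -
  interpret X: prob_space "distr M S X" by (rule prob_space_distr) simp
  interpret Y: prob_space "distr M T Y" by (rule prob_space_distr) simp
  have "(\<integral>\<^sup>+\<omega>. u (X \<omega>, Y \<omega>) \<partial>M) = (\<integral>\<^sup>+z. u z \<partial>distr M (S \<Otimes>\<^sub>M T) (\<lambda>\<omega>. (X \<omega>, Y \<omega>)))"
    by (subst nn_integral_distr) simp_all
  also have "\<dots> = (\<integral>\<^sup>+z. u z \<partial>(distr M S X \<Otimes>\<^sub>M distr M T Y))"
    by (subst distr_pair_of_indep_set[OF ind _ _ X Y]) simp_all
  also have "\<dots> = (\<integral>\<^sup>+x. \<integral>\<^sup>+y. u (x, y) \<partial>distr M T Y \<partial>distr M S X)"
    by (subst Y.nn_integral_fst[symmetric]) simp_all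
  also have "\<dots> = (\<integral>\<^sup>+\<omega>. \<integral>\<^sup>+y. u (X \<omega>, y) \<partial>distr M T Y \<partial>M)"
    by (subst nn_integral_distr) simp_all
  finally show ?thesis .
qed

text \<open>The identity of the sample space, read as a map into each of the two algebras, is a pair of
  independent random variables.\<close>

lemma (in prob_space) nn_integral_independent_copies:
  assumes ind: "indep_set (sets \<A>) (sets \<B>)" and sp: "space \<A> = space M" "space \<B> = space M"
    and id: "(\<lambda>\<omega>. \<omega>) \<in> measurable M \<A>" "(\<lambda>\<omega>. \<omega>) \<in> measurable M \<B>"
    and v: "v \<in> borel_measurable (\<A> \<Otimes>\<^sub>M \<B>)"
  shows "(\<integral>\<^sup>+\<omega>. v (\<omega>, \<omega>) \<partial>M) = (\<integral>\<^sup>+\<omega>. \<integral>\<^sup>+\<omega>'. v (\<omega>, \<omega>') \<partial>M \<partial>M)"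
proof -
  have inter: "(\<lambda>\<omega>. \<omega>) -` A \<inter> space M \<in> sets \<C>" if "A \<in> sets \<C>" "space \<C> = space M" for A \<C>
    using sets.Int_space_eq2[OF that(1)] that by simp
  have "(\<integral>\<^sup>+\<omega>. v (\<omega>, \<omega>) \<partial>M) = (\<integral>\<^sup>+\<omega>. \<integral>\<^sup>+\<omega>'. v (\<omega>, \<omega>') \<partial>distr M \<B> (\<lambda>\<omega>. \<omega>) \<partial>M)"
    by (rule nn_integral_pair_of_indep_set[OF ind id inter inter v]) (simp_all add: sp)
  also have "\<dots> = (\<integral>\<^sup>+\<omega>. \<integral>\<^sup>+\<omega>'. v (\<omega>, \<omega>') \<partial>M \<partial>M)"
    by (intro nn_integral_cong nn_integral_distr[OF id(2)])
      (auto intro!: measurable_compose[OF measurable_Pair1' v] simp: sp)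
  finally show ?thesis .
qed

text \<open>For indicators the real conditional expectation agrees with the nonnegative one, whose
  characterisation covers all nonnegative test functions at once.\<close>

lemma (in prob_space) nn_integral_markov_state:
  assumes sub: "subalgebra M G" and X: "X \<in> measurable G S"
    and R: "R \<in> measurable M (count_space UNIV)"
    and ce: "AE \<omega> in M. real_cond_exp M G (indicator {\<omega> \<in> space M. R \<omega> = j}) \<omega> = c \<omega>"
    and u: "u \<in> borel_measurable S"
  shows "(\<integral>\<^sup>+\<omega>. u (X \<omega>) * indicator {\<omega> \<in> space M. R \<omega> = j} \<omega> \<partial>M) = (\<integral>\<^sup>+\<omega>. u (X \<omega>) * ennreal (c \<omega>) \<partial>M)"
proof -
  interpret G: finite_measure_subalgebra M G
    by (unfold_locales) (use sub in auto)
  let ?J = "{\<omega> \<in> space M. R \<omega> = j}"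
  have J[measurable]: "?J \<in> sets M" using R by measurable
  have uX: "(\<lambda>\<omega>. u (X \<omega>)) \<in> borel_measurable G" by (rule measurable_compose[OF X u])
  have "AE \<omega> in M. nn_cond_exp M G (indicator ?J) \<omega> \<le> nn_cond_exp M G (\<lambda>_. 1) \<omega>"
    by (rule G.nn_cond_exp_mono) (auto simp: indicator_def)
  moreover have "AE \<omega> in M. 1 = nn_cond_exp M G (\<lambda>_. 1) \<omega>" "AE \<omega> in M. 0 = nn_cond_exp M G (\<lambda>_. 0) \<omega>"
    by (rule G.nn_cond_exp_F_meas; simp)+
  ultimately have "AE \<omega> in M. nn_cond_exp M G (indicator ?J) \<omega> = ennreal (c \<omega>)"
    using ce
  proof eventually_elim
    case (elim \<omega>)
    have "(\<lambda>\<omega>. ennreal (- indicator ?J \<omega>)) = (\<lambda>_. 0)" by (auto simp: indicator_def ennreal_neg)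
    then have "c \<omega> = enn2real (nn_cond_exp M G (indicator ?J) \<omega>)"
      using elim by (simp add: real_cond_exp_def ennreal_indicator)
    moreover have "nn_cond_exp M G (indicator ?J) \<omega> < top"
      using elim by (metis ennreal_one_less_top le_less_trans)
    ultimately show ?case by simp
  qed
  then have "(\<integral>\<^sup>+\<omega>. u (X \<omega>) * ennreal (c \<omega>) \<partial>M) = (\<integral>\<^sup>+\<omega>. u (X \<omega>) * nn_cond_exp M G (indicator ?J) \<omega> \<partial>M)"
    by (intro nn_integral_cong_AE) (auto elim!: eventually_mono)
  also have "\<dots> = (\<integral>\<^sup>+\<omega>. u (X \<omega>) * indicator ?J \<omega> \<partial>M)"
    by (rule G.nn_cond_exp_intg[OF uX]) simp
  finally show ?thesis ..
qed

lemma measurable_state_dependent: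
  fixes f :: "'a::topological_space \<Rightarrow> 'm::finite \<Rightarrow> 'b::topological_space"
  assumes "\<And>i. (\<lambda>x. f x i) \<in> borel_measurable borel"
    and X: "X \<in> borel_measurable N" and I: "I \<in> measurable N (count_space UNIV)"
  shows "(\<lambda>\<omega>. f (X \<omega>) (I \<omega>)) \<in> borel_measurable N"
  by (rule measurable_compose_countable[OF _ I, where f="\<lambda>i \<omega>. f (X \<omega>) i"])
    (rule measurable_compose[OF X assms(1)])

locale truncated_scheme =
  fixes f :: "real ^ 'n \<Rightarrow> 'm::finite \<Rightarrow> real ^ 'n" and g :: "real ^ 'n \<Rightarrow> 'm \<Rightarrow> real ^ 'd ^ 'n"
    and \<phi> :: "'m \<Rightarrow> real \<Rightarrow> real" and h :: "real \<Rightarrow> real" and \<Delta> :: real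
  assumes drift_continuous: "\<And>i. continuous_on UNIV (\<lambda>x. f x i)"
    and diffusion_continuous: "\<And>i. continuous_on UNIV (\<lambda>x. g x i)"
    and bound: "\<And>i. admissible_bound (\<lambda>x. f x i) (\<lambda>x. g x i) (\<phi> i)"
    and bound_le: "\<And>i. \<phi> i 1 \<le> h \<Delta>"
    and step_pos: "0 < \<Delta>"
begin

abbreviation "T i \<equiv> truncation (\<phi> i) (h \<Delta>) :: real ^ 'n \<Rightarrow> real ^ 'n"
abbreviation "\<nu> \<equiv> gaussian_noise (sqrt \<Delta>) :: (real ^ 'd) measure"
abbreviation "step \<equiv> truncated_step f g \<phi> (h \<Delta>) \<Delta>"
abbreviation "E \<equiv> (borel :: (real ^ 'n) measure) \<Otimes>\<^sub>M count_space (UNIV :: 'm set)"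

lemma sqrt_step_pos: "0 < sqrt \<Delta>" using step_pos by simp

lemma measurable_truncation [measurable (raw)]:
  assumes "X \<in> borel_measurable N" "I \<in> measurable N (count_space UNIV)"
  shows "(\<lambda>\<omega>. T (I \<omega>) (X \<omega>)) \<in> borel_measurable N"
  by (rule measurable_state_dependent[where f="\<lambda>x i. T i x", OF _ assms])
    (intro borel_measurable_continuous_onI truncation_continuous[OF bound bound_le])

lemma measurable_drift [measurable (raw)]:
  assumes "X \<in> borel_measurable N" "I \<in> measurable N (count_space UNIV)"
  shows "(\<lambda>\<omega>. f (X \<omega>) (I \<omega>)) \<in> borel_measurable N"
  by (rule measurable_state_dependent[OF _ assms])
    (intro borel_measurable_continuous_onI drift_continuous)

lemma measurable_diffusion [measurable (raw)]:
  assumes "X \<in> borel_measurable N" "I \<in> measurable N (count_space UNIV)"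
  shows "(\<lambda>\<omega>. g (X \<omega>) (I \<omega>)) \<in> borel_measurable N"
  by (rule measurable_state_dependent[OF _ assms])
    (intro borel_measurable_continuous_onI diffusion_continuous)

lemma measurable_matrix_vector [measurable (raw)]:
  fixes A :: "'w \<Rightarrow> real ^ 'd ^ 'n"
  assumes "A \<in> borel_measurable N" "X \<in> borel_measurable N"
  shows "(\<lambda>\<omega>. A \<omega> *v X \<omega>) \<in> borel_measurable N"
  by (rule borel_measurable_continuous_Pair[OF assms])
    (auto simp: matrix_vector_mult_def intro!: continuous_intros)

lemma measurable_truncated_step [measurable (raw)]:
  assumes [measurable]: "X \<in> borel_measurable N" "I \<in> measurable N (count_space UNIV)"
    "Y \<in> borel_measurable N" "J \<in> measurable N (count_space UNIV)"
  shows "(\<lambda>\<omega>. step (X \<omega>) (I \<omega>) (Y \<omega>) (J \<omega>)) \<in> borel_measurable N"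
  unfolding truncated_step_def by measurable

lemma measurable_Z_scheme:
  assumes B: "\<And>j. j \<le> k \<Longrightarrow> B (real j * \<Delta>) \<in> borel_measurable N"
    and r: "\<And>j. j \<le> k \<Longrightarrow> r (real j * \<Delta>) \<in> measurable N (count_space UNIV)"
  shows "Z_scheme f g \<phi> h B r \<Delta> x k \<in> borel_measurable N"
  using assms
proof (induction k)
  case 0
  from 0(2)[of 0] have [measurable]: "r 0 \<in> measurable N (count_space UNIV)" by simp
  show ?case unfolding Z_scheme_0[abs_def] by measurable
next
  case (Suc k)
  have [measurable]: "Z_scheme f g \<phi> h B r \<Delta> x k \<in> borel_measurable N"
    by (rule Suc.IH) (use Suc.prems in auto)
  note [measurable] = Suc.prems(1)[of "Suc k"] Suc.prems(1)[of k] Suc.prems(2)[of "Suc k"] Suc.prems(2)[of k]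
  show ?case unfolding Z_scheme_Suc[abs_def] by measurable
qed

text \<open>The scheme depends on the driving processes only through their values at the grid points up to the
  present, which may even live on different sample spaces.\<close>

lemma Z_scheme_cong:
  assumes "\<And>j. j \<le> k \<Longrightarrow> B (real j * \<Delta>) \<omega> = B' (real j * \<Delta>) \<omega>'"
    and "\<And>j. j \<le> k \<Longrightarrow> r (real j * \<Delta>) \<omega> = r' (real j * \<Delta>) \<omega>'"
  shows "Z_scheme f g \<phi> h B r \<Delta> x k \<omega> = Z_scheme f g \<phi> h B' r' \<Delta> x k \<omega>'"
  using assms
proof (induction k)
  case 0
  then show ?case by (simp add: Z_scheme_0)
next
  case (Suc k)
  have "Z_scheme f g \<phi> h B r \<Delta> x k \<omega> = Z_scheme f g \<phi> h B' r' \<Delta> x k \<omega>'"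
    by (rule Suc.IH) (use Suc.prems in auto)
  then show ?case using Suc.prems(1)[of k] Suc.prems(1)[of "Suc k"] Suc.prems(2)[of k] Suc.prems(2)[of "Suc k"]
    by (simp add: Z_scheme_Suc)
qed

end

locale switching_driver = truncated_scheme f g \<phi> h \<Delta> + prob_space M
  for f :: "real ^ 'n \<Rightarrow> 'm::finite \<Rightarrow> real ^ 'n" and g :: "real ^ 'n \<Rightarrow> 'm \<Rightarrow> real ^ 'd ^ 'n"
    and \<phi> h \<Delta> and M :: "'w measure" +
  fixes F :: "real \<Rightarrow> 'w measure" and B :: "real \<Rightarrow> 'w \<Rightarrow> real ^ 'd" and r :: "real \<Rightarrow> 'w \<Rightarrow> 'm"
    and P :: "real ^ 'm ^ 'm"
  assumes filtration: "usual_filtration M F"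
    and brownian: "brownian_motion M F B"
    and chain_adapted: "\<And>t. 0 \<le> t \<Longrightarrow> r t \<in> measurable (F t) (count_space UNIV)"
    and chain_step: "\<And>t j. 0 \<le> t \<Longrightarrow>
          AE \<omega> in M. real_cond_exp M (F t) (indicator {\<omega> \<in> space M. r (t + \<Delta>) \<omega> = j}) \<omega> = P $ r t \<omega> $ j"
    and P_nonneg: "\<And>i j. 0 \<le> P $ i $ j" and P_sum: "\<And>i. (\<Sum>j\<in>UNIV. P $ i $ j) = 1"
    and indep: "indep_processes M B r"
begin

lemma subalgebra_F: "0 \<le> t \<Longrightarrow> subalgebra M (F t)"
  using filtration by (simp add: usual_filtration_def)

lemma measurable_F_mono:
  assumes "X \<in> measurable (F s) S" "0 \<le> s" "s \<le> t"
  shows "X \<in> measurable (F t) S"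
proof -
  have "subalgebra (F t) (F s)"
    unfolding subalgebra_def
  proof
    have "0 \<le> t" using assms(2,3) by simp
    then show "space (F s) = space (F t)"
      using subalgebra_F[OF assms(2)] subalgebra_F[of t] unfolding subalgebra_def by metis
    show "sets (F s) \<subseteq> sets (F t)"
      using filtration assms(2,3) unfolding usual_filtration_def by blast
  qed
  from measurable_from_subalg[OF this assms(1)] show ?thesis .
qed

lemma B_adapted: "0 \<le> t \<Longrightarrow> B t \<in> borel_measurable (F t)"
  using brownian by (simp add: brownian_motion_def)

lemma B_measurable [measurable]: "0 \<le> t \<Longrightarrow> B t \<in> borel_measurable M"
  by (rule measurable_from_subalg[OF subalgebra_F B_adapted])

lemma r_measurable [measurable]: "0 \<le> t \<Longrightarrow> r t \<in> measurable M (count_space UNIV)"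
  by (rule measurable_from_subalg[OF subalgebra_F chain_adapted])

lemma distr_increment:
  assumes "0 \<le> s"
  shows "distr M borel (\<lambda>\<omega>. B (s + \<Delta>) \<omega> - B s \<omega>) = \<nu>"
proof -
  have "distributed M lborel (\<lambda>\<omega>. B (s + \<Delta>) \<omega> - B s \<omega>)
          (\<lambda>x. ennreal (\<Prod>j\<in>UNIV. normal_density 0 (sqrt (s + \<Delta> - s)) (x $ j)))"
    using brownian[unfolded brownian_motion_def, THEN conjunct2, THEN conjunct2, THEN conjunct2,
        rule_format, of s "s + \<Delta>"] assms step_pos by simp
  then have "distr M lborel (\<lambda>\<omega>. B (s + \<Delta>) \<omega> - B s \<omega>) = \<nu>"
    by (simp add: distributed_def gaussian_noise_def)
  moreover have "distr M borel (\<lambda>\<omega>. B (s + \<Delta>) \<omega> - B s \<omega>) = distr M lborel (\<lambda>\<omega>. B (s + \<Delta>) \<omega> - B s \<omega>)"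
    by (rule distr_cong) simp_all
  ultimately show ?thesis by simp
qed

lemma nn_integral_increment:
  assumes s: "0 \<le> s" and X: "X \<in> measurable (F s) S" and u[measurable]: "u \<in> borel_measurable (S \<Otimes>\<^sub>M borel)"
  shows "(\<integral>\<^sup>+\<omega>. u (X \<omega>, B (s + \<Delta>) \<omega> - B s \<omega>) \<partial>M) = (\<integral>\<^sup>+\<omega>. \<integral>\<^sup>+n. u (X \<omega>, n) \<partial>\<nu> \<partial>M)"
proof -
  have [measurable]: "(\<lambda>\<omega>. B (s + \<Delta>) \<omega> - B s \<omega>) \<in> borel_measurable M"
    using s step_pos by (intro borel_measurable_diff B_measurable) auto
  show ?thesis
    unfolding distr_increment[OF s, symmetric]
  proof (rule nn_integral_pair_of_indep_set)
    show "indep_set (sets (F s)) (sets (vimage_algebra (space M) (\<lambda>\<omega>. B (s + \<Delta>) \<omega> - B s \<omega>) borel))"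
      using brownian[unfolded brownian_motion_def, THEN conjunct2, THEN conjunct2, THEN conjunct2,
        rule_format, of s "s + \<Delta>"] s step_pos by simp
    show "X \<in> measurable M S" by (rule measurable_from_subalg[OF subalgebra_F[OF s] X])
    show "X -` A \<inter> space M \<in> sets (F s)" if "A \<in> sets S" for A
      using measurable_sets[OF X that] subalgebra_F[OF s] unfolding subalgebra_def by metis
    show "(\<lambda>\<omega>. B (s + \<Delta>) \<omega> - B s \<omega>) -` A \<inter> space M
        \<in> sets (vimage_algebra (space M) (\<lambda>\<omega>. B (s + \<Delta>) \<omega> - B s \<omega>) borel)" if "A \<in> sets borel" for A
      using that by (rule in_vimage_algebra)
  qed simp_all
qed

lemma nn_integral_switch:
  assumes s: "0 \<le> s" and X: "X \<in> measurable (F s) S" and u[measurable]: "u \<in> borel_measurable (S \<Otimes>\<^sub>M count_space UNIV)"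
  shows "(\<integral>\<^sup>+\<omega>. u (X \<omega>, r (s + \<Delta>) \<omega>) \<partial>M) = (\<integral>\<^sup>+\<omega>. (\<Sum>j\<in>UNIV. ennreal (P $ r s \<omega> $ j) * u (X \<omega>, j)) \<partial>M)"
proof -
  have [measurable]: "X \<in> measurable M S" by (rule measurable_from_subalg[OF subalgebra_F[OF s] X])
  have sD: "0 \<le> s + \<Delta>" using s step_pos by simp
  note [measurable] = r_measurable[OF s] r_measurable[OF sD]
  have one: "(\<integral>\<^sup>+\<omega>. u (X \<omega>, j) * indicator {\<omega> \<in> space M. r (s + \<Delta>) \<omega> = j} \<omega> \<partial>M)
      = (\<integral>\<^sup>+\<omega>. u (X \<omega>, j) * ennreal (P $ r s \<omega> $ j) \<partial>M)" for j
    by (rule nn_integral_markov_state[where X=X and S=S and G="F s" and u="\<lambda>x. u (x, j)"])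
      (use s X chain_step r_measurable[OF sD] subalgebra_F in simp_all)
  have "(\<integral>\<^sup>+\<omega>. u (X \<omega>, r (s + \<Delta>) \<omega>) \<partial>M) = (\<integral>\<^sup>+\<omega>. (\<Sum>j\<in>UNIV. u (X \<omega>, j) * indicator {\<omega> \<in> space M. r (s + \<Delta>) \<omega> = j} \<omega>) \<partial>M)"
    by (intro nn_integral_cong) (simp add: indicator_def sum.delta' if_distrib cong: if_cong)
  also have "\<dots> = (\<Sum>j\<in>UNIV. \<integral>\<^sup>+\<omega>. u (X \<omega>, j) * indicator {\<omega> \<in> space M. r (s + \<Delta>) \<omega> = j} \<omega> \<partial>M)"
    by (rule nn_integral_sum) measurable
  also have "\<dots> = (\<Sum>j\<in>UNIV. \<integral>\<^sup>+\<omega>. ennreal (P $ r s \<omega> $ j) * u (X \<omega>, j) \<partial>M)"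
    by (simp add: one mult.commute)
  also have "\<dots> = (\<integral>\<^sup>+\<omega>. (\<Sum>j\<in>UNIV. ennreal (P $ r s \<omega> $ j) * u (X \<omega>, j)) \<partial>M)"
    by (rule nn_integral_sum[symmetric]) measurable
  finally show ?thesis .
qed

lemma Z_measurable: "Z_scheme f g \<phi> h B r \<Delta> x k \<in> borel_measurable M"
  by (rule measurable_Z_scheme) (use step_pos in \<open>auto intro!: B_measurable r_measurable\<close>)

definition noise_algebra :: "'w measure" where
  "noise_algebra = vimage_algebra (space M) (\<lambda>\<omega>. \<lambda>t\<in>{0..}. B t \<omega>) (\<Pi>\<^sub>M t\<in>{0..}. borel)"

definition chain_algebra :: "'w measure" where
  "chain_algebra = vimage_algebra (space M) (\<lambda>\<omega>. \<lambda>t\<in>{0..}. r t \<omega>) (\<Pi>\<^sub>M t\<in>{0..}. count_space UNIV)"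

lemma measurable_noise_algebra: "0 \<le> t \<Longrightarrow> B t \<in> borel_measurable noise_algebra"
  unfolding noise_algebra_def
  using measurable_compose[OF measurable_vimage_algebra1 measurable_component_singleton[of t "{0..}"],
      of "\<lambda>\<omega>. \<lambda>t\<in>{0..}. B t \<omega>" "space M" "\<lambda>_. borel"]
  by (auto simp: space_PiM)

lemma measurable_chain_algebra: "0 \<le> t \<Longrightarrow> r t \<in> measurable chain_algebra (count_space UNIV)"
  unfolding chain_algebra_def
  using measurable_compose[OF measurable_vimage_algebra1 measurable_component_singleton[of t "{0..}"],
      of "\<lambda>\<omega>. \<lambda>t\<in>{0..}. r t \<omega>" "space M" "\<lambda>_. count_space UNIV"]
  by (auto simp: space_PiM)

text \<open>Brownian motion may be evaluated at one sample point and the chain at another, independent one.\<close>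

lemma decouple:
  assumes v: "v \<in> borel_measurable (noise_algebra \<Otimes>\<^sub>M chain_algebra)"
  shows "(\<integral>\<^sup>+\<omega>. v (\<omega>, \<omega>) \<partial>M) = (\<integral>\<^sup>+\<omega>. \<integral>\<^sup>+\<omega>'. v (\<omega>, \<omega>') \<partial>M \<partial>M)"
    and "(\<integral>\<^sup>+\<omega>. v (\<omega>, \<omega>) \<partial>M) = (\<integral>\<^sup>+\<omega>'. \<integral>\<^sup>+\<omega>. v (\<omega>, \<omega>') \<partial>M \<partial>M)"
proof -
  have "(\<lambda>\<omega>. \<omega>) \<in> measurable M noise_algebra"
    unfolding noise_algebra_def
    by (rule measurable_vimage_algebra2) (auto intro!: measurable_restrict B_measurable)
  moreover have "(\<lambda>\<omega>. \<omega>) \<in> measurable M chain_algebra"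
    unfolding chain_algebra_def
    by (rule measurable_vimage_algebra2) (auto intro!: measurable_restrict r_measurable)
  moreover have "indep_set (sets noise_algebra) (sets chain_algebra)"
    using indep by (simp add: indep_processes_def noise_algebra_def chain_algebra_def)
  moreover from this have "indep_set (sets chain_algebra) (sets noise_algebra)"
    unfolding indep_sets2_eq by (metis Int_commute mult.commute)
  moreover have "space noise_algebra = space M" "space chain_algebra = space M"
    by (simp_all add: noise_algebra_def chain_algebra_def)
  moreover have "(\<lambda>z. v (snd z, fst z)) \<in> borel_measurable (chain_algebra \<Otimes>\<^sub>M noise_algebra)"
    by (rule measurable_compose[OF measurable_Pair[OF measurable_snd measurable_fst] v])
  ultimately show "(\<integral>\<^sup>+\<omega>. v (\<omega>, \<omega>) \<partial>M) = (\<integral>\<^sup>+\<omega>. \<integral>\<^sup>+\<omega>'. v (\<omega>, \<omega>') \<partial>M \<partial>M)"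
    and "(\<integral>\<^sup>+\<omega>. v (\<omega>, \<omega>) \<partial>M) = (\<integral>\<^sup>+\<omega>'. \<integral>\<^sup>+\<omega>. v (\<omega>, \<omega>') \<partial>M \<partial>M)"
    using nn_integral_independent_copies[of noise_algebra chain_algebra v] v
      nn_integral_independent_copies[of chain_algebra noise_algebra "\<lambda>z. v (snd z, fst z)"] by auto
qed

text \<open>Conditionally on the filtration, the next increment of \<open>B\<close> and the next state of \<open>r\<close> need not be
  independent, since the filtration may carry information that correlates them. The argument
  therefore decouples the two processes. With the sample point of the chain frozen, the increment is
  integrated out by independence of increments; with the sample point of the Brownian motion frozen,
  the next state is integrated out by the Markov property.\<close>

lemma scheme_markov_property:
  fixes G :: "(real ^ 'n) \<times> 'm \<times> (real ^ 'd) \<times> 'm \<Rightarrow> ennreal" and x :: "real ^ 'n" and k :: nat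
  defines "Z \<equiv> Z_scheme f g \<phi> h B r \<Delta> x k" and "t \<equiv> real k * \<Delta>"
  assumes G[measurable]: "G \<in> borel_measurable (borel \<Otimes>\<^sub>M count_space UNIV \<Otimes>\<^sub>M borel \<Otimes>\<^sub>M count_space UNIV)"
  shows "(\<integral>\<^sup>+\<omega>. G (Z \<omega>, r t \<omega>, B (t + \<Delta>) \<omega> - B t \<omega>, r (t + \<Delta>) \<omega>) \<partial>M)
    = (\<integral>\<^sup>+\<omega>. (\<Sum>j\<in>UNIV. ennreal (P $ r t \<omega> $ j) * (\<integral>\<^sup>+n. G (Z \<omega>, r t \<omega>, n, j) \<partial>\<nu>)) \<partial>M)"
proof -
  interpret \<nu>: prob_space \<nu> by (rule prob_space_gaussian_noise[OF sqrt_step_pos])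
  let ?Br = "noise_algebra \<Otimes>\<^sub>M chain_algebra"
  \<comment> \<open>The scheme with Brownian motion and chain taken at separate sample points.\<close>
  define Y where "Y z = Z_scheme f g \<phi> h (\<lambda>t z. B t (fst z)) (\<lambda>t z. r t (snd z)) \<Delta> x k z" for z
  have t0: "0 \<le> t" "0 \<le> t + \<Delta>" using step_pos by (auto simp: t_def)
  have tj: "0 \<le> real j * \<Delta>" for j using step_pos by simp
  have tk: "real j * \<Delta> \<le> t" if "j \<le> k" for j using that step_pos by (simp add: t_def)
  have Bm: "(\<lambda>z. B s (fst z)) \<in> borel_measurable ?Br" if "0 \<le> s" for s
    by (rule measurable_compose[OF measurable_fst measurable_noise_algebra[OF that]])
  have rm: "(\<lambda>z. r s (snd z)) \<in> measurable ?Br (count_space UNIV)" if "0 \<le> s" for s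
    by (rule measurable_compose[OF measurable_snd measurable_chain_algebra[OF that]])
  note [measurable] = Bm[OF t0(1)] Bm[OF t0(2)] rm[OF t0(1)] rm[OF t0(2)]
  have [measurable]: "Y \<in> borel_measurable ?Br"
    unfolding Y_def[abs_def] by (rule measurable_Z_scheme) (intro Bm rm tj)+
  have Z_eq: "Z \<omega> = Y (\<omega>, \<omega>)" for \<omega>
    unfolding Z_def Y_def by (rule Z_scheme_cong) auto
  \<comment> \<open>With one of the sample points frozen, the scheme is adapted to the filtration.\<close>
  have Y_chain: "(\<lambda>\<omega>. Y (\<omega>, \<omega>')) \<in> borel_measurable (F t)" for \<omega>'
  proof -
    have "(\<lambda>\<omega>. Y (\<omega>, \<omega>')) = Z_scheme f g \<phi> h B (\<lambda>t _. r t \<omega>') \<Delta> x k"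
      unfolding Y_def by (rule ext, rule Z_scheme_cong) auto
    moreover have "\<dots> \<in> borel_measurable (F t)"
      by (rule measurable_Z_scheme) (auto intro!: measurable_F_mono[OF B_adapted] tj tk)
    ultimately show ?thesis by simp
  qed
  have Y_noise: "(\<lambda>\<omega>'. Y (\<omega>, \<omega>')) \<in> borel_measurable (F t)" for \<omega>
  proof -
    have "(\<lambda>\<omega>'. Y (\<omega>, \<omega>')) = Z_scheme f g \<phi> h (\<lambda>t _. B t \<omega>) r \<Delta> x k"
      unfolding Y_def by (rule ext, rule Z_scheme_cong) auto
    moreover have "\<dots> \<in> borel_measurable (F t)"
      by (rule measurable_Z_scheme) (auto intro!: measurable_F_mono[OF chain_adapted] tj tk)
    ultimately show ?thesis by simp
  qed
  define H where "H z i j = (\<integral>\<^sup>+n. G (z, i, n, j) \<partial>\<nu>)" for z i j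
  have H: "(\<lambda>w. H (fst w) (fst (snd w)) (snd (snd w))) \<in> borel_measurable (borel \<Otimes>\<^sub>M count_space UNIV \<Otimes>\<^sub>M count_space UNIV)"
    unfolding H_def by measurable
  have [measurable (raw)]: "(\<lambda>\<omega>. H (X \<omega>) (I \<omega>) (J \<omega>)) \<in> borel_measurable N"
    if "X \<in> borel_measurable N" "I \<in> measurable N (count_space UNIV)" "J \<in> measurable N (count_space UNIV)"
    for X I J and N :: "'q measure"
    using measurable_compose[OF measurable_Pair[OF that(1) measurable_Pair[OF that(2,3)]] H] by simp
  have increment: "(\<integral>\<^sup>+\<omega>. G (Y (\<omega>, \<omega>'), i, B (t + \<Delta>) \<omega> - B t \<omega>, j) \<partial>M) = (\<integral>\<^sup>+\<omega>. H (Y (\<omega>, \<omega>')) i j \<partial>M)" for \<omega>' i j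
    using nn_integral_increment[OF t0(1) Y_chain, of "\<lambda>(z, n). G (z, i, n, j)" \<omega>'] by (simp add: H_def)
  have switch: "(\<integral>\<^sup>+\<omega>'. H (Y (\<omega>, \<omega>')) (r t \<omega>') (r (t + \<Delta>) \<omega>') \<partial>M)
      = (\<integral>\<^sup>+\<omega>'. (\<Sum>j\<in>UNIV. ennreal (P $ r t \<omega>' $ j) * H (Y (\<omega>, \<omega>')) (r t \<omega>') j) \<partial>M)" for \<omega>
    using nn_integral_switch[OF t0(1) measurable_Pair[OF Y_noise[of \<omega>] chain_adapted[OF t0(1)]],
        of "\<lambda>w. H (fst (fst w)) (snd (fst w)) (snd w)"] by simp
  have "(\<integral>\<^sup>+\<omega>. G (Z \<omega>, r t \<omega>, B (t + \<Delta>) \<omega> - B t \<omega>, r (t + \<Delta>) \<omega>) \<partial>M)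
      = (\<integral>\<^sup>+\<omega>'. \<integral>\<^sup>+\<omega>. G (Y (\<omega>, \<omega>'), r t \<omega>', B (t + \<Delta>) \<omega> - B t \<omega>, r (t + \<Delta>) \<omega>') \<partial>M \<partial>M)"
    using decouple(2)[of "\<lambda>z. G (Y z, r t (snd z), B (t + \<Delta>) (fst z) - B t (fst z), r (t + \<Delta>) (snd z))"]
    by (simp add: Z_eq)
  also have "\<dots> = (\<integral>\<^sup>+\<omega>'. \<integral>\<^sup>+\<omega>. H (Y (\<omega>, \<omega>')) (r t \<omega>') (r (t + \<Delta>) \<omega>') \<partial>M \<partial>M)"
    unfolding increment ..
  also have "\<dots> = (\<integral>\<^sup>+\<omega>. \<integral>\<^sup>+\<omega>'. H (Y (\<omega>, \<omega>')) (r t \<omega>') (r (t + \<Delta>) \<omega>') \<partial>M \<partial>M)"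
    using decouple[of "\<lambda>z. H (Y z) (r t (snd z)) (r (t + \<Delta>) (snd z))"] by simp
  also have "\<dots> = (\<integral>\<^sup>+\<omega>. (\<Sum>j\<in>UNIV. ennreal (P $ r t \<omega> $ j) * H (Z \<omega>) (r t \<omega>) j) \<partial>M)"
    unfolding switch Z_eq
    using decouple(1)[of "\<lambda>z. \<Sum>j\<in>UNIV. ennreal (P $ r t (snd z) $ j) * H (Y z) (r t (snd z)) j"] by simp
  finally show ?thesis by (simp add: H_def)
qed

end

section \<open>The scheme as a contracting random map\<close>

definition row_pmf :: "real ^ 'm ^ 'm \<Rightarrow> 'm::finite \<Rightarrow> 'm pmf" where
  "row_pmf P i = embed_pmf (\<lambda>j. P $ i $ j)"

lemma pmf_row_pmf:
  assumes "\<And>j. 0 \<le> P $ i $ j" "(\<Sum>j\<in>UNIV. P $ i $ j) = 1"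
  shows "pmf (row_pmf P i) j = P $ i $ j"
  unfolding row_pmf_def
  by (rule pmf_embed_pmf) (use assms in \<open>auto simp: nn_integral_count_space_finite simp flip: ennreal_1\<close>)

text \<open>A random self-map of the state space whose values are independent and distributed according to the
  rows of \<open>P\<close>. It moves all states simultaneously, with the correct law for each one, and it
  merges them whenever it is constant.\<close>

definition transition_map_pmf :: "real ^ 'm ^ 'm \<Rightarrow> ('m::finite \<Rightarrow> 'm) pmf" where
  "transition_map_pmf P = Pi_pmf UNIV undefined (row_pmf P)"

context truncated_scheme
begin

definition scheme_noise :: "real ^ 'm ^ 'm \<Rightarrow> (('m \<Rightarrow> 'm) \<times> (real ^ 'd)) measure" where
  "scheme_noise P = measure_pmf (transition_map_pmf P) \<Otimes>\<^sub>M gaussian_noise (sqrt \<Delta>)"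

text \<open>The argument is truncated first, although the scheme produces only truncated points, so that the
  Lipschitz bounds of the truncated region hold for arbitrary arguments.\<close>

definition scheme_map :: "(real ^ 'n) \<times> 'm \<Rightarrow> ('m \<Rightarrow> 'm) \<times> (real ^ 'd) \<Rightarrow> (real ^ 'n) \<times> 'm" where
  "scheme_map a w = (step (T (snd a) (fst a)) (snd a) (snd w) (fst w (snd a)), fst w (snd a))"

lemma measurable_random_switch:
  assumes "X \<in> measurable N (measure_pmf p)" "I \<in> measurable N (count_space UNIV)"
  shows "(\<lambda>\<omega>. X \<omega> (I \<omega> :: 'm) :: 'm) \<in> measurable N (count_space UNIV)"
  by (rule measurable_compose_countable[OF _ assms(2), where f="\<lambda>i \<omega>. X \<omega> i"])
    (rule measurable_compose[OF assms(1)], simp)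

lemma measurable_component_switch: "(\<lambda>w. fst w i) \<in> measurable (scheme_noise P) (count_space UNIV)"
  unfolding scheme_noise_def by (rule measurable_random_switch[OF measurable_fst]) simp

lemma measurable_noise_snd: "snd \<in> borel_measurable (scheme_noise P)"
  using measurable_snd[of "measure_pmf (transition_map_pmf P)" "gaussian_noise (sqrt \<Delta>) :: (real ^ 'd) measure"]
  by (simp add: scheme_noise_def measurable_cong_sets[OF refl sets_gaussian_noise])

lemma measurable_scheme_map [measurable (raw)]:
  assumes "X \<in> measurable N E" and Y: "Y \<in> measurable N (scheme_noise P)"
  shows "(\<lambda>\<omega>. scheme_map (X \<omega>) (Y \<omega>)) \<in> measurable N E"
proof -
  have [measurable]: "(\<lambda>\<omega>. fst (X \<omega>)) \<in> borel_measurable N" "(\<lambda>\<omega>. snd (X \<omega>)) \<in> measurable N (count_space UNIV)"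
    using measurable_compose[OF assms(1) measurable_fst] measurable_compose[OF assms(1) measurable_snd] by auto
  have [measurable]: "(\<lambda>\<omega>. snd (Y \<omega>)) \<in> borel_measurable N"
    using measurable_compose[OF Y[unfolded scheme_noise_def] measurable_snd]
    by (simp add: measurable_cong_sets[OF refl sets_gaussian_noise])
  have [measurable]: "(\<lambda>\<omega>. fst (Y \<omega>) (snd (X \<omega>))) \<in> measurable N (count_space UNIV)"
    by (rule measurable_random_switch[OF measurable_compose[OF Y[unfolded scheme_noise_def] measurable_fst]]) measurable
  show ?thesis unfolding scheme_map_def by measurable
qed

lemma measurable_scheme_map_start: "scheme_map z \<in> measurable (scheme_noise P) E"
  by (rule measurable_scheme_map[where X="\<lambda>_. z" and Y="\<lambda>w. w" and P=P])
    (auto intro!: measurable_const simp: space_pair_measure)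

lemma prob_space_scheme_noise: "prob_space (scheme_noise P)"
proof -
  interpret G: prob_space "gaussian_noise (sqrt \<Delta>) :: (real ^ 'd) measure"
    by (rule prob_space_gaussian_noise[OF sqrt_step_pos])
  interpret pair_prob_space "measure_pmf (transition_map_pmf P)" "gaussian_noise (sqrt \<Delta>) :: (real ^ 'd) measure" ..
  show ?thesis unfolding scheme_noise_def by (rule prob_space_axioms)
qed

lemma nn_integral_scheme_noise:
  assumes P: "\<And>j. 0 \<le> P $ i $ j" "(\<Sum>j\<in>UNIV. P $ i $ j) = 1"
    and [measurable]: "\<And>j. H j \<in> borel_measurable borel"
  shows "(\<integral>\<^sup>+w. H (fst w i) (snd w) \<partial>scheme_noise P)
    = (\<Sum>j\<in>UNIV. ennreal (P $ i $ j) * (\<integral>\<^sup>+n. H j n \<partial>gaussian_noise (sqrt \<Delta>)))"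
proof -
  let ?\<nu> = "gaussian_noise (sqrt \<Delta>) :: (real ^ 'd) measure"
  interpret G: prob_space ?\<nu>
    by (rule prob_space_gaussian_noise[OF sqrt_step_pos])
  have meas: "(\<lambda>w. H (fst w i) (snd w)) \<in> borel_measurable (measure_pmf (transition_map_pmf P) \<Otimes>\<^sub>M ?\<nu>)"
  proof (rule measurable_compose_countable[where f="\<lambda>j w. H j (snd w)" and g="\<lambda>w. fst w i"])
    show "(\<lambda>w. fst w i) \<in> measurable (measure_pmf (transition_map_pmf P) \<Otimes>\<^sub>M ?\<nu>) (count_space UNIV)"
      by (rule measurable_random_switch[OF measurable_fst]) simp
  qed measurable
  have "(\<integral>\<^sup>+w. H (fst w i) (snd w) \<partial>scheme_noise P)
      = (\<integral>\<^sup>+u. \<integral>\<^sup>+n. H (u i) n \<partial>?\<nu> \<partial>measure_pmf (transition_map_pmf P))"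
    unfolding scheme_noise_def using G.nn_integral_fst[OF meas] by simp
  also have "\<dots> = (\<integral>\<^sup>+j. \<integral>\<^sup>+n. H j n \<partial>?\<nu> \<partial>measure_pmf (map_pmf (\<lambda>u. u i) (transition_map_pmf P)))"
    by simp
  also have "map_pmf (\<lambda>u. u i) (transition_map_pmf P) = row_pmf P i"
    by (simp add: transition_map_pmf_def Pi_pmf_component)
  also have "(\<integral>\<^sup>+j. \<integral>\<^sup>+n. H j n \<partial>?\<nu> \<partial>measure_pmf (row_pmf P i)) = (\<Sum>j\<in>UNIV. ennreal (P $ i $ j) * (\<integral>\<^sup>+n. H j n \<partial>?\<nu>))"
    by (subst nn_integral_measure_pmf) (simp add: nn_integral_count_space_finite pmf_row_pmf[OF P])
  finally show ?thesis .
qed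

lemma scheme_map_continuous:
  assumes "hybrid_tendsto Y y"
  shows "hybrid_tendsto (\<lambda>n. scheme_map (Y n) w) (scheme_map y w)"
proof -
  let ?i = "snd y"
  have Tc: "continuous_on S (T i)" for S i by (rule truncation_continuous[OF bound bound_le])
  have "continuous_on UNIV (\<lambda>x. step (T ?i x) ?i (snd w) (fst w ?i))"
    unfolding truncated_step_def
    by (intro continuous_on_compose2[OF Tc[of UNIV]] continuous_intros
        continuous_on_compose2[OF drift_continuous] continuous_on_compose2[OF diffusion_continuous] Tc)
      (auto intro!: continuous_intros continuous_on_compose2[OF diffusion_continuous] Tc simp: matrix_vector_mult_def)
  then have "(\<lambda>n. step (T ?i (fst (Y n))) ?i (snd w) (fst w ?i)) \<longlonglongrightarrow> fst (scheme_map y w)"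
    using assms unfolding hybrid_tendsto_def scheme_map_def
    by (auto intro: continuous_on_tendsto_compose)
  moreover have ev: "\<forall>\<^sub>F n in sequentially. snd (Y n) = ?i"
    using assms by (simp add: hybrid_tendsto_def)
  then have "\<forall>\<^sub>F n in sequentially. step (T ?i (fst (Y n))) ?i (snd w) (fst w ?i) = fst (scheme_map (Y n) w)"
    by eventually_elim (simp add: scheme_map_def)
  ultimately have "(\<lambda>n. fst (scheme_map (Y n) w)) \<longlonglongrightarrow> fst (scheme_map y w)"
    by (rule Lim_transform_eventually)
  moreover from ev have "\<forall>\<^sub>F n in sequentially. snd (scheme_map (Y n) w) = snd (scheme_map y w)"
    by eventually_elim (simp add: scheme_map_def)
  ultimately show ?thesis by (simp add: hybrid_tendsto_def)
qed

abbreviation em :: "real ^ 'n \<Rightarrow> 'm \<Rightarrow> real ^ 'd \<Rightarrow> real ^ 'n" where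
  "em x i n \<equiv> T i x + \<Delta> *\<^sub>R f (T i x) i + g (T i x) i *v n"

lemma norm_scheme_map_le: "norm (fst (scheme_map (x, i) w)) \<le> norm (em x i (snd w))"
  using truncation_nonexpansive[OF bound bound_le, of "fst w i" "em x i (snd w)" 0]
  by (simp add: scheme_map_def truncated_step_def)

lemma dist_scheme_map_le:
  "norm (fst (scheme_map (x, i) w) - fst (scheme_map (y, i) w)) \<le> norm (em x i (snd w) - em y i (snd w))"
  using truncation_nonexpansive[OF bound bound_le, of "fst w i" "em x i (snd w)" "em y i (snd w)"]
  by (simp add: scheme_map_def truncated_step_def dist_norm)

lemma measurable_em [measurable]: "(\<lambda>n. em x i n) \<in> borel_measurable borel"
  by (intro borel_measurable_continuous_onI continuous_intros)

end

text \<open>The factor \<open>c i\<close> bounds the effect of one step on two copies in state \<open>i\<close>; it may exceed 1,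
  and only the weighted average over the next state is required to contract.\<close>

locale contractive_scheme = truncated_scheme f g \<phi> h \<Delta>
  for f :: "real ^ 'n \<Rightarrow> 'm::finite \<Rightarrow> real ^ 'n" and g :: "real ^ 'n \<Rightarrow> 'm \<Rightarrow> real ^ 'd ^ 'n"
    and \<phi> h \<Delta> +
  fixes P :: "real ^ 'm ^ 'm" and k0 :: 'm and s \<gamma> :: real and \<xi> c :: "'m \<Rightarrow> real"
  assumes P_nonneg: "\<And>i j. 0 \<le> P $ i $ j" and P_sum: "\<And>i. (\<Sum>j\<in>UNIV. P $ i $ j) = 1"
    and P_column: "\<And>i. 0 < P $ i $ k0"
    and s: "0 < s" "2 * s \<le> 1"
    and \<xi>: "\<And>i. 1 \<le> \<xi> i"
    and \<gamma>: "0 \<le> \<gamma>" "\<gamma> < 1"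
    and one_step: "\<And>i x y. (\<integral>\<^sup>+n. ennreal (norm (em x i n - em y i n) powr (2 * s)) \<partial>gaussian_noise (sqrt \<Delta>))
        \<le> ennreal (c i * norm (x - y) powr (2 * s))"
    and weights: "\<And>i. 0 \<le> c i" "\<And>i. (\<Sum>j\<in>UNIV. P $ i $ j * \<xi> j) * c i \<le> \<gamma> * \<xi> i"
begin

abbreviation "W \<equiv> scheme_noise P"

sublocale W: prob_space W by (rule prob_space_scheme_noise)
sublocale \<nu>: prob_space \<nu> by (rule prob_space_gaussian_noise[OF sqrt_step_pos])

lemma \<xi>_nonneg: "0 \<le> \<xi> i" using \<xi>[of i] by linarith

lemma nn_integral_weighted:
  assumes [measurable]: "H \<in> borel_measurable borel"
  shows "(\<integral>\<^sup>+w. ennreal (\<xi> (fst w i)) * H (snd w) \<partial>W) = ennreal (\<Sum>j\<in>UNIV. P $ i $ j * \<xi> j) * (\<integral>\<^sup>+n. H n \<partial>\<nu>)"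
proof -
  have "(\<integral>\<^sup>+w. ennreal (\<xi> (fst w i)) * H (snd w) \<partial>W) = (\<Sum>j\<in>UNIV. ennreal (P $ i $ j) * (\<integral>\<^sup>+n. ennreal (\<xi> j) * H n \<partial>\<nu>))"
    by (rule nn_integral_scheme_noise[OF P_nonneg P_sum]) measurable
  also have "\<dots> = (\<Sum>j\<in>UNIV. ennreal (P $ i $ j * \<xi> j)) * (\<integral>\<^sup>+n. H n \<partial>\<nu>)"
    by (simp add: nn_integral_cmult sum_distrib_right ennreal_mult P_nonneg \<xi>_nonneg mult.assoc)
  finally show ?thesis by (simp add: P_nonneg \<xi>_nonneg)
qed

lemma same_state_contraction:
  "(\<integral>\<^sup>+w. ennreal (\<xi> (fst w i) * norm (em x i (snd w) - em y i (snd w)) powr (2 * s)) \<partial>W)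
     \<le> ennreal (\<gamma> * (\<xi> i * norm (x - y) powr (2 * s)))"
proof -
  let ?H = "\<lambda>n. ennreal (norm (em x i n - em y i n) powr (2 * s))"
  have "(\<integral>\<^sup>+w. ennreal (\<xi> (fst w i) * norm (em x i (snd w) - em y i (snd w)) powr (2 * s)) \<partial>W)
      = (\<integral>\<^sup>+w. ennreal (\<xi> (fst w i)) * ?H (snd w) \<partial>W)"
    by (simp add: ennreal_mult \<xi>_nonneg)
  also have "\<dots> = ennreal (\<Sum>j\<in>UNIV. P $ i $ j * \<xi> j) * (\<integral>\<^sup>+n. ?H n \<partial>\<nu>)"
    by (rule nn_integral_weighted) measurable
  also have "\<dots> \<le> ennreal (\<Sum>j\<in>UNIV. P $ i $ j * \<xi> j) * ennreal (c i * norm (x - y) powr (2 * s))"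
    by (intro mult_left_mono one_step) simp
  also have "\<dots> = ennreal (((\<Sum>j\<in>UNIV. P $ i $ j * \<xi> j) * c i) * norm (x - y) powr (2 * s))"
    using weights(1)[of i] by (simp add: ennreal_mult[symmetric] sum_nonneg P_nonneg \<xi>_nonneg mult.assoc)
  also have "\<dots> \<le> ennreal ((\<gamma> * \<xi> i) * norm (x - y) powr (2 * s))"
    by (intro ennreal_leI mult_right_mono weights) simp
  finally show ?thesis by (simp add: mult.assoc)
qed

definition origin_moment :: "'m \<Rightarrow> ennreal" where
  "origin_moment i = (\<integral>\<^sup>+w. ennreal (\<xi> (fst w i) * norm (em 0 i (snd w)) powr (2 * s)) \<partial>W)"

lemma origin_moment_finite: "origin_moment i < top"
proof -
  let ?K = "1 + norm (\<Delta> *\<^sub>R f 0 i) + norm (g 0 i)"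
  have bnd: "norm (em 0 i n) powr (2 * s) \<le> ?K + norm (g 0 i) * (norm n)\<^sup>2" for n
  proof -
    have "norm (em 0 i n) \<le> norm (\<Delta> *\<^sub>R f 0 i) + norm (g 0 i) * norm n"
      using norm_triangle_ineq[of "\<Delta> *\<^sub>R f 0 i" "g 0 i *v n"] norm_matrix_vector_le[of "g 0 i" n] by simp
    moreover have "norm n \<le> 1 + (norm n)\<^sup>2"
      using sum_power2_ge_zero[of "norm n - 1 / 2" 0] by (simp add: power2_eq_square algebra_simps)
    then have "norm (g 0 i) * norm n \<le> norm (g 0 i) * (1 + (norm n)\<^sup>2)" by (intro mult_left_mono) auto
    moreover have "norm (em 0 i n) powr (2 * s) \<le> 1 + norm (em 0 i n)"
    proof (cases "norm (em 0 i n) \<le> 1")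
      case True
      then have "norm (em 0 i n) powr (2 * s) \<le> 1 powr (2 * s)" using s by (intro powr_mono2) auto
      then show ?thesis unfolding powr_one_eq_one using norm_ge_zero[of "em 0 i n"] by linarith
    next
      case False
      then have "norm (em 0 i n) powr (2 * s) \<le> norm (em 0 i n) powr 1" using s by (intro powr_mono) auto
      then show ?thesis using False by simp
    qed
    ultimately show ?thesis by (simp add: algebra_simps)
  qed
  have int: "integrable \<nu> (\<lambda>n. ?K + norm (g 0 i) * (norm n)\<^sup>2)"
    using gaussian_norm_moment(1)[OF sqrt_step_pos, of 1, where 'd='d]
    by (intro Bochner_Integration.integrable_add integrable_mult_right \<nu>.integrable_const) simp
  have "origin_moment i = (\<integral>\<^sup>+w. ennreal (\<xi> (fst w i)) * ennreal (norm (em 0 i (snd w)) powr (2 * s)) \<partial>W)"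
    unfolding origin_moment_def by (simp add: ennreal_mult \<xi>_nonneg)
  also have "\<dots> = ennreal (\<Sum>j\<in>UNIV. P $ i $ j * \<xi> j) * (\<integral>\<^sup>+n. ennreal (norm (em 0 i n) powr (2 * s)) \<partial>\<nu>)"
    by (rule nn_integral_weighted) measurable
  also have "\<dots> \<le> ennreal (\<Sum>j\<in>UNIV. P $ i $ j * \<xi> j) * (\<integral>\<^sup>+n. ennreal (?K + norm (g 0 i) * (norm n)\<^sup>2) \<partial>\<nu>)"
    by (intro mult_left_mono nn_integral_mono ennreal_leI bnd) simp
  also have "\<dots> < top"
    using int by (subst nn_integral_eq_integral) (auto simp: ennreal_mult_less_top)
  finally show ?thesis .
qed

definition moment_bound :: real where
  "moment_bound = (\<Sum>i\<in>UNIV. enn2real (origin_moment i))"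

lemma moment_bound_nonneg: "0 \<le> moment_bound"
  by (simp add: moment_bound_def sum_nonneg)

lemma origin_moment_le: "origin_moment i \<le> ennreal moment_bound"
proof -
  have "origin_moment i = ennreal (enn2real (origin_moment i))" using origin_moment_finite[of i] by simp
  also have "\<dots> \<le> ennreal moment_bound"
    unfolding moment_bound_def by (intro ennreal_leI member_le_sum) auto
  finally show ?thesis .
qed

definition V :: "(real ^ 'n) \<times> 'm \<Rightarrow> real" where
  "V a = \<xi> (snd a) * norm (fst a) powr (2 * s)"

lemma V_nonneg: "0 \<le> V a"
  by (simp add: V_def \<xi>_nonneg)

lemma measurable_V [measurable]: "V \<in> borel_measurable E"
  unfolding V_def[abs_def] by measurable

text \<open>A trajectory is compared with the one that starts at the origin in the same state, so the moment
  bound follows from the contraction.\<close>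

lemma moment_drift: "(\<integral>\<^sup>+w. ennreal (V (scheme_map a w)) \<partial>W) \<le> ennreal (\<gamma> * V a + moment_bound)"
proof -
  obtain x i where a: "a = (x, i)" by (cases a)
  let ?q = "2 * s" and ?j = "\<lambda>w. fst w i" and ?y = "\<lambda>x w. em x i (snd w)"
  have le: "V (scheme_map a w) \<le> \<xi> (?j w) * norm (?y x w - ?y 0 w) powr ?q + \<xi> (?j w) * norm (?y 0 w) powr ?q" for w
  proof -
    have "norm (fst (scheme_map (x, i) w)) \<le> norm (?y x w - ?y 0 w) + norm (?y 0 w)"
      using norm_scheme_map_le[of x i w] norm_triangle_sub[of "?y x w" "?y 0 w"] by linarith
    then have "norm (fst (scheme_map (x, i) w)) powr ?q \<le> (norm (?y x w - ?y 0 w) + norm (?y 0 w)) powr ?q"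
      using s by (intro powr_mono2) auto
    also have "\<dots> \<le> norm (?y x w - ?y 0 w) powr ?q + norm (?y 0 w) powr ?q"
      using s by (intro powr_add_le_add_powr) auto
    finally have "\<xi> (?j w) * norm (fst (scheme_map (x, i) w)) powr ?q
        \<le> \<xi> (?j w) * (norm (?y x w - ?y 0 w) powr ?q + norm (?y 0 w) powr ?q)"
      by (intro mult_left_mono \<xi>_nonneg)
    then show ?thesis by (simp add: V_def a scheme_map_def distrib_left)
  qed
  have [measurable]: "(\<lambda>w. \<xi> (?j w)) \<in> borel_measurable W"
    by (rule measurable_compose[OF measurable_component_switch]) simp
  have [measurable]: "(\<lambda>w. em x i (snd w)) \<in> borel_measurable W" for x
    by (rule measurable_compose[OF measurable_noise_snd]) measurable
  have "(\<integral>\<^sup>+w. ennreal (V (scheme_map a w)) \<partial>W)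
      \<le> (\<integral>\<^sup>+w. ennreal (\<xi> (?j w) * norm (?y x w - ?y 0 w) powr ?q) + ennreal (\<xi> (?j w) * norm (?y 0 w) powr ?q) \<partial>W)"
    using le by (intro nn_integral_mono) (simp add: ennreal_plus[symmetric] \<xi>_nonneg ennreal_leI del: ennreal_plus)
  also have "\<dots> = (\<integral>\<^sup>+w. ennreal (\<xi> (?j w) * norm (?y x w - ?y 0 w) powr ?q) \<partial>W) + origin_moment i"
    unfolding origin_moment_def by (rule nn_integral_add) measurable
  also have "\<dots> \<le> ennreal (\<gamma> * V a) + ennreal moment_bound"
    using same_state_contraction[of i x 0] by (intro add_mono origin_moment_le) (simp add: V_def a)
  also have "\<dots> = ennreal (\<gamma> * V a + moment_bound)"
    by (rule ennreal_plus[symmetric]) (intro mult_nonneg_nonneg \<gamma> V_nonneg moment_bound_nonneg)+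
  finally show ?thesis .
qed

definition coupling_prob :: real where
  "coupling_prob = pmf (transition_map_pmf P) (\<lambda>_. k0)"

lemma coupling_prob_pos: "0 < coupling_prob"
proof -
  have "coupling_prob = (\<Prod>i\<in>UNIV. P $ i $ k0)"
    unfolding coupling_prob_def transition_map_pmf_def by (subst pmf_Pi') (auto simp: pmf_row_pmf P_nonneg P_sum)
  then show ?thesis using P_column by (simp add: prod_pos)
qed

lemma coupling_prob_le_1: "coupling_prob \<le> 1"
  by (simp add: coupling_prob_def pmf_le_1)

lemma separation_prob:
  "(\<integral>\<^sup>+w. indicator {u. u i \<noteq> u j} (fst w) \<partial>W) \<le> ennreal (1 - coupling_prob)"
proof -
  have m: "(\<lambda>w. indicator {u. u i \<noteq> u j} (fst w) :: ennreal) \<in> borel_measurable (measure_pmf (transition_map_pmf P) \<Otimes>\<^sub>M \<nu>)"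
    by (rule measurable_compose[OF measurable_fst]) simp
  have "(\<integral>\<^sup>+w. indicator {u. u i \<noteq> u j} (fst w) \<partial>W) = (\<integral>\<^sup>+u. \<integral>\<^sup>+n. indicator {u. u i \<noteq> u j} u \<partial>\<nu> \<partial>measure_pmf (transition_map_pmf P))"
    unfolding scheme_noise_def using \<nu>.nn_integral_fst[OF m] by simp
  also have "\<dots> = (\<integral>\<^sup>+u. indicator {u. u i \<noteq> u j} u \<partial>measure_pmf (transition_map_pmf P))"
    using \<nu>.emeasure_space_1 by simp
  also have "\<dots> = emeasure (measure_pmf (transition_map_pmf P)) {u. u i \<noteq> u j}"
    by simp
  also have "\<dots> \<le> emeasure (measure_pmf (transition_map_pmf P)) (- {\<lambda>_. k0})"
    by (intro emeasure_mono) auto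
  also have "\<dots> = ennreal (1 - coupling_prob)"
    using measure_pmf.prob_compl[of "{\<lambda>_. k0}" "transition_map_pmf P"]
    by (simp add: measure_pmf.emeasure_eq_measure coupling_prob_def pmf.rep_eq Compl_eq_Diff_UNIV)
  finally show ?thesis .
qed

text \<open>Large enough for the gain \<open>coupling_prob / 2 * penalty\<close> to absorb the additive constants of both
  moment bounds.\<close>

definition penalty :: real where
  "penalty = max 1 (4 * moment_bound / coupling_prob)"

definition weighted_dist :: "(real ^ 'n) \<times> 'm \<Rightarrow> (real ^ 'n) \<times> 'm \<Rightarrow> real" where
  "weighted_dist a b = (if snd a = snd b then \<xi> (snd a) * norm (fst a - fst b) powr (2 * s)
     else penalty + V a + V b)"

lemma weighted_dist_le: "weighted_dist a b \<le> penalty * of_bool (snd a \<noteq> snd b) + (V a + V b)"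
proof (cases "snd a = snd b")
  case True
  have "norm (fst a - fst b) powr (2 * s) \<le> (norm (fst a) + norm (fst b)) powr (2 * s)"
    using s by (intro powr_mono2 norm_triangle_ineq4) auto
  also have "\<dots> \<le> norm (fst a) powr (2 * s) + norm (fst b) powr (2 * s)"
    using s by (intro powr_add_le_add_powr) auto
  finally have "\<xi> (snd b) * norm (fst a - fst b) powr (2 * s)
      \<le> \<xi> (snd b) * (norm (fst a) powr (2 * s) + norm (fst b) powr (2 * s))"
    by (intro mult_left_mono \<xi>_nonneg)
  then show ?thesis using True by (simp add: weighted_dist_def V_def distrib_left)
qed (simp add: weighted_dist_def)

definition rate :: real where
  "rate = max \<gamma> (1 - coupling_prob / 2)"

lemma penalty_ge_1: "1 \<le> penalty" by (simp add: penalty_def)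

lemma moment_bound_penalty: "2 * moment_bound \<le> coupling_prob / 2 * penalty"
proof -
  have "4 * moment_bound / coupling_prob \<le> penalty" by (simp add: penalty_def)
  then show ?thesis using coupling_prob_pos by (simp add: field_simps)
qed

text \<open>In equal states this is the synchronous contraction. In different states the penalty survives with
  probability at most \<open>1 - coupling_prob\<close>, and after a merger the distance is still bounded by
  the two moment functions.\<close>

lemma weighted_dist_contraction:
  "(\<integral>\<^sup>+w. ennreal (weighted_dist (scheme_map a w) (scheme_map b w)) \<partial>W) \<le> ennreal rate * ennreal (weighted_dist a b)"
proof -
  obtain x i y j where ab: "a = (x, i)" "b = (y, j)" by (cases a, cases b)
  have rate0: "0 \<le> rate" using \<gamma> by (simp add: rate_def)
  have "(\<integral>\<^sup>+w. ennreal (weighted_dist (scheme_map a w) (scheme_map b w)) \<partial>W) \<le> ennreal (rate * weighted_dist a b)"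
  proof (cases "i = j")
    case True
    have "(\<integral>\<^sup>+w. ennreal (weighted_dist (scheme_map a w) (scheme_map b w)) \<partial>W)
        \<le> (\<integral>\<^sup>+w. ennreal (\<xi> (fst w i) * norm (em x i (snd w) - em y i (snd w)) powr (2 * s)) \<partial>W)"
    proof (intro nn_integral_mono ennreal_leI)
      fix w
      have "weighted_dist (scheme_map a w) (scheme_map b w)
          = \<xi> (fst w i) * norm (fst (scheme_map (x, i) w) - fst (scheme_map (y, i) w)) powr (2 * s)"
        using True by (simp add: ab weighted_dist_def scheme_map_def)
      also have "\<dots> \<le> \<xi> (fst w i) * norm (em x i (snd w) - em y i (snd w)) powr (2 * s)"
        using s by (intro mult_left_mono powr_mono2 dist_scheme_map_le \<xi>_nonneg) auto
      finally show "weighted_dist (scheme_map a w) (scheme_map b w) \<le> \<xi> (fst w i) * norm (em x i (snd w) - em y i (snd w)) powr (2 * s)" .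
    qed
    also have "\<dots> \<le> ennreal (\<gamma> * weighted_dist a b)"
      using same_state_contraction[of i x y] True by (simp add: ab weighted_dist_def)
    also have "\<dots> \<le> ennreal (rate * weighted_dist a b)"
      by (intro ennreal_leI mult_right_mono) (auto simp: rate_def ab True weighted_dist_def \<xi>_nonneg)
    finally show ?thesis .
  next
    case False
    let ?I = "\<lambda>w. indicator {u. u i \<noteq> u j} (fst w) :: ennreal"
    have p0: "0 \<le> penalty" using penalty_ge_1 by simp
    have plus3: "ennreal (p + (q + r)) = ennreal p + (ennreal q + ennreal r)"
      if "0 \<le> p" "0 \<le> q" "0 \<le> r" for p q r :: real using that by simp
    note [measurable] = measurable_scheme_map_start[where P=P]
    have [measurable]: "?I \<in> borel_measurable W"
      unfolding scheme_noise_def by (rule measurable_compose[OF measurable_fst]) simp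
    have "(\<integral>\<^sup>+w. ennreal (weighted_dist (scheme_map a w) (scheme_map b w)) \<partial>W)
        \<le> (\<integral>\<^sup>+w. ennreal penalty * ?I w + (ennreal (V (scheme_map a w)) + ennreal (V (scheme_map b w))) \<partial>W)"
    proof (rule nn_integral_mono)
      fix w
      have "ennreal (weighted_dist (scheme_map a w) (scheme_map b w))
          \<le> ennreal (penalty * of_bool (fst w i \<noteq> fst w j) + (V (scheme_map a w) + V (scheme_map b w)))"
        using weighted_dist_le[of "scheme_map a w" "scheme_map b w"]
        by (intro ennreal_leI) (simp add: ab scheme_map_def)
      also have "\<dots> = ennreal (penalty * of_bool (fst w i \<noteq> fst w j)) + (ennreal (V (scheme_map a w)) + ennreal (V (scheme_map b w)))"
        by (rule plus3) (use p0 V_nonneg in auto)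
      also have "ennreal (penalty * of_bool (fst w i \<noteq> fst w j)) = ennreal penalty * ?I w"
        by (auto simp: indicator_def)
      finally show "ennreal (weighted_dist (scheme_map a w) (scheme_map b w))
          \<le> ennreal penalty * ?I w + (ennreal (V (scheme_map a w)) + ennreal (V (scheme_map b w)))" .
    qed
    also have "\<dots> = ennreal penalty * (\<integral>\<^sup>+w. ?I w \<partial>W)
        + ((\<integral>\<^sup>+w. ennreal (V (scheme_map a w)) \<partial>W) + (\<integral>\<^sup>+w. ennreal (V (scheme_map b w)) \<partial>W))"
      by (simp add: nn_integral_add nn_integral_cmult)
    also have "\<dots> \<le> ennreal penalty * ennreal (1 - coupling_prob) + (ennreal (\<gamma> * V a + moment_bound) + ennreal (\<gamma> * V b + moment_bound))"
      by (intro add_mono mult_left_mono separation_prob moment_drift) simp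
    also have "\<dots> = ennreal (penalty * (1 - coupling_prob) + ((\<gamma> * V a + moment_bound) + (\<gamma> * V b + moment_bound)))"
      using p0 coupling_prob_le_1 moment_bound_nonneg
      by (subst plus3) (auto intro!: add_nonneg_nonneg mult_nonneg_nonneg \<gamma> V_nonneg simp: ennreal_mult)
    also have "\<dots> \<le> ennreal (rate * weighted_dist a b)"
    proof (rule ennreal_leI)
      have "penalty * (1 - coupling_prob) + ((\<gamma> * V a + moment_bound) + (\<gamma> * V b + moment_bound))
          \<le> (1 - coupling_prob / 2) * penalty + (\<gamma> * V a + \<gamma> * V b)"
        using moment_bound_penalty by (simp add: algebra_simps)
      also have "\<dots> \<le> rate * penalty + (rate * V a + rate * V b)"
        using p0 V_nonneg by (intro add_mono mult_right_mono) (auto simp: rate_def)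
      also have "\<dots> = rate * weighted_dist a b"
        using False by (simp add: ab weighted_dist_def algebra_simps)
      finally show "penalty * (1 - coupling_prob) + ((\<gamma> * V a + moment_bound) + (\<gamma> * V b + moment_bound)) \<le> rate * weighted_dist a b" .
    qed
    finally show ?thesis .
  qed
  then show ?thesis using rate0 by (simp add: ennreal_mult')
qed

lemma hybrid_dist_le_weighted_dist: "hybrid_dist a b \<le> weighted_dist a b"
proof (cases "snd a = snd b")
  case True
  have "min 1 (norm (fst a - fst b)) \<le> norm (fst a - fst b) powr (2 * s)"
  proof (cases "norm (fst a - fst b) \<le> 1")
    case small: True
    then have "norm (fst a - fst b) powr 1 \<le> norm (fst a - fst b) powr (2 * s)"
      using s by (intro powr_mono') auto
    then show ?thesis by simp
  next
    case False
    then show ?thesis using s by (simp add: ge_one_powr_ge_zero)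
  qed
  also have "\<dots> \<le> \<xi> (snd a) * norm (fst a - fst b) powr (2 * s)"
    using \<xi>[of "snd a"] mult_right_mono[of 1 "\<xi> (snd a)" "norm (fst a - fst b) powr (2 * s)"] by simp
  finally show ?thesis using True by (simp add: hybrid_dist_def weighted_dist_def dist_norm)
next
  case False
  then show ?thesis using penalty_ge_1 by (simp add: hybrid_dist_def weighted_dist_def V_nonneg add_increasing2)
qed

sublocale R: contracting_random_map W scheme_map "\<lambda>a b. ennreal (weighted_dist a b)" rate "(0, k0)"
proof
  show "(\<lambda>(a, w). scheme_map a w) \<in> measurable (E \<Otimes>\<^sub>M W) E"
    unfolding case_prod_beta' by (rule measurable_scheme_map) measurable
  show "(\<lambda>(a, b). ennreal (weighted_dist a b)) \<in> borel_measurable (E \<Otimes>\<^sub>M E)"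
    unfolding weighted_dist_def case_prod_beta' by measurable
  show "ennreal (hybrid_dist a b) \<le> ennreal (weighted_dist a b)" for a b
    by (intro ennreal_leI hybrid_dist_le_weighted_dist)
  show "0 \<le> rate" "rate < 1" using \<gamma> coupling_prob_pos by (auto simp: rate_def)
  show "(\<integral>\<^sup>+w. ennreal (weighted_dist (scheme_map a w) (scheme_map b w)) \<partial>W) \<le> ennreal rate * ennreal (weighted_dist a b)" for a b
    by (rule weighted_dist_contraction)
  show "hybrid_tendsto Y y \<Longrightarrow> hybrid_tendsto (\<lambda>n. scheme_map (Y n) w) (scheme_map y w)" for Y y w
    by (rule scheme_map_continuous)
  note [measurable] = measurable_scheme_map_start[where P=P]
  have "(\<integral>\<^sup>+w. ennreal (weighted_dist (scheme_map (0, k0) w) (0, k0)) \<partial>W)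
      \<le> (\<integral>\<^sup>+w. ennreal penalty + ennreal (V (scheme_map (0, k0) w)) \<partial>W)"
  proof (rule nn_integral_mono)
    fix w
    have "weighted_dist (scheme_map (0, k0) w) (0, k0) \<le> penalty + V (scheme_map (0, k0) w)"
      using weighted_dist_le[of "scheme_map (0, k0) w" "(0, k0)"] penalty_ge_1
      by (auto simp: V_def of_bool_def split: if_splits)
    then show "ennreal (weighted_dist (scheme_map (0, k0) w) (0, k0)) \<le> ennreal penalty + ennreal (V (scheme_map (0, k0) w))"
      using penalty_ge_1 V_nonneg by (simp add: ennreal_plus[symmetric] ennreal_leI del: ennreal_plus)
  qed
  also have "\<dots> = ennreal penalty + (\<integral>\<^sup>+w. ennreal (V (scheme_map (0, k0) w)) \<partial>W)"
    by (subst nn_integral_add) (simp_all add: W.emeasure_space_1)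
  also have "\<dots> \<le> ennreal penalty + ennreal (\<gamma> * V (0, k0) + moment_bound)"
    by (intro add_left_mono moment_drift)
  also have "\<dots> < top" by simp
  finally show "(\<integral>\<^sup>+w. ennreal (weighted_dist (scheme_map (0, k0) w) (0, k0)) \<partial>W) < top" .
qed simp

lemma unique_stationary: "\<exists>!\<mu>. R.stationary \<mu>"
  using R.stationary_pullback_law R.stationary_unique by blast

end

section \<open>Invariant measures of the scheme\<close>

context truncated_scheme
begin

lemma truncation_fixes_scheme: "T (r (real k * \<Delta>) \<omega>) (Z_scheme f g \<phi> h B r \<Delta> x k \<omega>) = Z_scheme f g \<phi> h B r \<Delta> x k \<omega>"
  unfolding Z_scheme_def by (rule truncation_idempotent[OF bound bound_le])

lemma truncation_fixes_map: "T (snd (scheme_map a w)) (fst (scheme_map a w)) = fst (scheme_map a w)"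
  unfolding scheme_map_def truncated_step_def by (simp add: truncation_idempotent[OF bound bound_le])

lemma scheme_map_truncation: "scheme_map (T (snd a) (fst a), snd a) w = scheme_map a w"
  by (simp add: scheme_map_def truncation_idempotent[OF bound bound_le])

definition transition_operator ::
  "real ^ 'm ^ 'm \<Rightarrow> ((real ^ 'n) \<times> 'm \<Rightarrow> ennreal) \<Rightarrow> (real ^ 'n) \<times> 'm \<Rightarrow> ennreal" where
  "transition_operator P u a = (\<integral>\<^sup>+w. u (scheme_map a w) \<partial>scheme_noise P)"

lemma measurable_transition_operator:
  assumes [measurable]: "u \<in> borel_measurable E"
  shows "transition_operator P u \<in> borel_measurable E"
proof -
  interpret W: prob_space "scheme_noise P" by (rule prob_space_scheme_noise)
  show ?thesis unfolding transition_operator_def[abs_def] by measurable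
qed

lemma measurable_transition_operator_power:
  "u \<in> borel_measurable E \<Longrightarrow> (transition_operator P ^^ k) u \<in> borel_measurable E"
  by (induction k) (auto intro: measurable_transition_operator)

end

context switching_driver
begin

lemma measurable_state: "(\<lambda>\<omega>. (Z_scheme f g \<phi> h B r \<Delta> x k \<omega>, r (real k * \<Delta>) \<omega>)) \<in> measurable M E"
  using step_pos by (intro measurable_Pair Z_measurable r_measurable) simp

lemma scheme_one_step:
  assumes [measurable]: "u \<in> borel_measurable E"
  shows "(\<integral>\<^sup>+\<omega>. u (Z_scheme f g \<phi> h B r \<Delta> x (Suc k) \<omega>, r (real (Suc k) * \<Delta>) \<omega>) \<partial>M)
    = (\<integral>\<^sup>+\<omega>. transition_operator P u (Z_scheme f g \<phi> h B r \<Delta> x k \<omega>, r (real k * \<Delta>) \<omega>) \<partial>M)"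
proof -
  let ?Z = "Z_scheme f g \<phi> h B r \<Delta> x k" and ?t = "real k * \<Delta>"
  let ?G = "\<lambda>(z, i, n, j). u (step z i n j, j)"
  have t: "real (Suc k) * \<Delta> = ?t + \<Delta>" by (simp add: algebra_simps)
  have "(\<integral>\<^sup>+\<omega>. u (Z_scheme f g \<phi> h B r \<Delta> x (Suc k) \<omega>, r (real (Suc k) * \<Delta>) \<omega>) \<partial>M)
      = (\<integral>\<^sup>+\<omega>. ?G (?Z \<omega>, r ?t \<omega>, B (?t + \<Delta>) \<omega> - B ?t \<omega>, r (?t + \<Delta>) \<omega>) \<partial>M)"
    unfolding Z_scheme_Suc t by simp
  also have "\<dots> = (\<integral>\<^sup>+\<omega>. (\<Sum>j\<in>UNIV. ennreal (P $ r ?t \<omega> $ j) * (\<integral>\<^sup>+n. ?G (?Z \<omega>, r ?t \<omega>, n, j) \<partial>\<nu>)) \<partial>M)"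
    by (rule scheme_markov_property) measurable
  also have "\<dots> = (\<integral>\<^sup>+\<omega>. transition_operator P u (?Z \<omega>, r ?t \<omega>) \<partial>M)"
  proof (rule nn_integral_cong)
    fix \<omega>
    have "transition_operator P u (?Z \<omega>, r ?t \<omega>)
        = (\<integral>\<^sup>+w. u (step (?Z \<omega>) (r ?t \<omega>) (snd w) (fst w (r ?t \<omega>)), fst w (r ?t \<omega>)) \<partial>scheme_noise P)"
      by (simp add: transition_operator_def scheme_map_def truncation_fixes_scheme)
    also have "\<dots> = (\<Sum>j\<in>UNIV. ennreal (P $ r ?t \<omega> $ j) * (\<integral>\<^sup>+n. u (step (?Z \<omega>) (r ?t \<omega>) n j, j) \<partial>\<nu>))"
      by (rule nn_integral_scheme_noise[OF P_nonneg P_sum]) measurable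
    finally show "(\<Sum>j\<in>UNIV. ennreal (P $ r ?t \<omega> $ j) * (\<integral>\<^sup>+n. ?G (?Z \<omega>, r ?t \<omega>, n, j) \<partial>\<nu>))
        = transition_operator P u (?Z \<omega>, r ?t \<omega>)" by simp
  qed
  finally show ?thesis .
qed

lemma scheme_expectation:
  assumes start: "AE \<omega> in M. r 0 \<omega> = i" and u: "u \<in> borel_measurable E"
  shows "(\<integral>\<^sup>+\<omega>. u (Z_scheme f g \<phi> h B r \<Delta> x k \<omega>, r (real k * \<Delta>) \<omega>) \<partial>M)
    = (transition_operator P ^^ k) u (T i x, i)"
  using u
proof (induction k arbitrary: u)
  case 0
  have "(\<integral>\<^sup>+\<omega>. u (Z_scheme f g \<phi> h B r \<Delta> x 0 \<omega>, r (real 0 * \<Delta>) \<omega>) \<partial>M) = (\<integral>\<^sup>+\<omega>. u (T i x, i) \<partial>M)"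
    using start by (intro nn_integral_cong_AE) (auto simp: Z_scheme_0 elim!: eventually_mono)
  then show ?case by (simp add: emeasure_space_1)
next
  case (Suc k)
  show ?case
    by (simp only: scheme_one_step[OF Suc.prems] Suc.IH[OF measurable_transition_operator[OF Suc.prems]] funpow_Suc_right o_apply)
qed

end

lemma sum_nn_integral_slice:
  fixes \<mu> :: "((real ^ 'n) \<times> 'm::finite) measure"
  assumes sets[measurable_cong]: "sets \<mu> = sets state_algebra"
    and F: "\<And>i. (\<lambda>x. F (x, i)) \<in> borel_measurable borel"
  shows "(\<Sum>i\<in>UNIV. \<integral>\<^sup>+x. F (x, i) \<partial>slice \<mu> i) = (\<integral>\<^sup>+a. F a \<partial>\<mu>)"
proof -
  have U: "UNIV \<times> {i} \<in> sets \<mu>" for i unfolding sets by (intro pair_measureI) auto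
  have space: "space \<mu> = UNIV" using sets_eq_imp_space_eq[OF sets] by (simp add: space_pair_measure)
  have m: "(\<lambda>a. F (fst a, i)) \<in> borel_measurable \<mu>" for i
    by (rule measurable_compose[OF _ F[of i]]) measurable
  have one: "(\<integral>\<^sup>+x. F (x, i) \<partial>slice \<mu> i) = (\<integral>\<^sup>+a. F (fst a, i) * indicator (UNIV \<times> {i}) a \<partial>\<mu>)" for i
  proof -
    have "(\<integral>\<^sup>+x. F (x, i) \<partial>slice \<mu> i) = (\<integral>\<^sup>+a. F (fst a, i) \<partial>restrict_space \<mu> (UNIV \<times> {i}))"
      unfolding slice_def
    proof (rule nn_integral_distr)
      show "fst \<in> measurable (restrict_space \<mu> (UNIV \<times> {i})) borel"
        by (intro measurable_restrict_space1) measurable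
      show "(\<lambda>x. F (x, i)) \<in> borel_measurable (distr (restrict_space \<mu> (UNIV \<times> {i})) borel fst)"
        using F by simp
    qed
    also have "\<dots> = (\<integral>\<^sup>+a. F (fst a, i) * indicator (UNIV \<times> {i}) a \<partial>\<mu>)"
      by (rule nn_integral_restrict_space) (simp add: U space)
    finally show ?thesis .
  qed
  have "(\<Sum>i\<in>UNIV. \<integral>\<^sup>+x. F (x, i) \<partial>slice \<mu> i) = (\<integral>\<^sup>+a. (\<Sum>i\<in>UNIV. F (fst a, i) * indicator (UNIV \<times> {i}) a) \<partial>\<mu>)"
    unfolding one by (rule nn_integral_sum[symmetric]) (use m U in measurable)
  also have "\<dots> = (\<integral>\<^sup>+a. F a \<partial>\<mu>)"
  proof (rule nn_integral_cong)
    fix a :: "(real ^ 'n) \<times> 'm"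
    have "(\<Sum>i\<in>UNIV. F (fst a, i) * indicator (UNIV \<times> {i}) a) = (\<Sum>i\<in>UNIV. if i = snd a then F a else 0)"
      by (intro sum.cong refl) (auto simp: indicator_def mem_Times_iff)
    then show "(\<Sum>i\<in>UNIV. F (fst a, i) * indicator (UNIV \<times> {i}) a) = F a" by simp
  qed
  finally show ?thesis .
qed

context contractive_scheme
begin

lemma stationary_transition_operator:
  assumes "R.stationary \<mu>" "u \<in> borel_measurable E"
  shows "(\<integral>\<^sup>+a. transition_operator P u a \<partial>\<mu>) = (\<integral>\<^sup>+a. u a \<partial>\<mu>)"
  unfolding transition_operator_def by (rule R.stationary_nn_integral[OF assms])

lemma stationary_truncation:
  assumes \<mu>: "R.stationary \<mu>" and u: "u \<in> borel_measurable E"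
  shows "(\<integral>\<^sup>+a. u (T (snd a) (fst a), snd a) \<partial>\<mu>) = (\<integral>\<^sup>+a. u a \<partial>\<mu>)"
proof -
  have m: "(\<lambda>a. u (T (snd a) (fst a), snd a)) \<in> borel_measurable E"
    by (rule measurable_compose[OF _ u]) measurable
  show ?thesis
    using R.stationary_nn_integral[OF \<mu> m] R.stationary_nn_integral[OF \<mu> u]
    by (simp add: truncation_fixes_map)
qed

text \<open>After at least one step the law of the scheme is carried by truncated points, so the truncation of
  the initial value inside the kernels has no effect on an invariant measure.\<close>

theorem invariant_iff_stationary:
  assumes drv: "\<And>i. switching_driver f g \<phi> h \<Delta> M F B (r i) P"
    and start: "\<And>i. AE \<omega> in M. r i 0 \<omega> = i"
  shows "invariant_measure (Z_kernel M f g \<phi> h B r \<Delta>) \<mu> \<longleftrightarrow> R.stationary \<mu>"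
proof -
  let ?K = "Z_kernel M f g \<phi> h B r \<Delta>"
  let ?L = "transition_operator P"
  have K: "emeasure (?K k x i) A = (?L ^^ k) (indicator A) (T i x, i)" if A: "A \<in> sets E" for k x i A
  proof -
    interpret switching_driver f g \<phi> h \<Delta> M F B "r i" P by (rule drv)
    have "emeasure (?K k x i) A = (\<integral>\<^sup>+b. indicator A b \<partial>?K k x i)"
      using A by (simp add: Z_kernel_def)
    also have "\<dots> = (\<integral>\<^sup>+\<omega>. indicator A (Z_scheme f g \<phi> h B (r i) \<Delta> x k \<omega>, r i (real k * \<Delta>) \<omega>) \<partial>M)"
      unfolding Z_kernel_def using A by (intro nn_integral_distr measurable_state) simp
    also have "\<dots> = (?L ^^ k) (indicator A) (T i x, i)"
      using A by (intro scheme_expectation start) simp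
    finally show ?thesis .
  qed
  have rect: "\<Upsilon> \<times> {l} \<in> sets E" if "\<Upsilon> \<in> sets borel" for \<Upsilon> and l :: 'm
    using that by (intro pair_measureI) auto
  have power_meas: "(\<lambda>a. (?L ^^ k) (indicator A) (T (snd a) (fst a), snd a)) \<in> borel_measurable E" if "A \<in> sets E" for k A
    by (rule measurable_compose[OF _ measurable_transition_operator_power[of "indicator A"]]) (use that in measurable)
  have slices: "(\<Sum>i\<in>UNIV. \<integral>\<^sup>+x. emeasure (?K k x i) A \<partial>slice \<mu> i) = (\<integral>\<^sup>+a. (?L ^^ k) (indicator A) (T (snd a) (fst a), snd a) \<partial>\<mu>)"
    if sets: "sets \<mu> = sets E" and A: "A \<in> sets E" for k A
  proof -
    have "(\<lambda>x. (?L ^^ k) (indicator A) (T i x, i)) \<in> borel_measurable borel" for i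
    proof -
      have "(\<lambda>x. (x, i)) \<in> measurable borel E" by measurable
      from measurable_compose[OF this power_meas[OF A, of k]] show ?thesis by simp
    qed
    then show ?thesis
      using sum_nn_integral_slice[OF sets, of "\<lambda>a. (?L ^^ k) (indicator A) (T (snd a) (fst a), snd a)"]
      by (simp add: K[OF A])
  qed
  show ?thesis
  proof
    assume inv: "invariant_measure ?K \<mu>"
    then have prob: "prob_space \<mu>" and sets[measurable_cong]: "sets \<mu> = sets E"
      by (auto simp: invariant_measure_def)
    let ?\<mu>' = "distr (\<mu> \<Otimes>\<^sub>M W) E (\<lambda>(a, w). scheme_map a w)"
    have image: "emeasure ?\<mu>' A = (\<integral>\<^sup>+a. ?L (indicator A) a \<partial>\<mu>)" if "A \<in> sets E" for A
      using R.nn_integral_image[OF sets, of "indicator A"] that by (simp add: transition_operator_def)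
    have "\<mu> = ?\<mu>'"
    proof (rule measure_eqI_sheets)
      fix \<Upsilon> :: "(real ^ 'n) set" and l :: 'm assume Y: "\<Upsilon> \<in> sets borel"
      have "emeasure \<mu> (\<Upsilon> \<times> {l}) = (\<Sum>i\<in>UNIV. \<integral>\<^sup>+x. emeasure (?K 1 x i) (\<Upsilon> \<times> {l}) \<partial>slice \<mu> i)"
        using inv Y unfolding invariant_measure_def by blast
      also have "\<dots> = (\<integral>\<^sup>+a. ?L (indicator (\<Upsilon> \<times> {l})) a \<partial>\<mu>)"
        unfolding slices[OF sets rect[OF Y]] by (simp add: transition_operator_def scheme_map_truncation)
      also have "\<dots> = emeasure ?\<mu>' (\<Upsilon> \<times> {l})" by (rule image[OF rect[OF Y], symmetric])
      finally show "emeasure \<mu> (\<Upsilon> \<times> {l}) = emeasure ?\<mu>' (\<Upsilon> \<times> {l})" .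
    qed (simp_all add: sets)
    then show "R.stationary \<mu>" unfolding R.stationary_def using prob sets by simp
  next
    assume \<mu>: "R.stationary \<mu>"
    then have prob: "prob_space \<mu>" and sets: "sets \<mu> = sets E" by (auto simp: R.stationary_def)
    have power: "(\<integral>\<^sup>+a. (?L ^^ k) u a \<partial>\<mu>) = (\<integral>\<^sup>+a. u a \<partial>\<mu>)" if "u \<in> borel_measurable E" for k u
      using that
    proof (induction k)
      case (Suc k)
      then show ?case
        by (simp add: stationary_transition_operator[OF \<mu>] measurable_transition_operator_power)
    qed simp
    show "invariant_measure ?K \<mu>"
      unfolding invariant_measure_def
    proof (intro conjI allI ballI prob sets)
      fix k and \<Upsilon> :: "(real ^ 'n) set" and l :: 'm assume "\<Upsilon> \<in> sets borel"
      note A = rect[OF this, of l]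
      have ind: "indicator (\<Upsilon> \<times> {l}) \<in> borel_measurable E" using A by simp
      have "(\<Sum>i\<in>UNIV. \<integral>\<^sup>+x. emeasure (?K k x i) (\<Upsilon> \<times> {l}) \<partial>slice \<mu> i) = (\<integral>\<^sup>+a. (?L ^^ k) (indicator (\<Upsilon> \<times> {l})) a \<partial>\<mu>)"
        unfolding slices[OF sets A]
        by (rule stationary_truncation[OF \<mu> measurable_transition_operator_power[OF ind]])
      also have "\<dots> = (\<integral>\<^sup>+a. indicator (\<Upsilon> \<times> {l}) a \<partial>\<mu>)" by (rule power[OF ind])
      also have "\<dots> = emeasure \<mu> (\<Upsilon> \<times> {l})" using A sets by simp
      finally show "emeasure \<mu> (\<Upsilon> \<times> {l}) = (\<Sum>i\<in>UNIV. \<integral>\<^sup>+x. emeasure (?K k x i) (\<Upsilon> \<times> {l}) \<partial>slice \<mu> i)" ..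
    qed
  qed
qed

end

section \<open>Choice of the weights and of the step size\<close>

text \<open>\<open>\<Delta> * (h \<Delta>)\<^sup>2\<close> is the square of \<open>\<Delta> powr (1/2 - \<theta>) * h \<Delta>\<close> times
  \<open>\<Delta> powr (2 * \<theta>)\<close>.\<close>

lemma admissible_step_function_limit:
  assumes "admissible_step_function f g \<phi> x0 h"
  shows "((\<lambda>\<Delta>. \<Delta> * (h \<Delta>)\<^sup>2) \<longlongrightarrow> 0) (at_right 0)"
proof -
  from assms obtain \<theta> K where \<theta>: "0 < \<theta>" "\<theta> < 1 / 2" and K: "0 < K"
    and le: "\<And>\<Delta>. \<Delta> \<in> {0<..1} \<Longrightarrow> \<Delta> powr (1/2 - \<theta>) * h \<Delta> \<le> K"
    unfolding admissible_step_function_def by blast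
  have lim: "filterlim h at_top (at_right 0)" using assms by (simp add: admissible_step_function_def)
  have ev: "\<forall>\<^sub>F \<Delta> in at_right 0. 0 < \<Delta> \<and> \<Delta> < 1 \<and> 0 \<le> h \<Delta>"
  proof (intro eventually_conj)
    show "\<forall>\<^sub>F \<Delta> in at_right 0. (0::real) < \<Delta>" by (rule eventually_at_right_less)
    show "\<forall>\<^sub>F \<Delta> in at_right 0. \<Delta> < (1::real)" by (rule eventually_at_right_real[THEN eventually_mono]) auto
    show "\<forall>\<^sub>F \<Delta> in at_right 0. 0 \<le> h \<Delta>" using lim by (simp add: filterlim_at_top)
  qed
  show ?thesis
  proof (rule tendsto_sandwich[where f="\<lambda>_. 0" and h="\<lambda>\<Delta>. K\<^sup>2 * \<Delta> powr (2 * \<theta>)"])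
    show "\<forall>\<^sub>F \<Delta> in at_right 0. 0 \<le> \<Delta> * (h \<Delta>)\<^sup>2" using ev by eventually_elim simp
    show "\<forall>\<^sub>F \<Delta> in at_right 0. \<Delta> * (h \<Delta>)\<^sup>2 \<le> K\<^sup>2 * \<Delta> powr (2 * \<theta>)"
      using ev
    proof eventually_elim
      case (elim \<Delta>)
      have "(\<Delta> powr (1/2 - \<theta>))\<^sup>2 = \<Delta> powr (1/2 - \<theta>) * \<Delta> powr (1/2 - \<theta>)" by (rule power2_eq_square)
      also have "\<dots> = \<Delta> powr (1 - 2 * \<theta>)" by (simp add: powr_add[symmetric])
      finally have "\<Delta> = (\<Delta> powr (1/2 - \<theta>))\<^sup>2 * \<Delta> powr (2 * \<theta>)"
        using elim by (simp add: powr_add[symmetric])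
      then have "\<Delta> * (h \<Delta>)\<^sup>2 = (\<Delta> powr (1/2 - \<theta>))\<^sup>2 * \<Delta> powr (2 * \<theta>) * (h \<Delta>)\<^sup>2" by simp
      also have "\<dots> = (\<Delta> powr (1/2 - \<theta>) * h \<Delta>)\<^sup>2 * \<Delta> powr (2 * \<theta>)" by (simp add: power_mult_distrib)
      also have "\<dots> \<le> K\<^sup>2 * \<Delta> powr (2 * \<theta>)"
        using le[of \<Delta>] elim by (intro mult_right_mono power_mono) auto
      finally show ?case .
    qed
    have "((\<lambda>\<Delta>. \<Delta> powr (2 * \<theta>)) \<longlongrightarrow> 0) (at_right 0)"
    proof (rule tendsto_zero_powrI[where b="2 * \<theta>"])
      show "((\<lambda>\<Delta>::real. \<Delta>) \<longlongrightarrow> 0) (at_right 0)" by (rule tendsto_ident_at)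
      show "\<forall>\<^sub>F \<Delta> in at_right 0. (0::real) \<le> \<Delta>" using ev by eventually_elim simp
    qed (use \<theta> in auto)
    then show "((\<lambda>\<Delta>. K\<^sup>2 * \<Delta> powr (2 * \<theta>)) \<longlongrightarrow> 0) (at_right 0)"
      using tendsto_mult_left[of _ 0 _ "K\<^sup>2"] by fastforce
  qed simp
qed

text \<open>With \<open>b\<close> the stationary mean of \<open>\<beta>\<close> and \<open>\<Gamma> *v c = b - \<beta>\<close>, the weights
  \<open>1 + s * c i\<close> give \<open>s * (b + s * \<beta> i * c i)\<close>, which is negative for small \<open>s\<close>. Adding a
  constant to \<open>c\<close> does not change \<open>\<Gamma> *v c\<close> and makes \<open>c\<close> nonnegative.\<close>

lemma weights_exist:
  fixes \<Gamma> :: "real ^ 'm ^ 'm"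
  assumes gen: "generator_matrix \<Gamma>" and irr: "irreducible_generator \<Gamma>" and st: "stationary_vector \<Gamma> \<pi>"
    and neg: "(\<Sum>i\<in>UNIV. \<pi> $ i * \<beta> i) < 0" and \<rho>: "0 < \<rho>"
  obtains s \<xi> where "0 < s" "2 * s \<le> 1" "2 * s \<le> \<rho>" "\<And>i. 1 \<le> \<xi> i"
    "\<And>i. (\<Sum>j\<in>UNIV. \<Gamma> $ i $ j * \<xi> j) + s * \<beta> i * \<xi> i < 0"
proof -
  define b where "b = (\<Sum>i\<in>UNIV. \<pi> $ i * \<beta> i)"
  have sum1: "(\<Sum>i\<in>UNIV. \<pi> $ i) = 1" using st by (simp add: stationary_vector_def)
  have "\<pi> \<bullet> (\<chi> i. b - \<beta> i) = 0"
    by (simp add: inner_vec_def right_diff_distrib sum_subtractf b_def[symmetric] sum_distrib_right[symmetric] sum1)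
  from poisson_equation_solvable[OF irr st this] obtain c0 where c0: "\<Gamma> *v c0 = (\<chi> i. b - \<beta> i)" .
  define t where "t = (\<Sum>i\<in>UNIV. \<bar>c0 $ i\<bar>)"
  define c where "c i = c0 $ i + t" for i
  have c_nonneg: "0 \<le> c i" for i
    using member_le_sum[of i UNIV "\<lambda>i. \<bar>c0 $ i\<bar>"] by (auto simp: c_def t_def)
  have \<Gamma>c: "(\<Sum>j\<in>UNIV. \<Gamma> $ i $ j * c j) = b - \<beta> i" for i
  proof -
    have "(\<Sum>j\<in>UNIV. \<Gamma> $ i $ j * c0 $ j) = b - \<beta> i"
      using c0 by (simp add: vec_eq_iff matrix_vector_mult_def)
    then show ?thesis
      by (simp add: c_def distrib_left sum.distrib sum_distrib_right[symmetric] generator_row_sum[OF gen])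
  qed
  define m where "m = 1 + (\<Sum>i\<in>UNIV. \<bar>\<beta> i * c i\<bar>)"
  have m: "1 \<le> m" by (simp add: m_def sum_nonneg)
  have m_ge: "\<beta> i * c i < m" for i
    using member_le_sum[of i UNIV "\<lambda>i. \<bar>\<beta> i * c i\<bar>"] by (force simp: m_def)
  define s where "s = min (1/2) (min (\<rho>/2) (- b / m))"
  have b0: "b < 0" using neg by (simp add: b_def)
  have bm: "0 < - b / m" using b0 m by (intro divide_pos_pos) auto
  have s2: "s \<le> 1 / 2" unfolding s_def by (rule min.cobounded1)
  have s3: "s \<le> \<rho> / 2" unfolding s_def by (rule order_trans[OF min.cobounded2 min.cobounded1])
  have s4: "s \<le> - b / m" unfolding s_def by (rule order_trans[OF min.cobounded2 min.cobounded2])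
  have s1: "0 < s" using bm \<rho> unfolding s_def min_less_iff_conj by simp
  have "s * m \<le> - b" using s4 m by (subst (asm) pos_le_divide_eq) auto
  with s1 s2 s3 have s: "0 < s" "2 * s \<le> 1" "2 * s \<le> \<rho>" "s * m \<le> - b" by auto
  have "(\<Sum>j\<in>UNIV. \<Gamma> $ i $ j * (1 + s * c j)) + s * \<beta> i * (1 + s * c i) < 0" for i
  proof -
    have row: "(\<Sum>j\<in>UNIV. \<Gamma> $ i $ j * (1 + s * c j)) = s * (\<Sum>j\<in>UNIV. \<Gamma> $ i $ j * c j)"
      by (simp add: distrib_left sum.distrib generator_row_sum[OF gen] sum_distrib_left mult_ac)
    have "(\<Sum>j\<in>UNIV. \<Gamma> $ i $ j * (1 + s * c j)) + s * \<beta> i * (1 + s * c i) = s * (b + s * (\<beta> i * c i))"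
      unfolding row \<Gamma>c by (simp add: algebra_simps)
    moreover have "s * (\<beta> i * c i) < s * m" using m_ge s by simp
    then have "b + s * (\<beta> i * c i) < 0" using s by linarith
    ultimately show ?thesis using s by (simp add: mult_pos_neg)
  qed
  then show ?thesis
    using s c_nonneg by (intro that[of s "\<lambda>i. 1 + s * c i"]) auto
qed

text \<open>To first order in \<open>\<Delta>\<close> the left-hand side minus \<open>\<xi> i\<close> is \<open>\<Delta>\<close> times the expression in
  the hypothesis.\<close>

lemma eventually_weights_contract:
  fixes \<Gamma> :: "real ^ 'm ^ 'm"
  assumes P: "transition_function \<Gamma> P" and e: "(e \<longlongrightarrow> 0) (at_right 0)"
    and neg: "(\<Sum>j\<in>UNIV. \<Gamma> $ i $ j * \<xi> j) + s * \<beta> * \<xi> i < 0"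
  shows "\<forall>\<^sub>F \<Delta> in at_right 0. (\<Sum>j\<in>UNIV. P \<Delta> $ i $ j * \<xi> j) * (1 + s * \<Delta> * (\<beta> + e \<Delta>)) < \<xi> i"
proof -
  let ?\<delta> = "\<lambda>j. if i = j then 1 else 0 :: real"
  let ?Q = "\<lambda>\<Delta>. (\<Sum>j\<in>UNIV. (P \<Delta> $ i $ j - ?\<delta> j) / \<Delta> * \<xi> j) + (\<Sum>j\<in>UNIV. P \<Delta> $ i $ j * \<xi> j) * (s * (\<beta> + e \<Delta>))"
  have sum_delta: "(\<Sum>j\<in>UNIV. ?\<delta> j * \<xi> j) = \<xi> i"
    by (simp add: if_distrib[of "\<lambda>z. z * _"] cong: if_cong)
  have "(?Q \<longlongrightarrow> (\<Sum>j\<in>UNIV. \<Gamma> $ i $ j * \<xi> j) + (\<Sum>j\<in>UNIV. ?\<delta> j * \<xi> j) * (s * (\<beta> + 0))) (at_right 0)"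
    by (intro tendsto_intros transition_derivative[OF P] transition_continuous[OF P] e)
  then have "\<forall>\<^sub>F \<Delta> in at_right 0. ?Q \<Delta> < 0"
    unfolding sum_delta by (rule order_tendstoD) (use neg in \<open>simp add: mult_ac\<close>)
  then show ?thesis
    using eventually_at_right_less[of 0]
  proof eventually_elim
    case (elim \<Delta>)
    have "\<Delta> * ?Q \<Delta> = (\<Sum>j\<in>UNIV. P \<Delta> $ i $ j * \<xi> j) * (1 + s * \<Delta> * (\<beta> + e \<Delta>)) - \<xi> i"
    proof -
      have "\<Delta> * (\<Sum>j\<in>UNIV. (P \<Delta> $ i $ j - ?\<delta> j) / \<Delta> * \<xi> j) = (\<Sum>j\<in>UNIV. (P \<Delta> $ i $ j - ?\<delta> j) * \<xi> j)"
        unfolding sum_distrib_left using elim by (intro sum.cong) auto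
      also have "\<dots> = (\<Sum>j\<in>UNIV. P \<Delta> $ i $ j * \<xi> j) - \<xi> i"
        by (simp add: left_diff_distrib sum_subtractf sum_delta)
      finally show ?thesis by (simp add: algebra_simps)
    qed
    moreover have "\<Delta> * ?Q \<Delta> < 0" using elim by (intro mult_pos_neg) auto
    ultimately show ?case by linarith
  qed
qed

text \<open>Two copies in the same state with the same noise. Since \<open>2 * s \<le> \<rho>\<close>, the hypothesis with the
  factor \<open>2 - \<rho>\<close> implies the condition of \<open>em_step_powr_bound\<close> at the truncated points.\<close>

lemma (in truncated_scheme) em_contraction:
  assumes s: "0 < s" "s < 1" "2 * s \<le> \<rho>" and small: "\<Delta> * h \<Delta> \<le> 1"
    and mono: "\<And>x y. (norm (x - y))\<^sup>2 * psi_diff f g x y i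
          - (2 - \<rho>) * (norm ((x - y) v* (g x i - g y i)))\<^sup>2 \<le> \<beta> * norm (x - y) ^ 4"
    and pos: "0 \<le> 1 + s * \<Delta> * (\<beta> + step_error_const TYPE('d) * (\<Delta> * (h \<Delta>)\<^sup>2))"
  shows "(\<integral>\<^sup>+n. ennreal (norm (em x i n - em y i n) powr (2 * s)) \<partial>\<nu>)
    \<le> ennreal ((1 + s * \<Delta> * (\<beta> + step_error_const TYPE('d) * (\<Delta> * (h \<Delta>)\<^sup>2))) * norm (x - y) powr (2 * s))"
proof (cases "T i x = T i y")
  case False
  define e where "e = T i x - T i y"
  define F where "F = f (T i x) i - f (T i y) i"
  define G where "G = g (T i x) i - g (T i y) i"
  let ?c = "1 + s * \<Delta> * (\<beta> + step_error_const TYPE('d) * (\<Delta> * (h \<Delta>)\<^sup>2))"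
  have em: "em x i n - em y i n = e + \<Delta> *\<^sub>R F + G *v n" for n
    by (simp add: e_def F_def G_def scaleR_diff_right matrix_vector_mult_diff_rdistrib)
  have "(\<integral>\<^sup>+n. ennreal (norm (em x i n - em y i n) powr (2 * s)) \<partial>\<nu>) \<le> ennreal (norm e powr (2 * s) * ?c)"
    unfolding em
  proof (rule em_step_powr_bound[OF s(1,2) _ _ _ step_pos small])
    show "e \<noteq> 0" using False by (simp add: e_def)
    show "norm F \<le> h \<Delta> * norm e"
      unfolding F_def e_def by (rule truncation_lipschitz_drift[OF bound bound_le])
    show "(norm G)\<^sup>2 \<le> h \<Delta> * (norm e)\<^sup>2"
      unfolding G_def e_def by (rule truncation_lipschitz_diffusion[OF bound bound_le])
    have "(2 - \<rho>) * (norm (e v* G))\<^sup>2 \<le> (2 - 2 * s) * (norm (e v* G))\<^sup>2"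
      using s by (intro mult_right_mono) auto
    with mono[of "T i x" "T i y"]
    show "(norm e)\<^sup>2 * (2 * (e \<bullet> F) + (norm G)\<^sup>2) - (2 - 2 * s) * (norm (e v* G))\<^sup>2 \<le> \<beta> * norm e ^ 4"
      unfolding psi_diff_def e_def F_def G_def by linarith
  qed
  also have "\<dots> \<le> ennreal (norm (x - y) powr (2 * s) * ?c)"
  proof (intro ennreal_leI mult_right_mono pos powr_mono2)
    show "norm e \<le> norm (x - y)"
      using truncation_nonexpansive[OF bound bound_le, of i x y] by (simp add: e_def dist_norm)
  qed (use s in auto)
  finally show ?thesis by (simp only: mult.commute)
qed simp

theorem theorem4p11:
  fixes M :: "'w measure" and F :: "real \<Rightarrow> 'w measure"
    and B :: "real \<Rightarrow> 'w \<Rightarrow> real ^ 'd"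
    and r :: "'m::finite \<Rightarrow> real \<Rightarrow> 'w \<Rightarrow> 'm"
    and \<Gamma> :: "real ^ 'm ^ 'm" and \<pi> :: "real ^ 'm"
    and f :: "real ^ 'n \<Rightarrow> 'm \<Rightarrow> real ^ 'n"
    and g :: "real ^ 'n \<Rightarrow> 'm \<Rightarrow> real ^ 'd ^ 'n"
    and \<phi> :: "'m \<Rightarrow> real \<Rightarrow> real" and h :: "real \<Rightarrow> real" and x0 :: "real ^ 'n"
    and Q :: "real ^ 'n ^ 'n" and p \<rho> :: real and \<alpha> \<beta> :: "'m \<Rightarrow> real"
  assumes "prob_space M" and "complete_measure M" and "usual_filtration M F"
    and "brownian_motion M F B"
    and "generator_matrix \<Gamma>" and "irreducible_generator \<Gamma>" and "stationary_vector \<Gamma> \<pi>"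
    and "\<And>i. markov_chain M F \<Gamma> (r i)"
    and "\<And>i. AE \<omega> in M. r i 0 \<omega> = i"
    and "\<And>i. indep_processes M B (r i)"
    and loc_lip_f: "\<And>i R. \<exists>L. L-lipschitz_on (cball 0 R) (\<lambda>x. f x i)"
    and loc_lip_g: "\<And>i R. \<exists>L. L-lipschitz_on (cball 0 R) (\<lambda>x. g x i)"
    and "\<And>i. admissible_bound (\<lambda>x. f x i) (\<lambda>x. g x i) (\<phi> i)"
    and "admissible_step_function f g \<phi> x0 h"
    and "p > 0" and "transpose Q = Q" and "\<And>x. x \<noteq> 0 \<Longrightarrow> 0 < x \<bullet> (Q *v x)"
    and cond1: "\<And>i. Limsup at_infinity (\<lambda>x. ereal
          (((1 + x \<bullet> (Q *v x)) * psi Q f g x i - (2 - p) * (norm (x v* (Q ** g x i)))\<^sup>2)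
            / (x \<bullet> (Q *v x))\<^sup>2)) \<le> ereal (\<alpha> i)"
    and "\<rho> > 0"
    and cond2: "\<And>x y i. (norm (x - y))\<^sup>2 * psi_diff f g x y i
          - (2 - \<rho>) * (norm ((x - y) v* (g x i - g y i)))\<^sup>2 \<le> \<beta> i * norm (x - y) ^ 4"
    and cond3: "(\<Sum>i\<in>UNIV. \<pi> $ i * \<alpha> i) < 0" "(\<Sum>i\<in>UNIV. \<pi> $ i * \<beta> i) < 0"
  shows "\<exists>\<Delta>0. 0 < \<Delta>0 \<and> \<Delta>0 \<le> 1 \<and>
    (\<forall>\<Delta>. 0 < \<Delta> \<and> \<Delta> \<le> \<Delta>0 \<longrightarrow>
       (\<exists>!\<mu>. invariant_measure (Z_kernel M f g \<phi> h B r \<Delta>) \<mu>))"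
proof -
  note gen = \<open>generator_matrix \<Gamma>\<close> and irr = \<open>irreducible_generator \<Gamma>\<close> and st = \<open>stationary_vector \<Gamma> \<pi>\<close>
  note chain = \<open>\<And>i. markov_chain M F \<Gamma> (r i)\<close> and step = \<open>admissible_step_function f g \<phi> x0 h\<close>
  note bound = \<open>\<And>i. admissible_bound (\<lambda>x. f x i) (\<lambda>x. g x i) (\<phi> i)\<close>
  obtain P where P: "transition_function \<Gamma> P"
    using chain[of undefined] unfolding markov_chain_def by blast
  have cond_exp: "AE \<omega> in M. real_cond_exp M (F t) (indicator {\<omega> \<in> space M. r i (t + \<Delta>) \<omega> = j}) \<omega> = P \<Delta> $ r i t \<omega> $ j"
    if "0 \<le> t" "0 < \<Delta>" for i t \<Delta> j
  proof -
    obtain P' where P': "transition_function \<Gamma> P'"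
      and ce: "\<And>s t j. 0 \<le> s \<and> s \<le> t \<Longrightarrow>
        AE \<omega> in M. real_cond_exp M (F s) (indicator {\<omega> \<in> space M. r i t \<omega> = j}) \<omega> = P' (t - s) $ r i s \<omega> $ j"
      using chain[of i] unfolding markov_chain_def by blast
    have "P' \<Delta> = P \<Delta>" using transition_function_unique[OF P' P, of \<Delta>] that by simp
    then show ?thesis using ce[of t "t + \<Delta>" j] that by simp
  qed
  obtain s \<xi> where s: "0 < s" "2 * s \<le> 1" "2 * s \<le> \<rho>" and \<xi>: "\<And>i. 1 \<le> \<xi> i"
    and drift: "\<And>i. (\<Sum>j\<in>UNIV. \<Gamma> $ i $ j * \<xi> j) + s * \<beta> i * \<xi> i < 0"
    by (rule weights_exist[OF gen irr st cond3(2) \<open>0 < \<rho>\<close>]) blast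
  define e where "e \<Delta> = step_error_const TYPE('d) * (\<Delta> * (h \<Delta>)\<^sup>2)" for \<Delta>
  define c where "c \<Delta> i = 1 + s * \<Delta> * (\<beta> i + e \<Delta>)" for \<Delta> i
  have h2: "((\<lambda>\<Delta>. \<Delta> * (h \<Delta>)\<^sup>2) \<longlongrightarrow> 0) (at_right 0)"
    by (rule admissible_step_function_limit[OF step])
  have e0: "(e \<longlongrightarrow> 0) (at_right 0)"
    unfolding e_def using tendsto_mult_left[OF h2, of "step_error_const TYPE('d)"] by simp
  have c1: "((\<lambda>\<Delta>. c \<Delta> i) \<longlongrightarrow> 1 + s * 0 * (\<beta> i + 0)) (at_right 0)" for i
    unfolding c_def by (intro tendsto_intros e0)
  have "\<forall>\<^sub>F \<Delta> in at_right 0. \<forall>i. 0 < c \<Delta> i \<and> (\<Sum>j\<in>UNIV. P \<Delta> $ i $ j * \<xi> j) * c \<Delta> i < \<xi> i"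
  proof (rule eventually_all_finite)
    fix i
    have "\<forall>\<^sub>F \<Delta> in at_right 0. 0 < c \<Delta> i" by (rule order_tendstoD[OF c1]) simp
    moreover have "\<forall>\<^sub>F \<Delta> in at_right 0. (\<Sum>j\<in>UNIV. P \<Delta> $ i $ j * \<xi> j) * c \<Delta> i < \<xi> i"
      unfolding c_def by (rule eventually_weights_contract[OF P e0 drift])
    ultimately show "\<forall>\<^sub>F \<Delta> in at_right 0. 0 < c \<Delta> i \<and> (\<Sum>j\<in>UNIV. P \<Delta> $ i $ j * \<xi> j) * c \<Delta> i < \<xi> i"
      by (rule eventually_conj)
  qed
  moreover have "\<forall>\<^sub>F \<Delta> in at_right 0. \<Delta> * (h \<Delta>)\<^sup>2 < 1" by (rule order_tendstoD[OF h2]) simp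
  moreover have "\<forall>\<^sub>F \<Delta> in at_right 0. 1 \<le> h \<Delta>"
    using step by (simp add: admissible_step_function_def filterlim_at_top)
  ultimately have "\<forall>\<^sub>F \<Delta> in at_right 0. (\<forall>i. 0 < c \<Delta> i \<and> (\<Sum>j\<in>UNIV. P \<Delta> $ i $ j * \<xi> j) * c \<Delta> i < \<xi> i)
      \<and> \<Delta> * (h \<Delta>)\<^sup>2 < 1 \<and> 1 \<le> h \<Delta>"
    by (intro eventually_conj)
  then obtain d where d: "0 < d" and small: "\<And>\<Delta>. 0 < \<Delta> \<Longrightarrow> \<Delta> < d \<Longrightarrow>
      (\<forall>i. 0 < c \<Delta> i \<and> (\<Sum>j\<in>UNIV. P \<Delta> $ i $ j * \<xi> j) * c \<Delta> i < \<xi> i) \<and> \<Delta> * (h \<Delta>)\<^sup>2 < 1 \<and> 1 \<le> h \<Delta>"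
    unfolding eventually_at_right_field by auto
  have main: "\<exists>!\<mu>. invariant_measure (Z_kernel M f g \<phi> h B r \<Delta>) \<mu>"
    if \<Delta>: "0 < \<Delta>" "\<Delta> < d" "\<Delta> \<le> 1" for \<Delta>
  proof -
    note sm = small[OF \<Delta>(1,2)]
    have bound_le: "\<phi> i 1 \<le> h \<Delta>" for i
    proof -
      have "(MAX i. \<phi> i (max (norm x0) 1)) \<le> h \<Delta>"
        using step \<Delta> by (auto simp: admissible_step_function_def)
      then have "\<phi> i (max (norm x0) 1) \<le> h \<Delta>"
        using Max_ge[of "range (\<lambda>i. \<phi> i (max (norm x0) 1))" "\<phi> i (max (norm x0) 1)"] by force
      moreover have "\<phi> i 1 \<le> \<phi> i (max (norm x0) 1)"
        using bound[of i] unfolding admissible_bound_def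
      proof (elim disjE conjE exE)
        assume "strict_mono_on {0..} (\<phi> i)"
        then have "mono_on {0..} (\<phi> i)" by (rule strict_mono_on_imp_mono_on)
        then show ?thesis by (rule mono_onD) auto
      qed auto
      ultimately show ?thesis by linarith
    qed
    interpret truncated_scheme f g \<phi> h \<Delta>
      by unfold_locales
        (use loc_lip_f loc_lip_g bound bound_le \<Delta> in \<open>auto intro: continuous_on_of_locally_lipschitz\<close>)
    have "\<Delta> * h \<Delta> \<le> \<Delta> * (h \<Delta>)\<^sup>2"
      using sm \<Delta> by (simp add: power2_eq_square mult_left_mono)
    with sm have dh: "\<Delta> * h \<Delta> \<le> 1" by linarith
    \<comment> \<open>The strict inequalities for the finitely many states give a common rate, which depends on the step size.\<close>
    define \<gamma> where "\<gamma> = (MAX i. (\<Sum>j\<in>UNIV. P \<Delta> $ i $ j * \<xi> j) * c \<Delta> i / \<xi> i)"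
    have \<xi>0: "0 < \<xi> i" for i using \<xi>[of i] by linarith
    have \<gamma>ge: "(\<Sum>j\<in>UNIV. P \<Delta> $ i $ j * \<xi> j) * c \<Delta> i / \<xi> i \<le> \<gamma>" for i
      unfolding \<gamma>_def by (intro Max_ge) auto
    have Pn: "0 \<le> P \<Delta> $ i $ j" for i j using transition_nonneg[OF P] \<Delta> by simp
    have "0 \<le> (\<Sum>j\<in>UNIV. P \<Delta> $ i $ j * \<xi> j) * c \<Delta> i / \<xi> i" for i
      using sm \<xi>0 Pn by (intro divide_nonneg_pos mult_nonneg_nonneg sum_nonneg) (auto intro: less_imp_le)
    then have \<gamma>0: "0 \<le> \<gamma>" using \<gamma>ge order_trans by blast
    have \<gamma>1: "\<gamma> < 1"
      unfolding \<gamma>_def using sm \<xi>0 by (subst Max_less_iff) (auto simp: divide_less_eq)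
    interpret contractive_scheme f g \<phi> h \<Delta> "P \<Delta>" undefined s \<gamma> \<xi> "c \<Delta>"
    proof
      show "0 \<le> P \<Delta> $ i $ j" for i j by (rule Pn)
      show "(\<Sum>j\<in>UNIV. P \<Delta> $ i $ j) = 1" for i using transition_row_sum[OF P] \<Delta> by simp
      show "0 < P \<Delta> $ i $ undefined" for i by (rule transition_pos[OF P gen irr \<Delta>(1)])
      show "(\<integral>\<^sup>+n. ennreal (norm (em x i n - em y i n) powr (2 * s)) \<partial>\<nu>)
          \<le> ennreal (c \<Delta> i * norm (x - y) powr (2 * s))" for i x y
        unfolding c_def e_def
        by (rule em_contraction[where \<rho>=\<rho>]) (use s dh cond2 sm in \<open>auto simp: c_def e_def less_imp_le\<close>)
      show "(\<Sum>j\<in>UNIV. P \<Delta> $ i $ j * \<xi> j) * c \<Delta> i \<le> \<gamma> * \<xi> i" for i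
        using \<gamma>ge[of i] \<xi>0[of i] by (simp add: divide_le_eq)
    qed (use s \<xi> \<gamma>0 \<gamma>1 sm in \<open>auto intro: less_imp_le\<close>)
    have "switching_driver f g \<phi> h \<Delta> M F B (r i) (P \<Delta>)" for i
    proof (intro switching_driver.intro switching_driver_axioms.intro truncated_scheme_axioms)
      show "t \<ge> 0 \<Longrightarrow> r i t \<in> measurable (F t) (count_space UNIV)" for t
        using chain[of i] by (simp add: markov_chain_def)
    qed (use assms P_nonneg P_sum cond_exp \<Delta> in auto)
    then have "invariant_measure (Z_kernel M f g \<phi> h B r \<Delta>) \<mu> \<longleftrightarrow> R.stationary \<mu>" for \<mu>
      by (rule invariant_iff_stationary) fact
    with unique_stationary show ?thesis by simp
  qed
  show ?thesis
    by (rule exI[of _ "min 1 (d / 2)"]) (use d main in auto)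
qed

end
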